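(* Let $A$ and $B$ be finite square $\{0,1\}$-matrices, and assume that every row and every column of $A$ and $B$ is nonzero. There is a $*$-isomorphism $\Psi:\mathcal{O}_A\to\mathcal{O}_B$ satisfying $\Psi(\mathcal{D}_A)=\mathcal{D}_B$ and $\lambda^B_z\circ\Psi=\Psi\circ\lambda^A_z$ for all $z\in\mathbb{T}$ if and only if $(X_A,\sigma_A)$ and $(X_B,\sigma_B)$ are eventually one-sided conjugate.
   Context: Conventions: $\mathbb{N}=\{0,1,2,\dots\}$, $\mathbb{T}=\{z\in\mathbb{C}:|z|=1\}$. Let $A$ be a finite square $\{0,1\}$-matrix with index set $I$ and with every row and every column nonzero. Cuntz--Krieger algebra: $\mathcal{O}_A$ denotes the Cuntz--Krieger algebra of $A$; if $A$ does not satisfy condition (I), $\mathcal{O}_A$ denotes the universal Cuntz--Krieger algebra. Thus in all cases $\mathcal{O}_A$ is the universal $C^*$-algebra generated by partial isometries $\{S_i:i\in I\}$ satisfying $\sum_{j\in I}S_jS_j^*=1$ and $S_i^*S_i=\sum_{j\in I}A(i,j)S_jS_j^*$ for all $i\in I$. The gauge action $\lambda^A:\mathbb{T}\to\operatorname{Aut}(\mathcal{O}_A)$ is given by $\lambda^A_z(S_i)=zS_i$. $\mathcal{D}_A$ is the canonical abelian $C^*$-subalgebra of $\mathcal{O}_A$ generated by the elements $S_{i_1}\cdots S_{i_n}S_{i_n}^*\cdots S_{i_1}^*$, $n\ge 1$, $i_1,\dots,i_n\in I$. One-sided subshift: $X_A=\{(x_n)_{n\in\mathbb{N}}\in I^{\mathbb{N}}:A(x_n,x_{n+1})=1\text{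 for all }n\in\mathbb{N}\}$ with the topology induced from the product topology ($I$ discrete), and $\sigma_A:X_A\to X_A$ is the shift $(\sigma_A(x))_n=x_{n+1}$. $(X_A,\sigma_A)$ and $(X_B,\sigma_B)$ are eventually one-sided conjugate if there are a homeomorphism $h:X_A\to X_B$ and continuous maps $k:X_A\to\mathbb{N}$ and $k':X_B\to\mathbb{N}$ such that $\sigma_B^{k(x)}(h(\sigma_A(x)))=\sigma_B^{k(x)+1}(h(x))$ for all $x\in X_A$, and $\sigma_A^{k'(y)}(h^{-1}(\sigma_B(y)))=\sigma_A^{k'(y)+1}(h^{-1}(y))$ for all $y\in X_B$. *)

theory Defs
  imports "HOL-Analysis.Analysis" "HOL-Algebra.Module" "HOL-Library.Poly_Mapping"
begin

section \<open>Normed star-algebras as records\<close>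

record 'a star_algebra = "(complex, 'a) module" +
  star :: "'a \<Rightarrow> 'a"
  alg_norm :: "'a \<Rightarrow> real"

text \<open>Unital C*-algebras; the zero algebra is allowed.\<close>

locale cstar_algebra = ring R for R (structure) +
  assumes smult_closed [simp, intro]: "x \<in> carrier R \<Longrightarrow> c \<odot> x \<in> carrier R"
    and smult_l_distr: "x \<in> carrier R \<Longrightarrow> (c + d) \<odot> x = c \<odot> x \<oplus> d \<odot> x"
    and smult_r_distr: "x \<in> carrier R \<Longrightarrow> y \<in> carrier R \<Longrightarrow> c \<odot> (x \<oplus> y) = c \<odot> x \<oplus> c \<odot> y"
    and smult_assoc: "x \<in> carrier R \<Longrightarrow> (c * d) \<odot> x = c \<odot> (d \<odot> x)"
    and smult_one [simp]: "x \<in> carrier R \<Longrightarrow> 1 \<odot> x = x"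
    and smult_mult_l: "x \<in> carrier R \<Longrightarrow> y \<in> carrier R \<Longrightarrow> (c \<odot> x) \<otimes> y = c \<odot> (x \<otimes> y)"
    and smult_mult_r: "x \<in> carrier R \<Longrightarrow> y \<in> carrier R \<Longrightarrow> x \<otimes> (c \<odot> y) = c \<odot> (x \<otimes> y)"
    and star_closed [simp, intro]: "x \<in> carrier R \<Longrightarrow> star R x \<in> carrier R"
    and star_star [simp]: "x \<in> carrier R \<Longrightarrow> star R (star R x) = x"
    and star_add: "x \<in> carrier R \<Longrightarrow> y \<in> carrier R \<Longrightarrow> star R (x \<oplus> y) = star R x \<oplus> star R y"
    and star_smult: "x \<in> carrier R \<Longrightarrow> star R (c \<odot> x) = cnj c \<odot> star R x"
    and star_mult: "x \<in> carrier R \<Longrightarrow> y \<in> carrier R \<Longrightarrow> star R (x \<otimes> y) = star R y \<otimes> star R x"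
    and norm_zero_iff: "x \<in> carrier R \<Longrightarrow> alg_norm R x = 0 \<longleftrightarrow> x = \<zero>"
    and norm_add: "x \<in> carrier R \<Longrightarrow> y \<in> carrier R \<Longrightarrow> alg_norm R (x \<oplus> y) \<le> alg_norm R x + alg_norm R y"
    and norm_smult: "x \<in> carrier R \<Longrightarrow> alg_norm R (c \<odot> x) = cmod c * alg_norm R x"
    and norm_mult: "x \<in> carrier R \<Longrightarrow> y \<in> carrier R \<Longrightarrow> alg_norm R (x \<otimes> y) \<le> alg_norm R x * alg_norm R y"
    and cstar_identity: "x \<in> carrier R \<Longrightarrow> alg_norm R (star R x \<otimes> x) = (alg_norm R x)\<^sup>2"
    and complete: "(\<And>n::nat. f n \<in> carrier R) \<Longrightarrow>
      (\<And>e. e > 0 \<Longrightarrow> \<exists>M. \<forall>m\<ge>M. \<forall>n\<ge>M. alg_norm R (f m \<ominus> f n) < e) \<Longrightarrow>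
      \<exists>l\<in>carrier R. (\<lambda>n. alg_norm R (f n \<ominus> l)) \<longlonglongrightarrow> 0"

definition star_hom ::
  "('a, 'm) star_algebra_scheme \<Rightarrow> ('b, 'n) star_algebra_scheme \<Rightarrow> ('a \<Rightarrow> 'b) set" where
  "star_hom R S = {\<phi> \<in> ring_hom R S.
     (\<forall>c. \<forall>x\<in>carrier R. \<phi> (c \<odot>\<^bsub>R\<^esub> x) = c \<odot>\<^bsub>S\<^esub> \<phi> x) \<and>
     (\<forall>x\<in>carrier R. \<phi> (star R x) = star S (\<phi> x))}"

definition star_iso ::
  "('a, 'm) star_algebra_scheme \<Rightarrow> ('b, 'n) star_algebra_scheme \<Rightarrow> ('a \<Rightarrow> 'b) set" where
  "star_iso R S = {\<phi> \<in> star_hom R S. bij_betw \<phi> (carrier R) (carrier S)}"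

definition cstar_subalgebra :: "'a set \<Rightarrow> 'a star_algebra \<Rightarrow> bool" where
  "cstar_subalgebra D R \<longleftrightarrow>
     D \<subseteq> carrier R \<and> \<zero>\<^bsub>R\<^esub> \<in> D \<and>
     (\<forall>x\<in>D. \<forall>y\<in>D. x \<oplus>\<^bsub>R\<^esub> y \<in> D) \<and>
     (\<forall>c. \<forall>x\<in>D. c \<odot>\<^bsub>R\<^esub> x \<in> D) \<and>
     (\<forall>x\<in>D. \<forall>y\<in>D. x \<otimes>\<^bsub>R\<^esub> y \<in> D) \<and>
     (\<forall>x\<in>D. star R x \<in> D) \<and>
     (\<forall>f l. (\<forall>n::nat. f n \<in> D) \<and> l \<in> carrier R \<and>
        (\<lambda>n. alg_norm R (f n \<ominus>\<^bsub>R\<^esub> l)) \<longlonglongrightarrow> 0 \<longrightarrow> l \<in> D)"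

definition cstar_generated :: "'a star_algebra \<Rightarrow> 'a set \<Rightarrow> 'a set" where
  "cstar_generated R X = \<Inter>{D. cstar_subalgebra D R \<and> X \<subseteq> D}"

section \<open>Hausdorff completion of a seminormed star-algebra\<close>

text \<open>Elements are classes of \<open>N\<close>-Cauchy sequences modulo \<open>N\<close>-null sequences; in particular the
  elements of seminorm zero are divided out. The operations act on representatives.\<close>

definition cauchy_seqs :: "('a::ring_1 \<Rightarrow> real) \<Rightarrow> (nat \<Rightarrow> 'a) set" where
  "cauchy_seqs N = {X. \<forall>e>0. \<exists>M. \<forall>m\<ge>M. \<forall>n\<ge>M. N (X m - X n) < e}"

definition null_rel :: "('a::ring_1 \<Rightarrow> real) \<Rightarrow> ((nat \<Rightarrow> 'a) \<times> (nat \<Rightarrow> 'a)) set" where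
  "null_rel N = {(X, Y). X \<in> cauchy_seqs N \<and> Y \<in> cauchy_seqs N \<and> (\<lambda>n. N (X n - Y n)) \<longlonglongrightarrow> 0}"

definition class_rep :: "(nat \<Rightarrow> 'a) set \<Rightarrow> nat \<Rightarrow> 'a" where
  "class_rep a = (SOME X. X \<in> a)"

definition const_class :: "('a::ring_1 \<Rightarrow> real) \<Rightarrow> 'a \<Rightarrow> (nat \<Rightarrow> 'a) set" where
  "const_class N x = null_rel N `` {\<lambda>_. x}"

definition extend1 ::
  "('a::ring_1 \<Rightarrow> real) \<Rightarrow> ('a \<Rightarrow> 'a) \<Rightarrow> (nat \<Rightarrow> 'a) set \<Rightarrow> (nat \<Rightarrow> 'a) set" where
  "extend1 N f a = null_rel N `` {\<lambda>n. f (class_rep a n)}"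

definition extend2 ::
  "('a::ring_1 \<Rightarrow> real) \<Rightarrow> ('a \<Rightarrow> 'a \<Rightarrow> 'a) \<Rightarrow> (nat \<Rightarrow> 'a) set \<Rightarrow> (nat \<Rightarrow> 'a) set \<Rightarrow> (nat \<Rightarrow> 'a) set" where
  "extend2 N f a b = null_rel N `` {\<lambda>n. f (class_rep a n) (class_rep b n)}"

definition seminorm_completion ::
  "('a::ring_1 \<Rightarrow> real) \<Rightarrow> (complex \<Rightarrow> 'a \<Rightarrow> 'a) \<Rightarrow> ('a \<Rightarrow> 'a) \<Rightarrow> (nat \<Rightarrow> 'a) set star_algebra" where
  "seminorm_completion N sc st =
     \<lparr>carrier = cauchy_seqs N // null_rel N,
      mult = extend2 N (*), one = const_class N 1,
      zero = const_class N 0, add = extend2 N (+),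
      smult = (\<lambda>c. extend1 N (sc c)),
      star = extend1 N st,
      alg_norm = (\<lambda>a. lim (\<lambda>n. N (class_rep a n)))\<rparr>"

section \<open>The free unital star-algebra\<close>

datatype 'i letter = Gen 'i | Adj 'i

text \<open>The free monoid on the letters is written additively, because multiplication of finitely
  supported functions (convolution) is taken with respect to \<open>+\<close> on the index type.\<close>

datatype 'i star_word = Word (letters: "'i letter list")

instantiation star_word :: (type) monoid_add
begin
definition zero_star_word :: "'a star_word" where "0 = Word []"
definition plus_star_word :: "'a star_word \<Rightarrow> 'a star_word \<Rightarrow> 'a star_word" where
  "u + v = Word (letters u @ letters v)"
instance by standard (auto simp: zero_star_word_def plus_star_word_def)
end

type_synonym 'i free_algebra = "'i star_word \<Rightarrow>\<^sub>0 complex"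

definition gen :: "'i \<Rightarrow> 'i free_algebra" where
  "gen i = Poly_Mapping.single (Word [Gen i]) 1"

definition adj :: "'i \<Rightarrow> 'i free_algebra" where
  "adj i = Poly_Mapping.single (Word [Adj i]) 1"

definition free_scale :: "complex \<Rightarrow> 'i free_algebra \<Rightarrow> 'i free_algebra" where
  "free_scale c x = Poly_Mapping.single 0 c * x"

fun letter_star :: "'i letter \<Rightarrow> 'i letter" where
  "letter_star (Gen i) = Adj i"
| "letter_star (Adj i) = Gen i"

definition word_star :: "'i star_word \<Rightarrow> 'i star_word" where
  "word_star w = Word (rev (map letter_star (letters w)))"

definition free_star :: "'i free_algebra \<Rightarrow> 'i free_algebra" where
  "free_star x = (\<Sum>w\<in>Poly_Mapping.keys x.
     Poly_Mapping.single (word_star w) (cnj (Poly_Mapping.lookup x w)))"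

definition cstar_seminorm :: "('i free_algebra \<Rightarrow> real) \<Rightarrow> bool" where
  "cstar_seminorm p \<longleftrightarrow>
     (\<forall>x y. p (x + y) \<le> p x + p y) \<and>
     (\<forall>c x. p (free_scale c x) = cmod c * p x) \<and>
     (\<forall>x y. p (x * y) \<le> p x * p y) \<and>
     (\<forall>x. p (free_star x * x) = (p x)\<^sup>2)"

section \<open>Cuntz--Krieger algebras\<close>

definition ck_relators :: "nat^'i^'i \<Rightarrow> 'i::finite free_algebra set" where
  "ck_relators A =
     {gen i * adj i * gen i - gen i | i. True} \<union>
     {(\<Sum>j\<in>UNIV. gen j * adj j) - 1} \<union>
     {adj i * gen i - (\<Sum>j\<in>UNIV. of_nat (A $ i $ j) * (gen j * adj j)) | i. True}"

text \<open>The universal C*-seminorm of the relations. Every admissible seminorm is at most 1 on the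
  generators, so the supremum is finite (\<open>ck_seminorms_bdd\<close>); the zero seminorm is admissible,
  so the supremum is over a nonempty set.\<close>

definition ck_norm :: "nat^'i^'i \<Rightarrow> 'i::finite free_algebra \<Rightarrow> real" where
  "ck_norm A x = (SUP p\<in>{p. cstar_seminorm p \<and> (\<forall>r\<in>ck_relators A. p r = 0)}. p x)"

text \<open>The universal C*-algebra of the Cuntz--Krieger relations, as the completion of the free unital
  star-algebra in the universal C*-seminorm. Its defining properties are proved below:
  \<open>ck_algebra_cstar\<close>, \<open>ck_gen_family\<close>, \<open>ck_gen_generates\<close>
  and \<open>ck_algebra_universal\<close>.\<close>

type_synonym 'i ck_element = "(nat \<Rightarrow> 'i free_algebra) set"

definition ck_algebra :: "nat^'i^'i \<Rightarrow> 'i::finite ck_element star_algebra" where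
  "ck_algebra A = seminorm_completion (ck_norm A) free_scale free_star"

definition ck_gen :: "nat^'i^'i \<Rightarrow> 'i::finite \<Rightarrow> 'i ck_element" where
  "ck_gen A i = const_class (ck_norm A) (gen i)"

text \<open>\<open>path_proj A [i\<^sub>1, \<dots>, i\<^sub>n]\<close> is
  \<open>S\<^bsub>i\<^sub>1\<^esub> \<cdots> S\<^bsub>i\<^sub>n\<^esub> S\<^bsub>i\<^sub>n\<^esub>* \<cdots> S\<^bsub>i\<^sub>1\<^esub>*\<close>, bracketed from the inside out.\<close>

definition path_proj :: "nat^'i^'i \<Rightarrow> 'i::finite list \<Rightarrow> 'i ck_element" where
  "path_proj A \<mu> = foldr (\<lambda>i e. ck_gen A i \<otimes>\<^bsub>ck_algebra A\<^esub> e \<otimes>\<^bsub>ck_algebra A\<^esub> star (ck_algebra A) (ck_gen A i))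
     \<mu> \<one>\<^bsub>ck_algebra A\<^esub>"

definition ck_diagonal :: "nat^'i^'i \<Rightarrow> 'i::finite ck_element set" where
  "ck_diagonal A = cstar_generated (ck_algebra A) {path_proj A \<mu> | \<mu>. \<mu> \<noteq> []}"

text \<open>On the free algebra, the gauge automorphism multiplies a word by \<open>z\<close> to the number of
  generators minus the number of adjoints; see \<open>gauge_action_iso\<close> and
  \<open>gauge_action_gen\<close>. It is only meaningful for \<open>cmod z = 1\<close>.\<close>

fun letter_degree :: "'i letter \<Rightarrow> int" where
  "letter_degree (Gen i) = 1"
| "letter_degree (Adj i) = - 1"

definition word_degree :: "'i star_word \<Rightarrow> int" where
  "word_degree w = sum_list (map letter_degree (letters w))"

definition free_gauge :: "complex \<Rightarrow> 'i free_algebra \<Rightarrow> 'i free_algebra" where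
  "free_gauge z = Poly_Mapping.mapp (\<lambda>w c. z powi word_degree w * c)"

definition gauge_action :: "nat^'i^'i \<Rightarrow> complex \<Rightarrow> 'i::finite ck_element \<Rightarrow> 'i ck_element" where
  "gauge_action A z = extend1 (ck_norm A) (free_gauge z)"

section \<open>One-sided topological Markov shifts\<close>

definition shift_space :: "nat^'i^'i \<Rightarrow> (nat \<Rightarrow> 'i::finite) set" where
  "shift_space A = {x. \<forall>n. A $ x n $ x (Suc n) = 1}"

definition shift_topology :: "nat^'i^'i \<Rightarrow> (nat \<Rightarrow> 'i::finite) topology" where
  "shift_topology A =
     subtopology (product_topology (\<lambda>_. discrete_topology UNIV) UNIV) (shift_space A)"

definition shift :: "(nat \<Rightarrow> 'i) \<Rightarrow> (nat \<Rightarrow> 'i)" where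
  "shift x = (\<lambda>n. x (Suc n))"

definition eventually_conjugate :: "nat^'i^'i \<Rightarrow> nat^'j^'j \<Rightarrow> bool" where
  "eventually_conjugate (A :: nat^'i^'i::finite) (B :: nat^'j^'j::finite) \<longleftrightarrow>
     (\<exists>h h' k k'.
        homeomorphic_maps (shift_topology A) (shift_topology B) h h' \<and>
        continuous_map (shift_topology A) (discrete_topology (UNIV :: nat set)) k \<and>
        continuous_map (shift_topology B) (discrete_topology (UNIV :: nat set)) k' \<and>
        (\<forall>x\<in>shift_space A. (shift ^^ k x) (h (shift x)) = (shift ^^ (k x + 1)) (h x)) \<and>
        (\<forall>y\<in>shift_space B. (shift ^^ k' y) (h' (shift y)) = (shift ^^ (k' y + 1)) (h' y)))"

section \<open>Universality of the construction\<close>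

lemma free_induct [case_names zero single add]:
  fixes x :: "'k \<Rightarrow>\<^sub>0 'b::comm_monoid_add"
  assumes "P 0" "\<And>w c. P (Poly_Mapping.single w c)" "\<And>x y. P x \<Longrightarrow> P y \<Longrightarrow> P (x + y)"
  shows "P x"
proof -
  have eq: "x = (\<Sum>w\<in>Poly_Mapping.keys x. Poly_Mapping.single w (Poly_Mapping.lookup x w))"
    by (rule poly_mapping_eqI)
       (simp add: lookup_sum lookup_single when_def if_distrib in_keys_iff sum.delta cong: if_cong)
  have "P (\<Sum>w\<in>K. Poly_Mapping.single w (Poly_Mapping.lookup x w))" if "finite K" for K
    using that by (induction K) (auto intro: assms)
  then show ?thesis using eq finite_keys by metis
qed

lemma word_star_star [simp]: "word_star (word_star w) = w"
proof -
  have "letter_star (letter_star l) = l" for l :: "'a letter" by (cases l) auto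
  then show ?thesis by (cases w) (simp add: word_star_def rev_map o_def)
qed

lemma word_star_add: "word_star (u + v) = word_star v + word_star u"
  by (simp add: word_star_def plus_star_word_def)

lemma word_star_zero [simp]: "word_star 0 = 0"
  by (simp add: word_star_def zero_star_word_def)

lemma lookup_free_star:
  "Poly_Mapping.lookup (free_star x) w = cnj (Poly_Mapping.lookup x (word_star w))"
proof -
  have "Poly_Mapping.lookup (free_star x) w =
      (\<Sum>v\<in>Poly_Mapping.keys x. if v = word_star w then cnj (Poly_Mapping.lookup x v) else 0)"
    unfolding free_star_def lookup_sum lookup_single when_def
    by (rule sum.cong) (auto simp: dest: arg_cong[where f=word_star])
  then show ?thesis by (simp add: in_keys_iff)
qed

lemma free_star_zero [simp]: "free_star 0 = 0"
  by (simp add: free_star_def)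

lemma free_star_add: "free_star (x + y) = free_star x + free_star y"
  by (rule poly_mapping_eqI) (simp add: lookup_free_star lookup_add)

lemma free_star_single [simp]:
  "free_star (Poly_Mapping.single w c) = Poly_Mapping.single (word_star w) (cnj c)"
  by (rule poly_mapping_eqI) (auto simp: lookup_free_star lookup_single when_def)

lemma free_star_star [simp]: "free_star (free_star x) = x"
  by (rule poly_mapping_eqI) (simp add: lookup_free_star)

lemma free_star_mult: "free_star (x * y) = free_star y * free_star x"
proof (induction x rule: free_induct)
  case (single w c)
  show ?case
    by (induction y rule: free_induct)
       (auto simp: mult_single word_star_add free_star_add algebra_simps)
qed (auto simp: free_star_add algebra_simps)

lemma free_star_scale: "free_star (free_scale c x) = free_scale (cnj c) (free_star x)"
  unfolding free_scale_def free_star_mult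
  by (induction x rule: free_induct) (auto simp: mult_single free_star_add algebra_simps)

lemma free_scale_central: "x * free_scale c y = free_scale c (x * y)"
proof -
  have "x * Poly_Mapping.single 0 c = Poly_Mapping.single 0 c * x" for x :: "'a free_algebra"
    by (induction x rule: free_induct) (auto simp: mult_single algebra_simps)
  then show ?thesis unfolding free_scale_def by (metis mult.assoc)
qed

lemma free_gauge_lookup:
  "Poly_Mapping.lookup (free_gauge z x) w = z powi word_degree w * Poly_Mapping.lookup x w"
  by (simp add: free_gauge_def lookup_mapp when_def in_keys_iff)

lemma word_degree_add: "word_degree (u + v) = word_degree u + word_degree v"
  by (simp add: word_degree_def plus_star_word_def)

lemma word_degree_star: "word_degree (word_star w) = - word_degree w"
proof -
  have *: "letter_degree (letter_star l) = - letter_degree l" for l :: "'a letter" by (cases l) auto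
  have "sum_list (map letter_degree (map letter_star l)) = - sum_list (map letter_degree l)"
    for l :: "'a letter list"
    by (induction l) (auto simp: *)
  then show ?thesis by (simp add: word_degree_def word_star_def rev_map [symmetric] sum_list_rev)
qed

lemma free_gauge_zero [simp]: "free_gauge z 0 = 0"
  by (rule poly_mapping_eqI) (simp add: free_gauge_lookup)

lemma free_gauge_add: "free_gauge z (x + y) = free_gauge z x + free_gauge z y"
  by (rule poly_mapping_eqI) (simp add: free_gauge_lookup lookup_add algebra_simps)

lemma free_gauge_minus: "free_gauge z (x - y) = free_gauge z x - free_gauge z y"
  by (rule poly_mapping_eqI) (simp add: free_gauge_lookup lookup_minus algebra_simps)

lemma free_gauge_single [simp]:
  "free_gauge z (Poly_Mapping.single w c) = Poly_Mapping.single w (z powi word_degree w * c)"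
  by (rule poly_mapping_eqI) (auto simp: free_gauge_lookup lookup_single when_def)

lemma free_gauge_mult:
  assumes "z \<noteq> 0" shows "free_gauge z (x * y) = free_gauge z x * free_gauge z y"
proof (induction x rule: free_induct)
  case (single w c)
  show ?case
    by (induction y rule: free_induct)
       (use assms in \<open>auto simp: mult_single word_degree_add power_int_add free_gauge_add algebra_simps\<close>)
qed (auto simp: free_gauge_add algebra_simps)

lemma word_degree_zero [simp]: "word_degree 0 = 0"
  by (simp add: word_degree_def zero_star_word_def)

lemma free_gauge_scale: "free_gauge z (free_scale c x) = free_scale c (free_gauge z x)"
  unfolding free_scale_def
  by (induction x rule: free_induct) (auto simp: mult_single free_gauge_add algebra_simps)

lemma free_gauge_star:
  fixes x :: "'i free_algebra"
  assumes "cmod z = 1" shows "free_gauge z (free_star x) = free_star (free_gauge z x)"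
proof (rule poly_mapping_eqI)
  fix w :: "'i star_word"
  have "z \<noteq> 0" "cnj z = inverse z" using assms by (auto simp: divide_conv_cnj inverse_eq_divide)
  then have "cnj (z powi (- word_degree w)) = z powi word_degree w"
    by (simp add: power_int_minus power_int_inverse)
  then show "Poly_Mapping.lookup (free_gauge z (free_star x)) w =
      Poly_Mapping.lookup (free_star (free_gauge z x)) w"
    by (simp add: free_gauge_lookup lookup_free_star word_degree_star)
qed

lemma free_gauge_gauge:
  assumes "z \<noteq> 0" "z' \<noteq> 0" shows "free_gauge z (free_gauge z' x) = free_gauge (z * z') x"
  by (rule poly_mapping_eqI) (simp add: free_gauge_lookup power_int_mult_distrib)

lemma free_gauge_1 [simp]: "free_gauge 1 x = x"
  by (rule poly_mapping_eqI) (simp add: free_gauge_lookup)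

lemma cstar_seminormD:
  assumes "cstar_seminorm p"
  shows "p (x + y) \<le> p x + p y" "p (free_scale c x) = cmod c * p x" "p (x * y) \<le> p x * p y"
    "p (free_star x * x) = (p x)\<^sup>2" "p 0 = 0" "p (- x) = p x" "p (x - y) \<le> p x + p y" "0 \<le> p x"
    "p (free_star x) = p x"
proof -
  show 1: "\<And>x y. p (x + y) \<le> p x + p y" and 2: "\<And>c x. p (free_scale c x) = cmod c * p x"
    and 3: "\<And>x y. p (x * y) \<le> p x * p y"
    and 4: "\<And>x. p (free_star x * x) = (p x)\<^sup>2" using assms by (auto simp: cstar_seminorm_def)
  show 5: "p 0 = 0" using 2[of 0 0] by (simp add: free_scale_def)
  have "free_scale (- 1) x = - x" for x :: "'a free_algebra"
    by (simp add: free_scale_def single_uminus)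
  then show 6: "\<And>x. p (- x) = p x" using 2[of "-1"] by auto
  show "p (x - y) \<le> p x + p y" using 1[of x "- y"] 6 by simp
  show 8: "\<And>x. 0 \<le> p x" using 1[of x "- x" for x] 5 6 by (smt (verit) add.right_inverse)
  have 9: "p x \<le> p (free_star x)" for x
  proof (cases "p x = 0")
    case False
    then have "p x > 0" using 8[of x] by simp
    moreover have "p x * p x \<le> p (free_star x) * p x" using 3[of "free_star x" x] 4[of x]
      by (simp add: power2_eq_square)
    ultimately show ?thesis by simp
  qed (simp add: 8)
  show "p (free_star x) = p x" using 9[of x] 9[of "free_star x"] by simp
qed

lemma free_star_gen [simp]: "free_star (gen i) = adj i" "free_star (adj i) = gen i"
  by (auto simp: gen_def adj_def word_star_def)

lemma free_scale_simps:
  "free_scale c (x + y) = free_scale c x + free_scale c y"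
  "free_scale c (x - y) = free_scale c x - free_scale c y"
  "free_scale (c + d) x = free_scale c x + free_scale d x"
  "free_scale c (free_scale d x) = free_scale (c * d) x"
  "free_scale 1 x = x"
  "free_scale c x * y = free_scale c (x * y)"
  by (auto simp: free_scale_def algebra_simps single_add mult_single simp flip: mult.assoc)

abbreviation "ck_seminorms A \<equiv> {p. cstar_seminorm p \<and> (\<forall>r\<in>ck_relators A. p r = 0)}"

lemma ck_seminorm_gen_le:
  assumes "p \<in> ck_seminorms A" shows "p (gen i) \<le> 1"
proof -
  note p = cstar_seminormD[of p] assms
  have s: "cstar_seminorm p" using assms by simp
  let ?q = "adj i * gen i"
  have r: "p (gen i * adj i * gen i - gen i) = 0" using assms by (auto simp: ck_relators_def)
  have "p (?q * ?q - ?q) \<le> p (adj i) * p (gen i * adj i * gen i - gen i)"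
    using cstar_seminormD(3)[OF s, of "adj i" "gen i * adj i * gen i - gen i"]
    by (simp add: algebra_simps)
  then have "p (?q * ?q - ?q) = 0" using r cstar_seminormD(8)[OF s] by (simp add: antisym)
  then have "p (?q * ?q) \<le> p ?q" using cstar_seminormD(1)[OF s, of "?q * ?q - ?q" ?q] by simp
  moreover have "p (?q * ?q) = (p ?q)\<^sup>2"
    using cstar_seminormD(4)[OF s, of ?q] by (simp add: free_star_mult)
  moreover have "p ?q = (p (gen i))\<^sup>2" using cstar_seminormD(4)[OF s, of "gen i"] by simp
  ultimately have "p ?q * p ?q \<le> p ?q" by (simp add: power2_eq_square)
  have "p ?q \<le> 1"
  proof (rule ccontr)
    assume "\<not> p ?q \<le> 1"
    then have "1 * p ?q < p ?q * p ?q" by (intro mult_strict_right_mono) auto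
    then show False using \<open>p ?q * p ?q \<le> p ?q\<close> by simp
  qed
  then show ?thesis using \<open>p ?q = _\<close> cstar_seminormD(8)[OF s] by (simp add: power_le_one_iff)
qed

lemma ck_seminorm_bounded: "\<exists>K. \<forall>p\<in>ck_seminorms A. p x \<le> K"
proof (induction x rule: free_induct)
  case zero
  show ?case by (rule exI[of _ 0]) (auto simp: cstar_seminormD)
next
  case (add x y)
  then obtain K L where "\<forall>p\<in>ck_seminorms A. p x \<le> K" "\<forall>p\<in>ck_seminorms A. p y \<le> L" by auto
  then show ?case by (intro exI[of _ "K + L"]) (smt (verit) cstar_seminormD(1) mem_Collect_eq)
next
  case (single w c)
  have *: "p (Poly_Mapping.single (Word ls) 1) \<le> 1" if "p \<in> ck_seminorms A" for p ls
  proof (induction ls)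
    case Nil
    have s: "cstar_seminorm p" using that by auto
    have e: "Poly_Mapping.single (Word []) (1::complex) = 1"
      by (simp add: zero_star_word_def[symmetric])
    have "free_star 1 = (1 :: 'a free_algebra)"
      using free_star_single[of 0 1] by (simp del: free_star_single)
    then have "(p 1)\<^sup>2 = p 1" using cstar_seminormD(4)[OF s, of 1] by simp
    then show ?case unfolding e by (auto simp: power2_eq_square)
  next
    case (Cons l ls)
    have s: "cstar_seminorm p" using that by auto
    have "p (Poly_Mapping.single (Word [l]) 1) \<le> 1"
    proof (cases l)
      case (Gen i) then show ?thesis using ck_seminorm_gen_le[OF that, of i] by (simp add: gen_def)
    next
      case (Adj i) then show ?thesis
        using ck_seminorm_gen_le[OF that, of i] cstar_seminormD(9)[OF s, of "gen i"]
        by (simp add: adj_def)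
    qed
    moreover have "Poly_Mapping.single (Word (l # ls)) 1 =
        Poly_Mapping.single (Word [l]) (1::complex) * Poly_Mapping.single (Word ls) 1"
      by (simp add: mult_single plus_star_word_def)
    ultimately show ?case using Cons cstar_seminormD(3,8)[OF s]
      by (smt (verit) mult_le_one)
  qed
  have w: "Poly_Mapping.single w c = free_scale c (Poly_Mapping.single (Word (letters w)) 1)"
    by (simp add: free_scale_def mult_single)
  have "\<forall>p\<in>ck_seminorms A. p (Poly_Mapping.single w c) \<le> cmod c"
  proof
    fix p assume p: "p \<in> ck_seminorms A"
    then have "p (Poly_Mapping.single w c) = cmod c * p (Poly_Mapping.single (Word (letters w)) 1)"
      unfolding w by (intro cstar_seminormD(2)) simp
    then show "p (Poly_Mapping.single w c) \<le> cmod c" using *[OF p] by (metis mult_left_le norm_ge_zero)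
  qed
  then show ?case by blast
qed

lemma ck_seminorms_bdd: "bdd_above ((\<lambda>p. p x) ` ck_seminorms A)"
  using ck_seminorm_bounded[of A x] by (auto simp: bdd_above_def)

lemma ck_seminorms_nonempty: "(\<lambda>_. 0) \<in> ck_seminorms A"
  by (simp add: cstar_seminorm_def)

lemma ck_norm_upper: "p \<in> ck_seminorms A \<Longrightarrow> p x \<le> ck_norm A x"
  unfolding ck_norm_def by (rule cSUP_upper[OF _ ck_seminorms_bdd])

lemma ck_norm_least: "(\<And>p. p \<in> ck_seminorms A \<Longrightarrow> p x \<le> K) \<Longrightarrow> ck_norm A x \<le> K"
  unfolding ck_norm_def by (rule cSUP_least) (use ck_seminorms_nonempty in auto)

lemma ck_norm_nonneg: "0 \<le> ck_norm A x"
  using ck_norm_upper[OF ck_seminorms_nonempty] .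

lemma ck_norm_seminorm: "ck_norm A \<in> ck_seminorms A"
proof -
  have sc_le: "ck_norm A (free_scale c x) \<le> cmod c * ck_norm A x" for c x
    by (rule ck_norm_least) (auto simp: cstar_seminormD intro!: mult_left_mono ck_norm_upper)
  have sc: "ck_norm A (free_scale c x) = cmod c * ck_norm A x" for c x
  proof (cases "c = 0")
    case True then show ?thesis using sc_le[of c x] ck_norm_nonneg[of A "free_scale c x"] by simp
  next
    case False
    have "ck_norm A x \<le> cmod (inverse c) * ck_norm A (free_scale c x)"
      using sc_le[of "inverse c" "free_scale c x"] False by (simp add: free_scale_simps)
    then have "cmod c * ck_norm A x \<le> cmod c * (cmod (inverse c) * ck_norm A (free_scale c x))"
      by (intro mult_left_mono) auto
    also have "\<dots> = (cmod c * cmod (inverse c)) * ck_norm A (free_scale c x)" by simp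
    also have "cmod c * cmod (inverse c) = 1" using False by (simp flip: norm_mult)
    finally show ?thesis using sc_le[of c x] by simp
  qed
  have mul: "ck_norm A (x * y) \<le> ck_norm A x * ck_norm A y" for x y
  proof (rule ck_norm_least)
    fix p assume p: "p \<in> ck_seminorms A"
    then have s: "cstar_seminorm p" by simp
    have "p (x * y) \<le> p x * p y" by (rule cstar_seminormD(3)[OF s])
    also have "\<dots> \<le> ck_norm A x * ck_norm A y"
      by (intro mult_mono ck_norm_upper p ck_norm_nonneg cstar_seminormD(8)[OF s])
    finally show "p (x * y) \<le> ck_norm A x * ck_norm A y" .
  qed
  have "ck_norm A (free_star x) \<le> ck_norm A x" for x
    by (rule ck_norm_least) (auto simp: cstar_seminormD(9) intro!: ck_norm_upper)
  then have "ck_norm A (free_star x * x) \<le> (ck_norm A x)\<^sup>2" for x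
    using mul[of "free_star x" x] ck_norm_nonneg[of A x]
    by (smt (verit) mult_right_mono power2_eq_square)
  moreover have "(ck_norm A x)\<^sup>2 \<le> ck_norm A (free_star x * x)" for x
  proof -
    have "ck_norm A x \<le> sqrt (ck_norm A (free_star x * x))"
    proof (rule ck_norm_least)
      fix p assume p: "p \<in> ck_seminorms A"
      then have "(p x)\<^sup>2 \<le> ck_norm A (free_star x * x)"
        using ck_norm_upper[OF p, of "free_star x * x"] cstar_seminormD(4)[of p x] by auto
      then show "p x \<le> sqrt (ck_norm A (free_star x * x))" by (rule real_le_rsqrt)
    qed
    then have "(ck_norm A x)\<^sup>2 \<le> (sqrt (ck_norm A (free_star x * x)))\<^sup>2"
      by (rule power_mono[OF _ ck_norm_nonneg])
    then show ?thesis by (simp add: ck_norm_nonneg)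
  qed
  moreover have "ck_norm A (x + y) \<le> ck_norm A x + ck_norm A y" for x y
  proof (rule ck_norm_least)
    fix p assume p: "p \<in> ck_seminorms A"
    then have s: "cstar_seminorm p" by simp
    show "p (x + y) \<le> ck_norm A x + ck_norm A y"
      using cstar_seminormD(1)[OF s, of x y] ck_norm_upper[OF p, of x] ck_norm_upper[OF p, of y]
      by linarith
  qed
  moreover have "ck_norm A r = 0" if "r \<in> ck_relators A" for r
    by (rule antisym[OF ck_norm_least ck_norm_nonneg]) (use that in auto)
  ultimately show ?thesis using sc mul by (auto simp: cstar_seminorm_def antisym)
qed

lemma free_gauge_gen: "free_gauge z (gen i) = free_scale z (gen i)"
   "free_gauge z (adj i) = free_scale (inverse z) (adj i)"
  by (auto simp: gen_def adj_def free_scale_def mult_single word_degree_def power_int_minus)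

lemma ck_norm_gauge:
  assumes "cmod z = 1" shows "ck_norm A (free_gauge z x) = ck_norm A x"
proof -
  have le: "ck_norm A (free_gauge z x) \<le> ck_norm A x" if z: "cmod z = 1" for z x
  proof -
    have z0: "z \<noteq> 0" using z by auto
    let ?p = "\<lambda>x. ck_norm A (free_gauge z x)"
    have s: "cstar_seminorm (ck_norm A)" and rel: "\<And>r. r \<in> ck_relators A \<Longrightarrow> ck_norm A r = 0"
      using ck_norm_seminorm[of A] by auto
    have "cstar_seminorm ?p"
      unfolding cstar_seminorm_def free_gauge_add free_gauge_mult[OF z0] free_gauge_scale
        free_gauge_star[OF z] by (simp add: cstar_seminormD[OF s])
    moreover have g1: "free_gauge z 1 = (1 :: 'a free_algebra)"
      using free_gauge_single[of z 0 1] by (simp del: free_gauge_single)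
    moreover have gsum: "free_gauge z (\<Sum>j\<in>J. f j) = (\<Sum>j\<in>J. free_gauge z (f j))"
      for f :: "'a \<Rightarrow> 'a free_algebra" and J
      by (induction J rule: infinite_finite_induct) (auto simp: free_gauge_add)
    moreover have gn: "free_gauge z (of_nat n) = (of_nat n :: 'a free_algebra)" for n
      by (induction n) (auto simp: free_gauge_add g1)
    have "free_gauge z r = r \<or> free_gauge z r = free_scale z r" if "r \<in> ck_relators A" for r
      using that z0 unfolding ck_relators_def
      by (auto simp: free_gauge_minus free_gauge_mult g1 gsum gn free_gauge_gen free_scale_simps
        free_scale_central)
    then have "?p r = 0" if "r \<in> ck_relators A" for r
      using rel that cstar_seminormD(2)[OF s] by (metis mult_eq_0_iff)
    ultimately have "?p \<in> ck_seminorms A" by auto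
    then show ?thesis by (rule ck_norm_upper)
  qed
  have "z \<noteq> 0" using assms by auto
  then have "ck_norm A x \<le> ck_norm A (free_gauge z x)"
    using le[of "inverse z" "free_gauge z x"] assms by (simp add: norm_inverse free_gauge_gauge)
  then show ?thesis using le[OF assms, of x] by simp
qed

locale free_cstar_seminorm =
  fixes N :: "'i free_algebra \<Rightarrow> real"
  assumes N: "cstar_seminorm N"
begin

lemmas N_rules = cstar_seminormD[OF N]

abbreviation "cls X \<equiv> null_rel N `` {X}"
abbreviation "C \<equiv> seminorm_completion N free_scale free_star"

lemma cauchyD: "X \<in> cauchy_seqs N \<Longrightarrow> e > 0 \<Longrightarrow> \<exists>M. \<forall>m\<ge>M. \<forall>n\<ge>M. N (X m - X n) < e"
  by (simp add: cauchy_seqs_def)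

lemma N_minus_commute: "N (x - y) = N (y - x)"
  using N_rules(6)[of "x - y"] by simp

lemma N_triangle: "N (x - z) \<le> N (x - y) + N (y - z)"
  using N_rules(1)[of "x - y" "y - z"] by simp

lemma N_rev_triangle: "\<bar>N x - N y\<bar> \<le> N (x - y)"
  using N_rules(1)[of "x - y" y] N_rules(1)[of "y - x" x] N_minus_commute[of x y] by simp

lemma equiv: "equiv (cauchy_seqs N) (null_rel N)"
proof (rule equivI)
  show "null_rel N \<subseteq> cauchy_seqs N \<times> cauchy_seqs N" by (auto simp: null_rel_def)
  show "refl_on (cauchy_seqs N) (null_rel N)" by (auto simp: refl_on_def null_rel_def N_rules)
  show "sym (null_rel N)" by (auto simp: sym_def null_rel_def N_minus_commute)
  show "trans (null_rel N)"
  proof (rule transI)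
    fix X Y Z assume "(X, Y) \<in> null_rel N" "(Y, Z) \<in> null_rel N"
    then have c: "X \<in> cauchy_seqs N" "Z \<in> cauchy_seqs N"
      and 1: "(\<lambda>n. N (X n - Y n)) \<longlonglongrightarrow> 0" "(\<lambda>n. N (Y n - Z n)) \<longlonglongrightarrow> 0"
      by (auto simp: null_rel_def)
    from tendsto_add[OF 1] have "(\<lambda>n. N (X n - Z n)) \<longlonglongrightarrow> 0"
      by (intro Lim_null_comparison[of "\<lambda>n. N (X n - Z n)"])
         (auto intro!: always_eventually simp: N_rules N_triangle)
    then show "(X, Z) \<in> null_rel N" using c by (simp add: null_rel_def)
  qed
qed

lemma carrier_C: "carrier C = cauchy_seqs N // null_rel N"
  by (simp add: seminorm_completion_def)

lemma cls_in [simp, intro]: "X \<in> cauchy_seqs N \<Longrightarrow> cls X \<in> carrier C"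
  by (simp add: carrier_C quotientI)

lemma cls_cases: assumes "a \<in> carrier C" obtains X where "X \<in> cauchy_seqs N" "a = cls X"
  using assms unfolding carrier_C by (auto elim: quotientE)

lemma cls_eq_iff: "X \<in> cauchy_seqs N \<Longrightarrow> Y \<in> cauchy_seqs N \<Longrightarrow>
    cls X = cls Y \<longleftrightarrow> (\<lambda>n. N (X n - Y n)) \<longlonglongrightarrow> 0"
  using eq_equiv_class_iff[OF equiv] by (simp add: null_rel_def)

lemma rep_cls: assumes "X \<in> cauchy_seqs N"
  shows "class_rep (cls X) \<in> cauchy_seqs N" "(\<lambda>n. N (class_rep (cls X) n - X n)) \<longlonglongrightarrow> 0"
proof -
  have "X \<in> cls X" using assms equiv by (metis equiv_class_self)
  then have "class_rep (cls X) \<in> cls X" unfolding class_rep_def by (rule someI[of "\<lambda>Y. Y \<in> cls X"])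
  then show "class_rep (cls X) \<in> cauchy_seqs N" "(\<lambda>n. N (class_rep (cls X) n - X n)) \<longlonglongrightarrow> 0"
    by (auto simp: null_rel_def N_minus_commute)
qed

lemma cauchy_const [simp]: "(\<lambda>_. x) \<in> cauchy_seqs N"
  by (auto simp: cauchy_seqs_def N_rules)

lemma cauchy_lip:
  assumes "X \<in> cauchy_seqs N" "\<And>x y. N (f x - f y) \<le> K * N (x - y)"
  shows "(\<lambda>n. f (X n)) \<in> cauchy_seqs N"
  unfolding cauchy_seqs_def
proof safe
  fix e :: real assume e: "e > 0"
  define K' where "K' = \<bar>K\<bar> + 1"
  obtain M where M: "\<forall>m\<ge>M. \<forall>n\<ge>M. N (X m - X n) < e / K'"
    using cauchyD[OF assms(1), of "e / K'"] e by (auto simp: K'_def)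
  have "N (f (X m) - f (X n)) < e" if "m \<ge> M" "n \<ge> M" for m n
  proof -
    have "N (f (X m) - f (X n)) \<le> K' * N (X m - X n)"
      using assms(2)[of "X m" "X n"] N_rules(8)[of "X m - X n"]
      by (elim order.trans) (auto simp: K'_def intro!: mult_right_mono)
    also have "\<dots> < K' * (e / K')" using M that by (intro mult_strict_left_mono) (auto simp: K'_def)
    also have "\<dots> = e" by (simp add: K'_def)
    finally show ?thesis .
  qed
  then show "\<exists>M. \<forall>m\<ge>M. \<forall>n\<ge>M. N (f (X m) - f (X n)) < e" by blast
qed

lemma extend1_cls:
  assumes X: "X \<in> cauchy_seqs N" and f: "\<And>x y. N (f x - f y) \<le> K * N (x - y)"
  shows "extend1 N f (cls X) = cls (\<lambda>n. f (X n))"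
  unfolding extend1_def
proof (subst cls_eq_iff)
  let ?Y = "class_rep (cls X)"
  have "(\<lambda>n. K * N (?Y n - X n)) \<longlonglongrightarrow> K * 0" using rep_cls[OF X] by (intro tendsto_intros)
  then show "(\<lambda>n. N (f (?Y n) - f (X n))) \<longlonglongrightarrow> 0"
    by (intro Lim_null_comparison[of "\<lambda>n. N (f (?Y n) - f (X n))"])
       (auto intro!: always_eventually simp: N_rules f)
qed (rule cauchy_lip[OF _ f], use X rep_cls[OF X] in simp)+

lemma cauchy_bounded:
  assumes "X \<in> cauchy_seqs N" obtains K where "K > 0" "\<And>n. N (X n) \<le> K"
proof -
  obtain M where M: "\<forall>m\<ge>M. \<forall>n\<ge>M. N (X m - X n) < 1" using cauchyD[OF assms, of 1] by auto
  define K where "K = Max ((\<lambda>n. N (X n)) ` {..M}) + 1"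
  have 1: "N (X n) \<le> Max ((\<lambda>n. N (X n)) ` {..M})" if "n \<le> M" for n
    using that by (intro Max_ge) auto
  have "N (X n) \<le> K" for n
  proof (cases "n \<le> M")
    case True then show ?thesis unfolding K_def using 1[of n] by linarith
  next
    case False
    then have "N (X n - X M) < 1" using M by auto
    then show ?thesis unfolding K_def using 1[of M] N_rev_triangle[of "X n" "X M"] by linarith
  qed
  moreover have "K > 0" unfolding K_def using 1[of 0] N_rules(8)[of "X 0"] by linarith
  ultimately show ?thesis using that by blast
qed

lemma cauchy_add:
  assumes "X \<in> cauchy_seqs N" "Y \<in> cauchy_seqs N" shows "(\<lambda>n. X n + Y n) \<in> cauchy_seqs N"
  unfolding cauchy_seqs_def
proof safe
  fix e :: real assume e: "e > 0"
  obtain M1 M2 where M: "\<forall>m\<ge>M1. \<forall>n\<ge>M1. N (X m - X n) < e / 2" "\<forall>m\<ge>M2. \<forall>n\<ge>M2. N (Y m - Y n) < e / 2"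
    using cauchyD[OF assms(1), of "e / 2"] cauchyD[OF assms(2), of "e / 2"] e by auto
  have "N (X m + Y m - (X n + Y n)) < e" if "m \<ge> max M1 M2" "n \<ge> max M1 M2" for m n
  proof -
    have "N (X m + Y m - (X n + Y n)) \<le> N (X m - X n) + N (Y m - Y n)"
      using N_rules(1)[of "X m - X n" "Y m - Y n"] by (simp add: algebra_simps)
    moreover have "N (X m - X n) < e / 2" "N (Y m - Y n) < e / 2" using M that by auto
    ultimately show ?thesis by linarith
  qed
  then show "\<exists>M. \<forall>m\<ge>M. \<forall>n\<ge>M. N (X m + Y m - (X n + Y n)) < e" by blast
qed

lemma mult_diff_le: "N (x * y - x' * y') \<le> N x * N (y - y') + N (x - x') * N y'"
proof -
  have "x * y - x' * y' = x * (y - y') + (x - x') * y'" by (simp add: algebra_simps)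
  then show ?thesis
    using N_rules(1)[of "x * (y - y')" "(x - x') * y'"] N_rules(3)[of x "y - y'"]
      N_rules(3)[of "x - x'" y'] by simp
qed

lemma cauchy_mult:
  assumes X: "X \<in> cauchy_seqs N" and Y: "Y \<in> cauchy_seqs N" shows "(\<lambda>n. X n * Y n) \<in> cauchy_seqs N"
  unfolding cauchy_seqs_def
proof safe
  fix e :: real assume e: "e > 0"
  obtain K where K: "K > 0" "\<And>n. N (X n) \<le> K" using cauchy_bounded[OF X] by blast
  obtain L where L: "L > 0" "\<And>n. N (Y n) \<le> L" using cauchy_bounded[OF Y] by blast
  obtain M1 where M1: "\<forall>m\<ge>M1. \<forall>n\<ge>M1. N (X m - X n) < e / (2 * L)"
    using cauchyD[OF X, of "e / (2 * L)"] e L by auto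
  obtain M2 where M2: "\<forall>m\<ge>M2. \<forall>n\<ge>M2. N (Y m - Y n) < e / (2 * K)"
    using cauchyD[OF Y, of "e / (2 * K)"] e K by auto
  have "N (X m * Y m - X n * Y n) < e" if "m \<ge> max M1 M2" "n \<ge> max M1 M2" for m n
  proof -
    have "N (X m) * N (Y m - Y n) \<le> K * N (Y m - Y n)"
      using K N_rules by (intro mult_right_mono) auto
    also have "\<dots> < K * (e / (2 * K))" using M2 that K by (intro mult_strict_left_mono) auto
    finally have 1: "N (X m) * N (Y m - Y n) < e / 2" using K by simp
    have "N (X m - X n) * N (Y n) \<le> N (X m - X n) * L"
      using L N_rules by (intro mult_left_mono) auto
    also have "\<dots> < e / (2 * L) * L" using M1 that L by (intro mult_strict_right_mono) auto
    finally have "N (X m - X n) * N (Y n) < e / 2" using L by simp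
    then show ?thesis using 1 mult_diff_le[of "X m" "Y m" "X n" "Y n"] by linarith
  qed
  then show "\<exists>M. \<forall>m\<ge>M. \<forall>n\<ge>M. N (X m * Y m - X n * Y n) < e" by blast
qed

lemma add_cls:
  assumes X: "X \<in> cauchy_seqs N" and Y: "Y \<in> cauchy_seqs N"
  shows "cls X \<oplus>\<^bsub>C\<^esub> cls Y = cls (\<lambda>n. X n + Y n)"
proof -
  let ?X = "class_rep (cls X)" and ?Y = "class_rep (cls Y)"
  have "(\<lambda>n. N (?X n - X n) + N (?Y n - Y n)) \<longlonglongrightarrow> 0 + 0"
    using rep_cls[OF X] rep_cls[OF Y] by (intro tendsto_add)
  moreover have "N (?X n + ?Y n - (X n + Y n)) \<le> N (?X n - X n) + N (?Y n - Y n)" for n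
    using N_rules(1)[of "?X n - X n" "?Y n - Y n"] by (simp add: algebra_simps)
  ultimately have "(\<lambda>n. N (?X n + ?Y n - (X n + Y n))) \<longlonglongrightarrow> 0"
    by (intro Lim_null_comparison[of "\<lambda>n. N (?X n + ?Y n - (X n + Y n))"])
       (auto intro!: always_eventually simp: N_rules)
  then show ?thesis
    using cls_eq_iff[OF cauchy_add[OF rep_cls(1)[OF X] rep_cls(1)[OF Y]] cauchy_add[OF X Y]]
    by (simp add: seminorm_completion_def extend2_def)
qed

lemma mult_cls:
  assumes X: "X \<in> cauchy_seqs N" and Y: "Y \<in> cauchy_seqs N"
  shows "cls X \<otimes>\<^bsub>C\<^esub> cls Y = cls (\<lambda>n. X n * Y n)"
proof -
  let ?X = "class_rep (cls X)" and ?Y = "class_rep (cls Y)"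
  obtain K where K: "K > 0" "\<And>n. N (?X n) \<le> K" using cauchy_bounded[OF rep_cls(1)[OF X]] by blast
  obtain L where L: "L > 0" "\<And>n. N (Y n) \<le> L" using cauchy_bounded[OF Y] by blast
  have "(\<lambda>n. K * N (?Y n - Y n) + N (?X n - X n) * L) \<longlonglongrightarrow> K * 0 + 0 * L"
    using rep_cls[OF X] rep_cls[OF Y] by (intro tendsto_intros)
  moreover have "N (?X n * ?Y n - X n * Y n) \<le> K * N (?Y n - Y n) + N (?X n - X n) * L" for n
    by (rule order.trans[OF mult_diff_le])
       (use K L N_rules in \<open>auto intro!: add_mono mult_mono\<close>)
  ultimately have "(\<lambda>n. N (?X n * ?Y n - X n * Y n)) \<longlonglongrightarrow> 0"
    by (intro Lim_null_comparison[of "\<lambda>n. N (?X n * ?Y n - X n * Y n)"])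
       (auto intro!: always_eventually simp: N_rules)
  then show ?thesis
    using cls_eq_iff[OF cauchy_mult[OF rep_cls(1)[OF X] rep_cls(1)[OF Y]] cauchy_mult[OF X Y]]
    by (simp add: seminorm_completion_def extend2_def)
qed

lemma scale_lip: "N (free_scale c x - free_scale c y) \<le> cmod c * N (x - y)"
  using N_rules(2)[of c "x - y"] by (simp add: free_scale_simps)

lemma star_diff: "free_star (x - y) = free_star x - free_star y"
  using free_star_add[of "x - y" y] by (simp add: algebra_simps)

lemma star_lip: "N (free_star x - free_star y) \<le> 1 * N (x - y)"
  using N_rules(9)[of "x - y"] by (simp add: star_diff)

lemma cauchy_scale: "X \<in> cauchy_seqs N \<Longrightarrow> (\<lambda>n. free_scale c (X n)) \<in> cauchy_seqs N"
  by (rule cauchy_lip[OF _ scale_lip])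

lemma cauchy_star: "X \<in> cauchy_seqs N \<Longrightarrow> (\<lambda>n. free_star (X n)) \<in> cauchy_seqs N"
  by (rule cauchy_lip[OF _ star_lip])

lemma smult_cls: "X \<in> cauchy_seqs N \<Longrightarrow> c \<odot>\<^bsub>C\<^esub> cls X = cls (\<lambda>n. free_scale c (X n))"
  using extend1_cls[OF _ scale_lip] by (simp add: seminorm_completion_def)

lemma star_cls: "X \<in> cauchy_seqs N \<Longrightarrow> star C (cls X) = cls (\<lambda>n. free_star (X n))"
  using extend1_cls[OF _ star_lip] by (simp add: seminorm_completion_def)

lemma zero_C: "\<zero>\<^bsub>C\<^esub> = cls (\<lambda>_. 0)" and one_C: "\<one>\<^bsub>C\<^esub> = cls (\<lambda>_. 1)"
  by (auto simp: seminorm_completion_def const_class_def)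

lemma norm_cls: assumes X: "X \<in> cauchy_seqs N" shows "(\<lambda>n. N (X n)) \<longlonglongrightarrow> alg_norm C (cls X)"
proof -
  let ?Y = "class_rep (cls X)"
  have "Cauchy (\<lambda>n. N (?Y n))"
    unfolding Cauchy_def dist_real_def
    using cauchyD[OF rep_cls(1)[OF X]] by (meson N_rev_triangle order.strict_trans1)
  then have "(\<lambda>n. N (?Y n)) \<longlonglongrightarrow> lim (\<lambda>n. N (?Y n))"
    using Cauchy_convergent convergent_LIMSEQ_iff by blast
  moreover have "(\<lambda>n. N (?Y n) - N (X n)) \<longlonglongrightarrow> 0"
    by (rule Lim_null_comparison[OF always_eventually rep_cls(2)[OF X]]) (simp add: N_rev_triangle)
  ultimately have "(\<lambda>n. N (?Y n) - (N (?Y n) - N (X n))) \<longlonglongrightarrow> lim (\<lambda>n. N (?Y n)) - 0"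
    by (rule tendsto_diff)
  then show ?thesis by (simp add: seminorm_completion_def)
qed

lemmas cauchy_rules [simp, intro] = cauchy_add cauchy_mult cauchy_scale cauchy_star
lemmas cls_rules = add_cls mult_cls smult_cls star_cls zero_C one_C

lemma ring_C: "ring C"
proof (rule ringI)
  show "abelian_group C"
  proof (rule abelian_groupI)
    fix x assume "x \<in> carrier C"
    then obtain X where X: "X \<in> cauchy_seqs N" "x = cls X" by (rule cls_cases)
    show "\<zero>\<^bsub>C\<^esub> \<oplus>\<^bsub>C\<^esub> x = x" using X by (simp add: cls_rules)
    have "cls (\<lambda>n. free_scale (- 1) (X n)) \<oplus>\<^bsub>C\<^esub> x = \<zero>\<^bsub>C\<^esub>"
      using X by (simp add: add_cls zero_C) (simp add: free_scale_def single_uminus)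
    then show "\<exists>y\<in>carrier C. y \<oplus>\<^bsub>C\<^esub> x = \<zero>\<^bsub>C\<^esub>" using X by blast
  qed (auto elim!: cls_cases simp: cls_rules algebra_simps)
  show "monoid C" by (rule monoidI) (auto elim!: cls_cases simp: cls_rules algebra_simps)
qed (auto elim!: cls_cases simp: cls_rules algebra_simps)

lemma cauchy_minus [simp, intro]:
  assumes "X \<in> cauchy_seqs N" "Y \<in> cauchy_seqs N" shows "(\<lambda>n. X n - Y n) \<in> cauchy_seqs N"
  using cauchy_add[OF assms(1) cauchy_scale[OF assms(2), of "-1"]] 
  by (simp add: free_scale_def single_uminus)

lemma minus_cls:
  assumes X: "X \<in> cauchy_seqs N" and Y: "Y \<in> cauchy_seqs N"
  shows "cls X \<ominus>\<^bsub>C\<^esub> cls Y = cls (\<lambda>n. X n - Y n)"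
proof -
  interpret ring C by (rule ring_C)
  have "cls (\<lambda>n. X n - Y n) \<oplus>\<^bsub>C\<^esub> cls Y = cls X" using X Y by (simp add: add_cls)
  then have "cls X \<ominus>\<^bsub>C\<^esub> cls Y = (cls (\<lambda>n. X n - Y n) \<oplus>\<^bsub>C\<^esub> cls Y) \<ominus>\<^bsub>C\<^esub> cls Y" by (rule arg_cong[OF sym])
  also have "\<dots> = cls (\<lambda>n. X n - Y n) \<oplus>\<^bsub>C\<^esub> (cls Y \<ominus>\<^bsub>C\<^esub> cls Y)"
    unfolding a_minus_def by (rule a_assoc) (use cls_in[OF X] cls_in[OF Y] cls_in[OF cauchy_minus[OF X Y]] in simp_all)
  also have "cls Y \<ominus>\<^bsub>C\<^esub> cls Y = \<zero>\<^bsub>C\<^esub>"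
    unfolding a_minus_def by (rule r_neg[OF cls_in[OF Y]])
  finally show ?thesis using r_zero[OF cls_in[OF cauchy_minus[OF X Y]]] by simp
qed

lemma norm_const: "alg_norm C (cls (\<lambda>_. x)) = N x"
  using LIMSEQ_unique[OF norm_cls[OF cauchy_const] tendsto_const] by simp

lemma complete_C:
  assumes a: "\<And>k::nat. a k \<in> carrier C"
    and ca: "\<And>e. e > 0 \<Longrightarrow> \<exists>M. \<forall>m\<ge>M. \<forall>n\<ge>M. alg_norm C (a m \<ominus>\<^bsub>C\<^esub> a n) < e"
  shows "\<exists>l\<in>carrier C. (\<lambda>n. alg_norm C (a n \<ominus>\<^bsub>C\<^esub> l)) \<longlonglongrightarrow> 0"
proof -
  interpret ring C by (rule ring_C)
  have tri: "alg_norm C (u \<ominus>\<^bsub>C\<^esub> w) \<le> alg_norm C (u \<ominus>\<^bsub>C\<^esub> v) + alg_norm C (v \<ominus>\<^bsub>C\<^esub> w)"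
    if "u \<in> carrier C" "v \<in> carrier C" "w \<in> carrier C" for u v w
  proof -
    obtain U where U: "U \<in> cauchy_seqs N" "u = cls U" using \<open>u \<in> _\<close> by (rule cls_cases)
    obtain V where V: "V \<in> cauchy_seqs N" "v = cls V" using \<open>v \<in> _\<close> by (rule cls_cases)
    obtain W where W: "W \<in> cauchy_seqs N" "w = cls W" using \<open>w \<in> _\<close> by (rule cls_cases)
    note * = U V W
    show ?thesis unfolding * minus_cls[OF *(1,3)] minus_cls[OF *(1,5)] minus_cls[OF *(3,5)]
      by (rule LIMSEQ_le[OF norm_cls tendsto_add[OF norm_cls norm_cls]])
         (use * in \<open>auto intro!: exI[of _ 0] N_triangle\<close>)
  qed
  have comm: "alg_norm C (u \<ominus>\<^bsub>C\<^esub> v) = alg_norm C (v \<ominus>\<^bsub>C\<^esub> u)"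
    if "u \<in> carrier C" "v \<in> carrier C" for u v
  proof -
    obtain U where U: "U \<in> cauchy_seqs N" "u = cls U" using \<open>u \<in> _\<close> by (rule cls_cases)
    obtain V where V: "V \<in> cauchy_seqs N" "v = cls V" using \<open>v \<in> _\<close> by (rule cls_cases)
    note * = U V
    show ?thesis unfolding * minus_cls[OF *(1,3)] minus_cls[OF *(3,1)]
      by (rule LIMSEQ_unique[OF norm_cls, rotated])
         (use * norm_cls[of "\<lambda>n. V n - U n"] in \<open>auto simp: N_minus_commute\<close>)
  qed
  have "\<exists>y. alg_norm C (a k \<ominus>\<^bsub>C\<^esub> cls (\<lambda>_. y)) \<le> 1 / real (Suc k)" for k
  proof -
    obtain X where X: "X \<in> cauchy_seqs N" "a k = cls X" using a[of k] by (rule cls_cases)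
    obtain M where M: "\<forall>m\<ge>M. \<forall>n\<ge>M. N (X m - X n) < 1 / real (Suc k)"
      using cauchyD[OF X(1), of "1 / real (Suc k)"] by auto
    have "alg_norm C (cls X \<ominus>\<^bsub>C\<^esub> cls (\<lambda>_. X M)) \<le> 1 / real (Suc k)"
      unfolding minus_cls[OF X(1) cauchy_const]
      by (rule LIMSEQ_le_const2[OF norm_cls]) (use X M in \<open>auto intro!: exI[of _ M] less_imp_le\<close>)
    then show ?thesis unfolding X by (rule exI[of _ "X M"])
  qed
  then have "\<forall>k. \<exists>y. alg_norm C (a k \<ominus>\<^bsub>C\<^esub> cls (\<lambda>_. y)) \<le> 1 / real (Suc k)" ..
  from choice[OF this] obtain y
    where y: "\<And>k. alg_norm C (a k \<ominus>\<^bsub>C\<^esub> cls (\<lambda>_. y k)) \<le> 1 / real (Suc k)" by blast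
  have small: "\<exists>M. \<forall>k\<ge>M. 1 / real (Suc k) < e" if "e > 0" for e :: real
    using order_tendstoD(2)[OF LIMSEQ_inverse_real_of_nat that]
    by (simp add: eventually_sequentially inverse_eq_divide)
  have Y: "y \<in> cauchy_seqs N" unfolding cauchy_seqs_def
  proof safe
    fix e :: real assume e: "e > 0"
    obtain M1 where M1: "\<forall>k\<ge>M1. 1 / real (Suc k) < e / 3" using small[of "e / 3"] e by auto
    obtain M2 where M2: "\<forall>m\<ge>M2. \<forall>n\<ge>M2. alg_norm C (a m \<ominus>\<^bsub>C\<^esub> a n) < e / 3" using ca[of "e / 3"] e by auto
    have "N (y m - y n) < e" if mn: "m \<ge> max M1 M2" "n \<ge> max M1 M2" for m n
    proof -
      let ?c = "\<lambda>k. cls (\<lambda>_. y k)"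
      have "N (y m - y n) = alg_norm C (?c m \<ominus>\<^bsub>C\<^esub> ?c n)" by (simp add: minus_cls norm_const)
      also have "\<dots> \<le> alg_norm C (?c m \<ominus>\<^bsub>C\<^esub> a m) + (alg_norm C (a m \<ominus>\<^bsub>C\<^esub> a n) + alg_norm C (a n \<ominus>\<^bsub>C\<^esub> ?c n))"
        using tri[of "?c m" "a m" "?c n"] tri[of "a m" "a n" "?c n"] a by auto
      also have "alg_norm C (?c m \<ominus>\<^bsub>C\<^esub> a m) = alg_norm C (a m \<ominus>\<^bsub>C\<^esub> ?c m)" using comm a by auto
      finally have "N (y m - y n) \<le> alg_norm C (a m \<ominus>\<^bsub>C\<^esub> ?c m) + (alg_norm C (a m \<ominus>\<^bsub>C\<^esub> a n) + alg_norm C (a n \<ominus>\<^bsub>C\<^esub> ?c n))" .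
      moreover have "1 / real (Suc m) < e / 3" "1 / real (Suc n) < e / 3" 
        "alg_norm C (a m \<ominus>\<^bsub>C\<^esub> a n) < e / 3" using M1 M2 mn by auto
      ultimately show ?thesis using y[of m] y[of n] by linarith
    qed
    then show "\<exists>M. \<forall>m\<ge>M. \<forall>n\<ge>M. N (y m - y n) < e" by blast
  qed
  have "(\<lambda>k. alg_norm C (a k \<ominus>\<^bsub>C\<^esub> cls y)) \<longlonglongrightarrow> 0"
  proof (rule LIMSEQ_I)
    fix e :: real assume e: "e > 0"
    obtain M1 where M1: "\<forall>k\<ge>M1. 1 / real (Suc k) < e / 2" using small[of "e / 2"] e by auto
    obtain M2 where M2: "\<forall>m\<ge>M2. \<forall>n\<ge>M2. N (y m - y n) < e / 2" using cauchyD[OF Y, of "e / 2"] e by auto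
    have "norm (alg_norm C (a k \<ominus>\<^bsub>C\<^esub> cls y) - 0) < e" if k: "k \<ge> max M1 M2" for k
    proof -
      have "alg_norm C (cls (\<lambda>_. y k) \<ominus>\<^bsub>C\<^esub> cls y) \<le> e / 2"
        unfolding minus_cls[OF cauchy_const Y]
        by (rule LIMSEQ_le_const2[OF norm_cls]) (use Y M2 k in \<open>auto intro!: exI[of _ M2] less_imp_le\<close>)
      moreover have "1 / real (Suc k) < e / 2" using M1 k by auto
      ultimately have "alg_norm C (a k \<ominus>\<^bsub>C\<^esub> cls y) < e"
        using tri[of "a k" "cls (\<lambda>_. y k)" "cls y"] a y[of k] Y by force
      moreover have "0 \<le> alg_norm C (a k \<ominus>\<^bsub>C\<^esub> cls y)"
      proof -
        have "a k \<ominus>\<^bsub>C\<^esub> cls y \<in> carrier C" using a Y by auto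
        then obtain Z where Z: "Z \<in> cauchy_seqs N" "a k \<ominus>\<^bsub>C\<^esub> cls y = cls Z" by (rule cls_cases)
        show ?thesis unfolding Z
          by (rule LIMSEQ_le_const[OF norm_cls]) (use Z in \<open>auto simp: N_rules\<close>)
      qed
      ultimately show ?thesis by simp
    qed
    then show "\<exists>no. \<forall>n\<ge>no. norm (alg_norm C (a n \<ominus>\<^bsub>C\<^esub> cls y) - 0) < e" by blast
  qed
  then show ?thesis using Y by blast
qed

lemma cstar_algebra_C: "cstar_algebra C"
proof -
  interpret ring C by (rule ring_C)
  show ?thesis
  proof (rule cstar_algebra.intro[OF ring_C], unfold_locales)
    fix x assume "x \<in> carrier C"
    then obtain X where X: "X \<in> cauchy_seqs N" "x = cls X" by (rule cls_cases)
    show "alg_norm C x = 0 \<longleftrightarrow> x = \<zero>\<^bsub>C\<^esub>"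
      unfolding X zero_C using norm_cls[OF X(1)] X(1)
      by (auto simp: cls_eq_iff intro: LIMSEQ_unique)
    show "alg_norm C (star C x \<otimes>\<^bsub>C\<^esub> x) = (alg_norm C x)\<^sup>2"
      using norm_cls[of "\<lambda>n. free_star (X n) * X n"] tendsto_power[OF norm_cls[OF X(1)], of 2] X
      by (auto simp: cls_rules N_rules intro: LIMSEQ_unique)
    show "alg_norm C (c \<odot>\<^bsub>C\<^esub> x) = cmod c * alg_norm C x" for c
      using norm_cls[of "\<lambda>n. free_scale c (X n)"] tendsto_mult_left[OF norm_cls[OF X(1)], of "cmod c"] X
      by (auto simp: cls_rules N_rules intro: LIMSEQ_unique)
    fix y assume "y \<in> carrier C"
    then obtain Y where Y: "Y \<in> cauchy_seqs N" "y = cls Y" by (rule cls_cases)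
    show "alg_norm C (x \<oplus>\<^bsub>C\<^esub> y) \<le> alg_norm C x + alg_norm C y"
      unfolding X Y add_cls[OF X(1) Y(1)]
      by (rule LIMSEQ_le[OF norm_cls tendsto_add[OF norm_cls norm_cls]]) (use X Y in \<open>auto simp: N_rules\<close>)
    show "alg_norm C (x \<otimes>\<^bsub>C\<^esub> y) \<le> alg_norm C x * alg_norm C y"
      unfolding X Y mult_cls[OF X(1) Y(1)]
      by (rule LIMSEQ_le[OF norm_cls tendsto_mult[OF norm_cls norm_cls]]) (use X Y in \<open>auto simp: N_rules\<close>)
  next
    fix f :: "nat \<Rightarrow> _" assume "\<And>n. f n \<in> carrier C" 
      and "\<And>e. e > 0 \<Longrightarrow> \<exists>M. \<forall>m\<ge>M. \<forall>n\<ge>M. alg_norm C (f m \<ominus>\<^bsub>C\<^esub> f n) < e"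
    then show "\<exists>l\<in>carrier C. (\<lambda>n. alg_norm C (f n \<ominus>\<^bsub>C\<^esub> l)) \<longlonglongrightarrow> 0" by (rule complete_C)
  qed (auto elim!: cls_cases simp: cls_rules free_scale_simps free_scale_central free_star_add
      free_star_mult free_star_scale)
qed

end

lemma ck_norm_locale: "free_cstar_seminorm (ck_norm A)"
  using ck_norm_seminorm[of A] by unfold_locales auto

theorem ck_algebra_cstar: "cstar_algebra (ck_algebra A)"
  unfolding ck_algebra_def by (rule free_cstar_seminorm.cstar_algebra_C[OF ck_norm_locale])

lemma gauge_cls:
  assumes "cmod z = 1" "X \<in> cauchy_seqs (ck_norm A)"
  shows "gauge_action A z (null_rel (ck_norm A) `` {X}) = null_rel (ck_norm A) `` {\<lambda>n. free_gauge z (X n)}"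
    "(\<lambda>n. free_gauge z (X n)) \<in> cauchy_seqs (ck_norm A)"
proof -
  interpret free_cstar_seminorm "ck_norm A" by (rule ck_norm_locale)
  have l: "ck_norm A (free_gauge z x - free_gauge z y) \<le> 1 * ck_norm A (x - y)" for x y
    using ck_norm_gauge[OF assms(1), of A "x - y"] by (simp add: free_gauge_minus)
  show "gauge_action A z (null_rel (ck_norm A) `` {X}) = null_rel (ck_norm A) `` {\<lambda>n. free_gauge z (X n)}"
    unfolding gauge_action_def by (rule extend1_cls[OF assms(2) l])
  show "(\<lambda>n. free_gauge z (X n)) \<in> cauchy_seqs (ck_norm A)"
    by (rule cauchy_lip[OF assms(2) l])
qed

theorem gauge_action_gen:
  assumes "cmod z = 1" shows "gauge_action A z (ck_gen A i) = z \<odot>\<^bsub>ck_algebra A\<^esub> ck_gen A i"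
proof -
  interpret free_cstar_seminorm "ck_norm A" by (rule ck_norm_locale)
  show ?thesis using gauge_cls(1)[OF assms cauchy_const, of "gen i"]
    by (simp add: ck_gen_def const_class_def ck_algebra_def smult_cls free_gauge_gen)
qed

theorem gauge_action_iso:
  assumes z: "cmod z = 1" shows "gauge_action A z \<in> star_iso (ck_algebra A) (ck_algebra A)"
proof -
  interpret free_cstar_seminorm "ck_norm A" by (rule ck_norm_locale)
  have z0: "z \<noteq> 0" using z by auto
  have g1: "free_gauge z 1 = (1 :: 'i free_algebra)" for z
    using free_gauge_single[of z 0 1] by (simp del: free_gauge_single)
  note g = gauge_cls[OF z] gauge_cls[of "inverse z"]
  have inv: "gauge_action A (inverse z) (gauge_action A z a) = a"
    "gauge_action A z (gauge_action A (inverse z) a) = a"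
    "gauge_action A z a \<in> carrier C" "gauge_action A (inverse z) a \<in> carrier C"
    if "a \<in> carrier C" for a
    using that z z0 by (auto elim!: cls_cases simp: g norm_inverse free_gauge_gauge)
  have "bij_betw (gauge_action A z) (carrier C) (carrier C)"
    by (rule bij_betw_byWitness[of _ "gauge_action A (inverse z)"]) (use inv in auto)
  moreover have "gauge_action A z \<in> ring_hom C C"
    by (rule ring_hom_memI)
       (auto elim!: cls_cases simp: g z0 cls_rules free_gauge_add free_gauge_mult[OF z0] g1)
  ultimately show ?thesis
    unfolding star_iso_def star_hom_def ck_algebra_def
    by (auto elim!: cls_cases simp: g cls_rules free_gauge_scale free_gauge_star[OF z])
qed

definition ck_family :: "('b, 'm) star_algebra_scheme \<Rightarrow> nat^'i^'i \<Rightarrow> ('i::finite \<Rightarrow> 'b) \<Rightarrow> bool" where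
  "ck_family R A T \<longleftrightarrow>
     (\<forall>i. T i \<in> carrier R \<and> T i \<otimes>\<^bsub>R\<^esub> star R (T i) \<otimes>\<^bsub>R\<^esub> T i = T i) \<and>
     (\<Oplus>\<^bsub>R\<^esub>j\<in>UNIV. T j \<otimes>\<^bsub>R\<^esub> star R (T j)) = \<one>\<^bsub>R\<^esub> \<and>
     (\<forall>i. star R (T i) \<otimes>\<^bsub>R\<^esub> T i =
        (\<Oplus>\<^bsub>R\<^esub>j\<in>UNIV. of_nat (A $ i $ j) \<odot>\<^bsub>R\<^esub> (T j \<otimes>\<^bsub>R\<^esub> star R (T j))))"

context cstar_algebra
begin

lemma smult_0 [simp]: "x \<in> carrier R \<Longrightarrow> 0 \<odot> x = \<zero>"
  using norm_zero_iff[of "0 \<odot> x"] norm_smult[of x 0] by simp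

lemma smult_left_commute: "x \<in> carrier R \<Longrightarrow> c \<odot> (d \<odot> x) = d \<odot> (c \<odot> x)"
  by (metis smult_assoc mult.commute)

lemma smult_zero [simp]: "c \<odot> \<zero> = \<zero>"
  using norm_zero_iff[of "c \<odot> \<zero>"] norm_smult[of \<zero> c] norm_zero_iff[of \<zero>] by simp

lemma smult_minus1: "x \<in> carrier R \<Longrightarrow> (- 1) \<odot> x = \<ominus> x"
  using smult_l_distr[of x "- 1" 1] minus_equality[of "(- 1) \<odot> x" x] by simp

lemma norm_minus: "x \<in> carrier R \<Longrightarrow> alg_norm R (\<ominus> x) = alg_norm R x"
  using norm_smult[of x "- 1"] by (simp add: smult_minus1)

lemma norm_nonneg: "x \<in> carrier R \<Longrightarrow> 0 \<le> alg_norm R x"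
  using norm_add[of x "\<ominus> x"] norm_minus[of x] norm_zero_iff[of \<zero>] by (simp add: r_neg)

lemma star_zero [simp]: "star R \<zero> = \<zero>"
  using star_smult[of \<zero> 0] by simp

lemma star_one [simp]: "star R \<one> = \<one>"
proof -
  have "star R \<one> = star R (star R (star R \<one>) \<otimes> star R \<one>)" using star_mult[of "star R \<one>" \<one>] by simp
  then show ?thesis using star_mult[of "star R \<one>" \<one>] by simp
qed

lemma norm_star: "x \<in> carrier R \<Longrightarrow> alg_norm R (star R x) = alg_norm R x"
proof -
  have *: "alg_norm R x \<le> alg_norm R (star R x)" if "x \<in> carrier R" for x
  proof (cases "alg_norm R x = 0")
    case True then show ?thesis using norm_nonneg[of "star R x"] that by simp
  next
    case False
    then have "alg_norm R x > 0" using norm_nonneg[OF that] by simp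
    moreover have "alg_norm R x * alg_norm R x \<le> alg_norm R (star R x) * alg_norm R x"
      using cstar_identity[OF that] norm_mult[of "star R x" x] that by (simp add: power2_eq_square)
    ultimately show ?thesis by simp
  qed
  show "x \<in> carrier R \<Longrightarrow> alg_norm R (star R x) = alg_norm R x" using *[of x] *[of "star R x"] by simp
qed

definition converges :: "(nat \<Rightarrow> 'a) \<Rightarrow> 'a \<Rightarrow> bool" where
  "converges f l \<longleftrightarrow> (\<forall>n. f n \<in> carrier R) \<and> l \<in> carrier R \<and> (\<lambda>n. alg_norm R (f n \<ominus> l)) \<longlonglongrightarrow> 0"

lemma convergesI:
  assumes "\<And>n. f n \<in> carrier R" "l \<in> carrier R" "\<And>n. alg_norm R (f n \<ominus> l) \<le> g n" "g \<longlonglongrightarrow> 0"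
  shows "converges f l"
  unfolding converges_def using assms
  by (auto intro!: Lim_null_comparison[of "\<lambda>n. alg_norm R (f n \<ominus> l)" g] always_eventually
      simp: norm_nonneg)

lemma diff_split:
  assumes "x \<in> carrier R" "y \<in> carrier R" "z \<in> carrier R"
  shows "x \<ominus> z = (x \<ominus> y) \<oplus> (y \<ominus> z)"
  using assms unfolding a_minus_def by (simp add: a_assoc r_neg1 flip: a_assoc[of "\<ominus> y"])

lemma converges_unique:
  assumes "converges f l" "converges f l'" shows "l = l'"
proof -
  have c: "l \<in> carrier R" "l' \<in> carrier R" "\<And>n. f n \<in> carrier R" using assms by (auto simp: converges_def)
  have "alg_norm R (l \<ominus> l') \<le> alg_norm R (f n \<ominus> l) + alg_norm R (f n \<ominus> l')" for n
  proof -
    have "alg_norm R (l \<ominus> f n) = alg_norm R (f n \<ominus> l)"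
      using norm_minus[of "l \<ominus> f n"] c by (simp add: a_minus_def minus_add a_comm)
    then show ?thesis using diff_split[of l "f n" l'] norm_add[of "l \<ominus> f n" "f n \<ominus> l'"] c by simp
  qed
  moreover have "(\<lambda>n. alg_norm R (f n \<ominus> l) + alg_norm R (f n \<ominus> l')) \<longlonglongrightarrow> 0 + 0"
    using assms by (intro tendsto_add) (auto simp: converges_def)
  ultimately have "alg_norm R (l \<ominus> l') \<le> 0" by (auto intro: LIMSEQ_le_const)
  then have "l \<ominus> l' = \<zero>" using norm_nonneg[of "l \<ominus> l'"] norm_zero_iff[of "l \<ominus> l'"] c by simp
  moreover have "l = (l \<ominus> l') \<oplus> l'" using c by (simp add: a_minus_def a_assoc l_neg)
  ultimately show ?thesis using c by simp
qed

lemma converges_const: "x \<in> carrier R \<Longrightarrow> converges (\<lambda>_. x) x"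
  using norm_zero_iff[of \<zero>] by (simp add: converges_def a_minus_def r_neg)

lemma converges_add:
  assumes "converges f l" "converges g m" shows "converges (\<lambda>n. f n \<oplus> g n) (l \<oplus> m)"
proof (rule convergesI)
  note c = assms[unfolded converges_def]
  show "(\<lambda>n. alg_norm R (f n \<ominus> l) + alg_norm R (g n \<ominus> m)) \<longlonglongrightarrow> 0"
    using c by (intro tendsto_add_zero) auto
  fix n
  have "f n \<oplus> g n \<ominus> (l \<oplus> m) = (f n \<ominus> l) \<oplus> (g n \<ominus> m)"
    using c by (simp add: a_minus_def minus_add a_ac)
  then show "alg_norm R (f n \<oplus> g n \<ominus> (l \<oplus> m)) \<le> alg_norm R (f n \<ominus> l) + alg_norm R (g n \<ominus> m)"
    using norm_add[of "f n \<ominus> l" "g n \<ominus> m"] c by simp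
qed (use assms in \<open>auto simp: converges_def\<close>)

lemma converges_smult:
  assumes "converges f l" shows "converges (\<lambda>n. c \<odot> f n) (c \<odot> l)"
proof (rule convergesI)
  note d = assms[unfolded converges_def]
  show "(\<lambda>n. cmod c * alg_norm R (f n \<ominus> l)) \<longlonglongrightarrow> 0"
    using d tendsto_mult_right_zero by blast
  fix n
  have "c \<odot> f n \<ominus> c \<odot> l = c \<odot> (f n \<ominus> l)"
    using d smult_assoc[of l "- 1" c] smult_assoc[of l c "- 1"]
    by (simp add: a_minus_def smult_r_distr flip: smult_minus1)
  then show "alg_norm R (c \<odot> f n \<ominus> c \<odot> l) \<le> cmod c * alg_norm R (f n \<ominus> l)"
    using norm_smult[of "f n \<ominus> l"] d by simp
qed (use assms in \<open>auto simp: converges_def\<close>)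

lemma star_diff: "x \<in> carrier R \<Longrightarrow> y \<in> carrier R \<Longrightarrow> star R (x \<ominus> y) = star R x \<ominus> star R y"
  by (simp add: a_minus_def star_add star_smult flip: smult_minus1)

lemma converges_star:
  assumes "converges f l" shows "converges (\<lambda>n. star R (f n)) (star R l)"
  using assms norm_star[of "f n \<ominus> l" for n]
  unfolding converges_def by (simp flip: star_diff)

lemma converges_mult:
  assumes "converges f l" "converges g m" shows "converges (\<lambda>n. f n \<otimes> g n) (l \<otimes> m)"
proof (rule convergesI)
  note c = assms[unfolded converges_def]
  let ?F = "\<lambda>n. alg_norm R (f n \<ominus> l)" and ?G = "\<lambda>n. alg_norm R (g n \<ominus> m)"
  have "(\<lambda>n. (?F n + alg_norm R l) * ?G n + ?F n * alg_norm R m) \<longlonglongrightarrow>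
      (0 + alg_norm R l) * 0 + 0 * alg_norm R m"
    using c by (intro tendsto_intros) auto
  then show "(\<lambda>n. (?F n + alg_norm R l) * ?G n + ?F n * alg_norm R m) \<longlonglongrightarrow> 0" by simp
  fix n
  have fn: "f n \<in> carrier R" "g n \<in> carrier R" "l \<in> carrier R" "m \<in> carrier R" using c by auto
  have "f n = (f n \<ominus> l) \<oplus> l" using fn by (simp add: a_minus_def a_assoc l_neg)
  then have 1: "alg_norm R (f n) \<le> ?F n + alg_norm R l" using norm_add[of "f n \<ominus> l" l] fn by simp
  have "f n \<otimes> g n \<ominus> l \<otimes> m = (f n \<otimes> g n \<ominus> f n \<otimes> m) \<oplus> (f n \<otimes> m \<ominus> l \<otimes> m)"
    by (rule diff_split) (use fn in auto)
  also have "\<dots> = f n \<otimes> (g n \<ominus> m) \<oplus> (f n \<ominus> l) \<otimes> m"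
    using fn by (simp add: a_minus_def r_distr l_distr r_minus l_minus)
  finally have "alg_norm R (f n \<otimes> g n \<ominus> l \<otimes> m) \<le> alg_norm R (f n) * ?G n + ?F n * alg_norm R m"
    using norm_add[of "f n \<otimes> (g n \<ominus> m)" "(f n \<ominus> l) \<otimes> m"] norm_mult[of "f n" "g n \<ominus> m"]
      norm_mult[of "f n \<ominus> l" m] fn by simp
  also have "\<dots> \<le> (?F n + alg_norm R l) * ?G n + ?F n * alg_norm R m"
    using 1 fn by (intro add_right_mono mult_right_mono norm_nonneg) auto
  finally show "alg_norm R (f n \<otimes> g n \<ominus> l \<otimes> m) \<le> (?F n + alg_norm R l) * ?G n + ?F n * alg_norm R m" .
qed (use assms in \<open>auto simp: converges_def\<close>)

fun letter_eval :: "('i \<Rightarrow> 'a) \<Rightarrow> 'i letter \<Rightarrow> 'a" where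
  "letter_eval T (Gen i) = T i"
| "letter_eval T (Adj i) = star R (T i)"

definition word_eval :: "('i \<Rightarrow> 'a) \<Rightarrow> 'i star_word \<Rightarrow> 'a" where
  "word_eval T w = foldr (\<lambda>l e. letter_eval T l \<otimes> e) (letters w) \<one>"

definition free_eval :: "('i \<Rightarrow> 'a) \<Rightarrow> 'i free_algebra \<Rightarrow> 'a" where
  "free_eval T x = (\<Oplus>w\<in>Poly_Mapping.keys x. Poly_Mapping.lookup x w \<odot> word_eval T w)"

context
  fixes T :: "'i::finite \<Rightarrow> 'a"
  assumes T [simp, intro]: "\<And>i. T i \<in> carrier R"
begin

lemma letter_eval_closed [simp, intro]: "letter_eval T l \<in> carrier R"
  by (cases l) auto

lemma foldr_closed [simp, intro]:
  "e \<in> carrier R \<Longrightarrow> foldr (\<lambda>l e. letter_eval T l \<otimes> e) ls e \<in> carrier R"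
  by (induction ls) auto

lemma word_eval_closed [simp, intro]: "word_eval T w \<in> carrier R"
  by (simp add: word_eval_def)

lemma foldr_mult:
  "e \<in> carrier R \<Longrightarrow> foldr (\<lambda>l e. letter_eval T l \<otimes> e) ls e = foldr (\<lambda>l e. letter_eval T l \<otimes> e) ls \<one> \<otimes> e"
  by (induction ls) (auto simp: m_assoc)

lemma word_eval_add: "word_eval T (u + v) = word_eval T u \<otimes> word_eval T v"
  using foldr_mult[of "foldr (\<lambda>l e. letter_eval T l \<otimes> e) (letters v) \<one>" "letters u"]
  by (simp add: word_eval_def plus_star_word_def)

lemma word_eval_star: "word_eval T (word_star w) = star R (word_eval T w)"
proof -
  have "letter_eval T (letter_star l) = star R (letter_eval T l)" for l by (cases l) auto
  then have "foldr (\<lambda>l e. letter_eval T l \<otimes> e) (rev (map letter_star ls)) \<one> =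
      star R (foldr (\<lambda>l e. letter_eval T l \<otimes> e) ls \<one>)" for ls
  proof (induction ls)
    case (Cons l ls)
    then show ?case using foldr_mult[of "letter_eval T (letter_star l) \<otimes> \<one>" "rev (map letter_star ls)"]
      by (simp add: star_mult)
  qed simp
  then show ?thesis by (simp add: word_eval_def word_star_def)
qed

lemma free_eval_closed [simp, intro]: "free_eval T x \<in> carrier R"
  unfolding free_eval_def by (rule finsum_closed) auto

lemma free_eval_superset:
  assumes "finite K" "Poly_Mapping.keys x \<subseteq> K"
  shows "free_eval T x = (\<Oplus>w\<in>K. Poly_Mapping.lookup x w \<odot> word_eval T w)"
  unfolding free_eval_def
  by (rule add.finprod_mono_neutral_cong_left) (use assms in \<open>auto simp: in_keys_iff\<close>)

lemma free_eval_zero [simp]: "free_eval T 0 = \<zero>"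
  by (simp add: free_eval_def)

lemma free_eval_single [simp]: "free_eval T (Poly_Mapping.single w c) = c \<odot> word_eval T w"
  using free_eval_superset[of "{w}" "Poly_Mapping.single w c"] by simp

lemma free_eval_add: "free_eval T (x + y) = free_eval T x \<oplus> free_eval T y"
proof -
  let ?K = "Poly_Mapping.keys x \<union> Poly_Mapping.keys y"
  have "free_eval T (x + y) = (\<Oplus>w\<in>?K. Poly_Mapping.lookup (x + y) w \<odot> word_eval T w)"
    by (rule free_eval_superset) (auto simp: Poly_Mapping.keys_add)
  also have "\<dots> = (\<Oplus>w\<in>?K. Poly_Mapping.lookup x w \<odot> word_eval T w \<oplus> Poly_Mapping.lookup y w \<odot> word_eval T w)"
    by (simp add: lookup_add smult_l_distr)
  also have "\<dots> = (\<Oplus>w\<in>?K. Poly_Mapping.lookup x w \<odot> word_eval T w) \<oplus> (\<Oplus>w\<in>?K. Poly_Mapping.lookup y w \<odot> word_eval T w)"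
    by (rule finsum_addf) auto
  finally show ?thesis using free_eval_superset[of ?K x] free_eval_superset[of ?K y] by simp
qed

lemma free_eval_mult: "free_eval T (x * y) = free_eval T x \<otimes> free_eval T y"
proof (induction x rule: free_induct)
  case (single w c)
  show ?case
    by (induction y rule: free_induct)
       (auto simp: mult_single word_eval_add free_eval_add r_distr smult_mult_l smult_mult_r smult_assoc
         smult_left_commute distrib_left)
qed (auto simp: free_eval_add l_distr distrib_right)

lemma free_eval_scale: "free_eval T (free_scale c x) = c \<odot> free_eval T x"
proof -
  have "word_eval T 0 = \<one>" by (simp add: word_eval_def zero_star_word_def)
  then show ?thesis by (simp add: free_scale_def free_eval_mult smult_mult_l)
qed

lemma free_eval_one [simp]: "free_eval T 1 = \<one>"
proof -
  have "word_eval T 0 = \<one>" by (simp add: word_eval_def zero_star_word_def)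
  then show ?thesis using free_eval_single[of 0 1] by (simp del: free_eval_single)
qed

lemma free_eval_star: "free_eval T (free_star x) = star R (free_eval T x)"
  by (induction x rule: free_induct) (auto simp: free_eval_add free_star_add star_add star_smult word_eval_star)

lemma free_eval_minus: "free_eval T (x - y) = free_eval T x \<ominus> free_eval T y"
proof -
  have eq: "x - y = x + free_scale (- 1) y" by (simp add: free_scale_def single_uminus)
  show ?thesis unfolding eq by (simp add: free_eval_add free_eval_scale smult_minus1 a_minus_def)
qed

lemma free_eval_sum: "free_eval T (\<Sum>j\<in>J. f j) = (\<Oplus>j\<in>J. free_eval T (f j))" if "finite J"
  using that by (induction J) (auto simp: free_eval_add)

lemma free_eval_gen [simp]: "free_eval T (gen i) = T i" "free_eval T (adj i) = star R (T i)"
  by (auto simp: gen_def adj_def word_eval_def)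

lemma of_nat_scale: "of_nat n * x = free_scale (of_nat n) x"
  by (simp add: free_scale_def)

lemma norm_eval_seminorm:
  assumes "ck_family R A T" shows "(\<lambda>x. alg_norm R (free_eval T x)) \<in> ck_seminorms A"
proof -
  have "cstar_seminorm (\<lambda>x. alg_norm R (free_eval T x))"
    by (auto simp: cstar_seminorm_def free_eval_add free_eval_mult free_eval_scale free_eval_star
        norm_add norm_mult norm_smult cstar_identity)
  moreover have "free_eval T r = \<zero>" if "r \<in> ck_relators A" for r
    using that assms unfolding ck_relators_def ck_family_def
    by (auto simp: free_eval_minus free_eval_mult free_eval_sum of_nat_scale free_eval_scale a_minus_def r_neg)
  ultimately show ?thesis using norm_zero_iff[of \<zero>] by auto
qed

end

theorem ck_algebra_universal:
  fixes A :: "nat^'i^'i"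
  assumes fam: "ck_family R A T"
  shows "\<exists>\<phi>\<in>star_hom (ck_algebra A) R. \<forall>i. \<phi> (ck_gen A i) = T i"
proof -
  interpret F: free_cstar_seminorm "ck_norm A" by (rule ck_norm_locale)
  have T: "T i \<in> carrier R" for i using fam by (simp add: ck_family_def)
  let ?e = "free_eval T"
  note [simp, intro] = free_eval_closed[OF T]
  have le: "alg_norm R (?e x) \<le> ck_norm A x" for x
    using ck_norm_upper[OF norm_eval_seminorm[OF T fam]] .
  have conv: "\<exists>l. converges (\<lambda>n. ?e (X n)) l" if X: "X \<in> cauchy_seqs (ck_norm A)" for X
  proof -
    have "\<exists>l\<in>carrier R. (\<lambda>n. alg_norm R (?e (X n) \<ominus> l)) \<longlonglongrightarrow> 0"
    proof (rule complete)
      fix e :: real assume "e > 0"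
      then obtain M where M: "\<forall>m\<ge>M. \<forall>n\<ge>M. ck_norm A (X m - X n) < e" using F.cauchyD[OF X] by blast
      have "alg_norm R (?e (X m) \<ominus> ?e (X n)) < e" if "m \<ge> M" "n \<ge> M" for m n
        using le[of "X m - X n"] M that by (force simp: free_eval_minus[OF T])
      then show "\<exists>M. \<forall>m\<ge>M. \<forall>n\<ge>M. alg_norm R (?e (X m) \<ominus> ?e (X n)) < e" by blast
    qed auto
    then show ?thesis by (auto simp: converges_def)
  qed
  define \<phi> where "\<phi> a = (SOME l. converges (\<lambda>n. ?e (class_rep a n)) l)" for a
  have \<phi>: "\<phi> (F.cls X) = l"
    if X: "X \<in> cauchy_seqs (ck_norm A)" and l: "converges (\<lambda>n. ?e (X n)) l" for X l
  proof -
    let ?Y = "class_rep (F.cls X)"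
    have 1: "converges (\<lambda>n. ?e (?Y n)) (\<phi> (F.cls X))"
      unfolding \<phi>_def by (rule someI_ex[OF conv[OF F.rep_cls(1)[OF X]]])
    have "converges (\<lambda>n. ?e (?Y n - X n)) \<zero>"
      by (rule convergesI[OF _ _ _ F.rep_cls(2)[OF X]]) (auto simp: a_minus_def le)
    from converges_add[OF this l] have "converges (\<lambda>n. ?e (?Y n)) l"
      using l by (simp add: converges_def flip: free_eval_add[OF T])
    then show ?thesis using converges_unique[OF 1] by simp
  qed
  have \<phi>_conv: "converges (\<lambda>n. ?e (X n)) (\<phi> (F.cls X))" if X: "X \<in> cauchy_seqs (ck_norm A)" for X
    using conv[OF X] \<phi>[OF X] by auto
  have \<phi>_closed: "\<phi> (F.cls X) \<in> carrier R" if X: "X \<in> cauchy_seqs (ck_norm A)" for X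
    using \<phi>_conv[OF X] by (simp add: converges_def)
  have \<phi>_const: "\<phi> (F.cls (\<lambda>_. x)) = ?e x" for x
    by (rule \<phi>) (auto intro: converges_const)
  have "\<phi> \<in> ring_hom F.C R"
  proof (rule ring_hom_memI)
    fix x assume "x \<in> carrier F.C"
    then obtain X where X: "X \<in> cauchy_seqs (ck_norm A)" "x = F.cls X" by (rule F.cls_cases)
    show "\<phi> x \<in> carrier R" using X \<phi>_closed by simp
    fix y assume "y \<in> carrier F.C"
    then obtain Y where Y: "Y \<in> cauchy_seqs (ck_norm A)" "y = F.cls Y" by (rule F.cls_cases)
    show "\<phi> (x \<otimes>\<^bsub>F.C\<^esub> y) = \<phi> x \<otimes> \<phi> y"
      unfolding X Y F.mult_cls[OF X(1) Y(1)]
      using converges_mult[OF \<phi>_conv[OF X(1)] \<phi>_conv[OF Y(1)]] X Y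
      by (intro \<phi>) (auto simp: free_eval_mult[OF T])
    show "\<phi> (x \<oplus>\<^bsub>F.C\<^esub> y) = \<phi> x \<oplus> \<phi> y"
      unfolding X Y F.add_cls[OF X(1) Y(1)]
      using converges_add[OF \<phi>_conv[OF X(1)] \<phi>_conv[OF Y(1)]] X Y
      by (intro \<phi>) (auto simp: free_eval_add[OF T])
  qed (simp add: F.one_C \<phi>_const free_eval_one[OF T])
  moreover have "\<phi> (c \<odot>\<^bsub>F.C\<^esub> x) = c \<odot> \<phi> x" "\<phi> (star F.C x) = star R (\<phi> x)"
    if "x \<in> carrier F.C" for x c
  proof -
    obtain X where X: "X \<in> cauchy_seqs (ck_norm A)" "x = F.cls X" using \<open>x \<in> _\<close> by (rule F.cls_cases)
    show "\<phi> (c \<odot>\<^bsub>F.C\<^esub> x) = c \<odot> \<phi> x"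
      unfolding X F.smult_cls[OF X(1)] using converges_smult[OF \<phi>_conv[OF X(1)]] X
      by (intro \<phi>) (auto simp: free_eval_scale[OF T])
    show "\<phi> (star F.C x) = star R (\<phi> x)"
      unfolding X F.star_cls[OF X(1)] using converges_star[OF \<phi>_conv[OF X(1)]] X
      by (intro \<phi>) (auto simp: free_eval_star[OF T])
  qed
  ultimately have "\<phi> \<in> star_hom (ck_algebra A) R" by (simp add: star_hom_def ck_algebra_def)
  moreover have "\<phi> (ck_gen A i) = T i" for i
    using \<phi>_const[of "gen i"] by (simp add: ck_gen_def const_class_def free_eval_gen[OF T])
  ultimately show ?thesis by blast
qed

end

theorem ck_gen_family: "ck_family (ck_algebra A) A (ck_gen A)"
proof -
  interpret F: free_cstar_seminorm "ck_norm A" by (rule ck_norm_locale)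
  interpret ring F.C by (rule F.ring_C)
  let ?k = "\<lambda>x. F.cls (\<lambda>_. x)"
  have g: "ck_gen A i = ?k (gen i)" for i by (simp add: ck_gen_def const_class_def)
  have sum: "(\<Oplus>\<^bsub>F.C\<^esub>j\<in>J. ?k (f j)) = ?k (\<Sum>j\<in>J. f j)" if "finite J" for f and J :: "'a set"
    using that by (induction J) (auto simp: F.zero_C F.add_cls)
  have rel: "?k x = ?k y" if "x - y \<in> ck_relators A" for x y
    using ck_norm_seminorm[of A] that by (subst F.cls_eq_iff) auto
  have scale: "of_nat n \<odot>\<^bsub>F.C\<^esub> ?k x = ?k (of_nat n * x)" for n x
    by (simp add: F.smult_cls free_scale_def)
  show ?thesis unfolding ck_family_def ck_algebra_def g
    by (auto simp: F.star_cls F.mult_cls sum scale F.one_C ck_relators_def intro!: rel)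
qed

theorem ck_gen_generates: "cstar_generated (ck_algebra A) (range (ck_gen A)) = carrier (ck_algebra A)"
proof -
  interpret F: free_cstar_seminorm "ck_norm A" by (rule ck_norm_locale)
  have "carrier F.C \<subseteq> D" if D: "cstar_subalgebra D F.C" "range (ck_gen A) \<subseteq> D" for D
  proof
    let ?k = "\<lambda>x. F.cls (\<lambda>_. x)"
    have add: "\<And>x y. ?k x \<in> D \<Longrightarrow> ?k y \<in> D \<Longrightarrow> ?k (x + y) \<in> D"
      and mult: "\<And>x y. ?k x \<in> D \<Longrightarrow> ?k y \<in> D \<Longrightarrow> ?k (x * y) \<in> D"
      and scale: "\<And>c x. ?k x \<in> D \<Longrightarrow> ?k (free_scale c x) \<in> D"
      and st: "\<And>x. ?k x \<in> D \<Longrightarrow> ?k (free_star x) \<in> D"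
      and zero: "?k 0 \<in> D"
      using D(1) F.add_cls[OF F.cauchy_const F.cauchy_const] F.mult_cls[OF F.cauchy_const F.cauchy_const]
        F.smult_cls[OF F.cauchy_const] F.star_cls[OF F.cauchy_const] F.zero_C
      unfolding cstar_subalgebra_def by metis+
    have closed: "l \<in> D" if "\<And>n. f n \<in> D" "l \<in> carrier F.C"
        "(\<lambda>n. alg_norm F.C (f n \<ominus>\<^bsub>F.C\<^esub> l)) \<longlonglongrightarrow> 0" for f l
    proof -
      have "\<forall>f l. (\<forall>n::nat. f n \<in> D) \<and> l \<in> carrier F.C \<and>
          (\<lambda>n. alg_norm F.C (f n \<ominus>\<^bsub>F.C\<^esub> l)) \<longlonglongrightarrow> 0 \<longrightarrow> l \<in> D"
        using D(1) unfolding cstar_subalgebra_def by (elim conjE)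
      from this[THEN spec, THEN spec, of f l, THEN mp] that show ?thesis by simp
    qed
    have gen: "?k (gen i) \<in> D" for i using D(2) by (auto simp: ck_gen_def const_class_def)
    have adj: "?k (adj i) \<in> D" for i using st[OF gen[of i]] by simp
    have sum: "?k (\<Sum>j\<in>J. f j) \<in> D" if "\<And>j. ?k (f j) \<in> D" for f and J :: "'a set"
      by (induction J rule: infinite_finite_induct) (auto intro: add zero that)
    have "?k ((\<Sum>j\<in>UNIV. gen j * adj j) - 1) = ?k 0"
      using ck_norm_seminorm[of A] by (subst F.cls_eq_iff) (auto simp: ck_relators_def)
    then have "?k (\<Sum>j\<in>UNIV. gen j * adj j) = ?k 1"
      by (simp add: F.cls_eq_iff)
    then have one: "?k 1 \<in> D" using sum[of "\<lambda>j. gen j * adj j" UNIV] mult[OF gen adj] by simp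
    have word: "?k (Poly_Mapping.single (Word ls) 1) \<in> D" for ls
    proof (induction ls)
      case Nil then show ?case using one by (simp add: zero_star_word_def[symmetric])
    next
      case (Cons l ls)
      have "Poly_Mapping.single (Word (l # ls)) 1 =
        (case l of Gen i \<Rightarrow> gen i | Adj i \<Rightarrow> adj i) * Poly_Mapping.single (Word ls) 1"
        by (simp add: gen_def adj_def mult_single plus_star_word_def split: letter.split)
      then show ?case using mult[OF _ Cons] gen adj by (auto split: letter.splits)
    qed
    have free: "?k x \<in> D" for x
    proof (induction x rule: free_induct)
      case (single w c)
      show ?case using scale[OF word[of "letters w"], of c] by (simp add: free_scale_def mult_single)
    qed (auto intro: add zero)
    fix a assume "a \<in> carrier F.C"
    then obtain X where X: "X \<in> cauchy_seqs (ck_norm A)" "a = F.cls X" by (rule F.cls_cases)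
    interpret cstar_algebra F.C by (rule F.cstar_algebra_C)
    have "(\<lambda>n. alg_norm F.C (?k (X n) \<ominus>\<^bsub>F.C\<^esub> a)) \<longlonglongrightarrow> 0"
    proof (rule LIMSEQ_I)
      fix e :: real assume e: "e > 0"
      obtain M where M: "\<forall>m\<ge>M. \<forall>n\<ge>M. ck_norm A (X m - X n) < e / 2" using F.cauchyD[OF X(1), of "e / 2"] e by auto
      have "norm (alg_norm F.C (?k (X k) \<ominus>\<^bsub>F.C\<^esub> a) - 0) < e" if "k \<ge> M" for k
      proof -
        have "alg_norm F.C (?k (X k) \<ominus>\<^bsub>F.C\<^esub> a) \<le> e / 2"
          unfolding X(2) F.minus_cls[OF F.cauchy_const X(1)]
          by (rule LIMSEQ_le_const2[OF F.norm_cls]) (use X M that in \<open>auto intro!: exI[of _ M] less_imp_le\<close>)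
        moreover have "0 \<le> alg_norm F.C (?k (X k) \<ominus>\<^bsub>F.C\<^esub> a)"
          using X by (intro norm_nonneg) auto
        ultimately show ?thesis using e by simp
      qed
      then show "\<exists>no. \<forall>n\<ge>no. norm (alg_norm F.C (?k (X n) \<ominus>\<^bsub>F.C\<^esub> a) - 0) < e" by blast
    qed
    moreover have "a \<in> carrier F.C" using X by simp
    ultimately show "a \<in> D" using closed[of "\<lambda>n. ?k (X n)" a] free by simp
  qed
  moreover have "cstar_subalgebra (carrier F.C) F.C"
  proof -
    interpret cstar_algebra F.C by (rule F.cstar_algebra_C)
    show ?thesis by (auto simp: cstar_subalgebra_def)
  qed
  moreover have "range (ck_gen A) \<subseteq> carrier F.C" by (auto simp: ck_gen_def const_class_def)
  ultimately show ?thesis unfolding cstar_generated_def ck_algebra_def by blast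
qed

end

theory Submission
  imports Defs
begin

text \<open>
Everything is reduced to the free star-algebra modulo the null ideal of the universal seminorm, and to
its representation on functions on the one-sided shift space, in which \<open>S\<^sub>i\<close> prepends the letter \<open>i\<close>.
The matrix coefficients of this representation are bounded by the universal seminorm
(\<open>coefficient_bounded\<close>), because the operator norm on finitely supported functions is one of the
seminorms in the supremum. The representation need not be faithful, since the shift may have isolated
periodic points; but it is faithful on the elements of each fixed degree
(\<open>homogeneous_faithful\<close>). Indeed, a word applied to a sufficiently long path \<open>S\<^sub>\<nu>\<close> gives a path \<open>S\<^sub>\<mu>\<close> or
zero, and for a fixed degree and a point beginning with \<open>\<nu>\<close>, the path \<open>\<mu>\<close> can be read off from the
point to which the word moves it. This needs orthogonality of the ranges of the generators; it is not
among the relations, and follows from the C*-identity because the range projections add up to one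
(\<open>projections_orthogonal\<close>). Hence no uniqueness theorem for Cuntz--Krieger algebras is used, and
condition (I) plays no role.

From a conjugacy \<open>h\<close>, with lag bounded by some \<open>K\<close> by compactness, the partial homeomorphism
\<open>h(z') \<mapsto> h(z)\<close>, where \<open>z'\<close> is the shift of \<open>z\<close> and \<open>z\<close> ranges over the points beginning with \<open>i\<close>,
changes only a prefix of bounded length and makes it longer by one letter. So it is implemented by a
finite sum \<open>transport i\<close> of products \<open>S\<^sub>\<mu> S\<^sub>\<nu>\<^sup>*\<close> with \<open>\<mu>\<close> one letter longer than \<open>\<nu>\<close>. Mapping the generators
of the first algebra to these elements intertwines the representations along \<open>h\<close>
(\<open>rep_subst\<close>); as everything is homogeneous, faithfulness in each degree shows that the relations hold,
that the homomorphism constructed from the inverse of \<open>h\<close> is its inverse, and that path projections go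
to sums of path projections (\<open>diagonal_gauge_isomorphism\<close>).

Conversely, let \<open>\<Psi>\<close> be an isomorphism. The diagonal acts diagonally in the representation, and evaluation
at a point \<open>x\<close>, composed with the inverse of \<open>\<Psi>\<close>, is a character of the other diagonal. Characters are
contractive, and this one is therefore evaluation at a unique point \<open>h(x)\<close>
(\<open>image_point_exists\<close>). The image \<open>n = \<Psi>(S\<^sub>i)\<close> normalizes the diagonal, so its column at \<open>h(x')\<close>, where
\<open>x'\<close> is the shift of a point \<open>x\<close> that begins with \<open>i\<close>, is concentrated at \<open>h(x)\<close>. As \<open>n\<close> has degree one for
the gauge action, it is approximated by combinations of words of degree one; one of these words must
then move \<open>h(x')\<close> to \<open>h(x)\<close>, which bounds the lag in terms of the length of the words in the
approximation (\<open>letter_lag\<close>).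
\<close>

section \<open>Orthogonality of projections with sum one\<close>

context free_cstar_seminorm
begin

text \<open>Equality modulo the null ideal of the seminorm, that is, equality of the images in the
  completion.\<close>

definition eqv :: "'i free_algebra \<Rightarrow> 'i free_algebra \<Rightarrow> bool" (infix "\<simeq>" 50) where
  "x \<simeq> y \<longleftrightarrow> N (x - y) = 0"

lemma null_rules:
  "N x = 0 \<Longrightarrow> N y = 0 \<Longrightarrow> N (x + y) = 0"
  "N x = 0 \<Longrightarrow> N y = 0 \<Longrightarrow> N (x - y) = 0"
  "N x = 0 \<Longrightarrow> N (x * z) = 0"
  "N x = 0 \<Longrightarrow> N (z * x) = 0"
  using N_rules(1)[of x y] N_rules(7)[of x y] N_rules(3)[of x z] N_rules(3)[of z x]
    N_rules(8)[of "x + y"] N_rules(8)[of "x - y"] N_rules(8)[of "x * z"] N_rules(8)[of "z * x"]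
  by auto

lemma eqv_refl [simp]: "x \<simeq> x"
  by (simp add: eqv_def N_rules)

lemma eqv_sym: "x \<simeq> y \<Longrightarrow> y \<simeq> x"
  by (simp add: eqv_def N_minus_commute)

lemma eqv_trans [trans]: "x \<simeq> y \<Longrightarrow> y \<simeq> z \<Longrightarrow> x \<simeq> z"
  using null_rules(1)[of "x - y" "y - z"] by (simp add: eqv_def)

lemma eqv_add: "x \<simeq> y \<Longrightarrow> x' \<simeq> y' \<Longrightarrow> x + x' \<simeq> y + y'"
  using null_rules(1)[of "x - y" "x' - y'"] by (simp add: eqv_def algebra_simps)

lemma eqv_mult: "x \<simeq> y \<Longrightarrow> x' \<simeq> y' \<Longrightarrow> x * x' \<simeq> y * y'"
  using null_rules(1)[OF null_rules(3)[of "x - y" x'] null_rules(4)[of "x' - y'" y]]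
  by (simp add: eqv_def algebra_simps)

lemma eqv_scale: "x \<simeq> y \<Longrightarrow> free_scale c x \<simeq> free_scale c y"
  by (simp add: eqv_def N_rules flip: free_scale_simps(2))

lemma eqv_star: "x \<simeq> y \<Longrightarrow> free_star x \<simeq> free_star y"
  by (simp add: eqv_def N_rules flip: star_diff)

lemma eqv_sum: "(\<And>j. j \<in> J \<Longrightarrow> f j \<simeq> g j) \<Longrightarrow> (\<Sum>j\<in>J. f j) \<simeq> (\<Sum>j\<in>J. g j)"
  by (induction J rule: infinite_finite_induct) (auto intro: eqv_add)

lemma eqv_N: "x \<simeq> y \<Longrightarrow> N x = N y"
  using N_rev_triangle[of x y] by (simp add: eqv_def)

lemma eqv_zero_iff: "x \<simeq> 0 \<longleftrightarrow> N x = 0"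
  by (simp add: eqv_def)

lemma unit_ball_mult: "N x \<le> 1 \<Longrightarrow> N y \<le> 1 \<Longrightarrow> N (x * y) \<le> 1"
  using N_rules(3)[of x y] N_rules(8) by (meson mult_le_one order_trans)

lemma unit_ball_average:
  assumes "N x \<le> 1" "N y \<le> 1" "x + y \<simeq> z + z" shows "N z \<le> 1"
proof -
  have "z + z = free_scale 2 z"
    using free_scale_simps(3)[of 1 1 z] by (simp add: free_scale_simps(5))
  then have "2 * N z = N (x + y)" using eqv_N[OF assms(3)] N_rules(2)[of 2 z] by simp
  then show ?thesis using N_rules(1)[of x y] assms by simp
qed

text \<open>In the corner of a projection \<open>q\<close>, the unit is an extreme point of the unit ball: if both
  \<open>q + b\<close> and \<open>q - b\<close> are contractions with \<open>b\<close> selfadjoint, the same holds for \<open>3/2\<close> times \<open>b\<close>.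
  Averaging the squares, the fourth powers and \<open>q - b\<^sup>4 = (q + b) (q - b) (q + b\<^sup>2)\<close> shows that
  \<open>q + 3 b\<^sup>2\<close> is a contraction; by the C*-identity so is \<open>q + i \<surd>3 b\<close>, hence
  \<open>q - 3 b\<^sup>2\<close>; and \<open>3/4 (q + b)\<^sup>2 + 1/4 (q - 3 b\<^sup>2) = q + 3/2 b\<close>.\<close>

lemma unit_extreme_step:
  assumes sa: "free_star q = q" "free_star b = b"
    and q: "q * q \<simeq> q" "q * b \<simeq> b" "b * q \<simeq> b"
    and le: "N (q + b) \<le> 1" "N (q - b) \<le> 1"
  shows "N (q + free_scale (3 / 2) b) \<le> 1" "N (q - free_scale (3 / 2) b) \<le> 1"
proof -
  define c where "c = b * b"
  define z1 z2 z3 where "z1 = q * q - q" and "z2 = q * b - b" and "z3 = b * q - b"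
  have z: "N z1 = 0" "N z2 = 0" "N z3 = 0" using q by (auto simp: z1_def z2_def z3_def eqv_def)
  have diffI: "x \<simeq> y" if "x - y = w" "N w = 0" for x y w using that by (simp add: eqv_def)
  note zs = z1_def z2_def z3_def c_def algebra_simps
  note nulls = null_rules z
  have c1: "N (q + c) \<le> 1"
    by (rule unit_ball_average[OF unit_ball_mult[OF le(1) le(1)] unit_ball_mult[OF le(2) le(2)]],
        rule diffI[of _ _ "z1 + z1"]) (simp add: zs, intro nulls)
  have "(q + b) * (q + b) \<simeq> q + b + b + c"
    by (rule diffI[of _ _ "z1 + z2 + z3"]) (simp add: zs, intro nulls)
  then have u2: "N (q + b + b + c) \<le> 1" using unit_ball_mult[OF le(1) le(1)] eqv_N by simp
  have "(q - b) * (q - b) \<simeq> q - b - b + c"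
    by (rule diffI[of _ _ "z1 - z2 - z3"]) (simp add: zs, intro nulls)
  then have v2: "N (q - b - b + c) \<le> 1" using unit_ball_mult[OF le(2) le(2)] eqv_N by simp
  have c6: "N (q + c + c + c + c + c + c + c * c) \<le> 1"
  proof (rule unit_ball_average[OF unit_ball_mult[OF u2 u2] unit_ball_mult[OF v2 v2]])
    let ?w = "z1 + z2 * b + b * z3"
    show "(q + b + b + c) * (q + b + b + c) + (q - b - b + c) * (q - b - b + c) \<simeq>
        (q + c + c + c + c + c + c + c * c) + (q + c + c + c + c + c + c + c * c)"
      by (rule diffI[of _ _ "?w + ?w"]) (simp add: zs, intro nulls)
  qed
  have "(q + b) * (q - b) * (q + c) \<simeq> q - c * c"
    by (rule diffI[of _ _ "(z1 - z2 + z3) * (q + c) + (z1 + z2 * b - b * z3)"])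
       (simp add: zs, intro nulls)
  then have c4: "N (q - c * c) \<le> 1"
    using unit_ball_mult[OF unit_ball_mult[OF le] c1] eqv_N by simp
  have c3: "N (q + c + c + c) \<le> 1"
    by (rule unit_ball_average[OF c6 c4]) (simp add: algebra_simps)
  have three: "free_scale 3 c = c + c + c"
    using free_scale_simps(3)[of "1 + 1" 1 c] free_scale_simps(3)[of 1 1 c] by (simp add: free_scale_simps(5))
  have w: "N (q + free_scale s b) \<le> 1" if s: "cnj s = - s" "s * s = - 3" for s
  proof -
    let ?w = "q + free_scale s b"
    have "free_star ?w * ?w \<simeq> q + c + c + c"
    proof (rule diffI[of _ _ "z1 + free_scale s z2 - free_scale s z3"])
      have "free_scale (s * s) (b * b) = - free_scale 3 c"
        unfolding s(2) c_def by (simp add: free_scale_def single_uminus)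
      then have *: "free_scale (s * s) (b * b) = - (c + c + c)" by (simp add: three)
      have m: "free_scale (- s) b = - free_scale s b" by (simp add: free_scale_def single_uminus)
      show "free_star ?w * ?w - (q + c + c + c) = z1 + free_scale s z2 - free_scale s z3"
        using * by (simp add: free_star_add free_star_scale sa s(1) m z1_def z2_def z3_def
            free_scale_simps free_scale_central algebra_simps)
      show "N (z1 + free_scale s z2 - free_scale s z3) = 0"
        by (intro nulls) (simp_all add: N_rules z)
    qed
    then have "(N ?w)\<^sup>2 \<le> 1" using N_rules(4)[of ?w] eqv_N c3 by simp
    then show ?thesis using N_rules(8)[of ?w] by (simp add: power_le_one_iff)
  qed
  let ?s = "\<i> * complex_of_real (sqrt 3)"
  have s: "cnj ?s = - ?s" "?s * ?s = - 3" "cnj (- ?s) = - (- ?s)" "(- ?s) * (- ?s) = - 3"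
    by (auto simp: complex_eq_iff)
  have d: "N (q - c - c - c) \<le> 1"
  proof (rule unit_ball_average[OF unit_ball_mult[OF w w] unit_ball_mult[OF w w]])
    define t where "t = free_scale ?s b"
    have "t * t = - free_scale 3 c"
      by (simp add: t_def free_scale_simps free_scale_central c_def s(2)) (simp add: free_scale_def single_uminus)
    then have tt: "t * t = - (c + c + c)" by (simp add: three)
    have m: "free_scale (- ?s) b = - t" by (simp add: t_def free_scale_def single_uminus)
    have "(q + t) * (q + t) + (q + - t) * (q + - t) - (q - c - c - c + (q - c - c - c)) = z1 + z1"
      by (simp add: z1_def tt algebra_simps)
    then show "(q + free_scale ?s b) * (q + free_scale ?s b) + (q + free_scale (- ?s) b) * (q + free_scale (- ?s) b)
      \<simeq> q - c - c - c + (q - c - c - c)"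
      unfolding m t_def[symmetric] by (rule diffI) (intro nulls)
  qed (use s in auto)
  have fin: "N (q + free_scale (3 / 2) b') \<le> 1"
    if "N (q + b' + b' + c) \<le> 1" for b'
  proof -
    have "free_scale (3 / 4) (q + b' + b' + c) + free_scale (1 / 4) (q - c - c - c) =
        free_scale (3 / 4 + 1 / 4) q + free_scale (3 / 4 + 3 / 4) b' + (free_scale (3 / 4) c - free_scale (1 / 4 + 1 / 4 + 1 / 4) c)"
      unfolding free_scale_simps by (simp add: algebra_simps)
    also have "\<dots> = q + free_scale (3 / 2) b'" by (simp add: free_scale_simps(5))
    finally have e: "q + free_scale (3 / 2) b' =
      free_scale (3 / 4) (q + b' + b' + c) + free_scale (1 / 4) (q - c - c - c)" by simp
    have "N (q + free_scale (3 / 2) b') \<le> 3 / 4 * N (q + b' + b' + c) + 1 / 4 * N (q - c - c - c)"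
      unfolding e using N_rules(1)[of "free_scale (3 / 4) (q + b' + b' + c)" "free_scale (1 / 4) (q - c - c - c)"]
      by (simp add: N_rules)
    then show ?thesis using that d by linarith
  qed
  show "N (q + free_scale (3 / 2) b) \<le> 1" using fin[OF u2] .
  have "free_scale (3 / 2) (- b) = - free_scale (3 / 2) b" by (simp add: free_scale_def)
  then show "N (q - free_scale (3 / 2) b) \<le> 1" using fin[of "- b"] v2 by simp
qed

lemma unit_extreme:
  assumes sa: "free_star q = q" "free_star b = b"
    and q: "q * q \<simeq> q" "q * b \<simeq> b" "b * q \<simeq> b"
    and le: "N (q + b) \<le> 1" "N (q - b) \<le> 1"
  shows "N b = 0"
proof -
  have 1: "N (q + free_scale (of_real ((3 / 2) ^ n)) b) \<le> 1 \<and> N (q - free_scale (of_real ((3 / 2) ^ n)) b) \<le> 1" for n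
  proof (induction n)
    case 0 then show ?case using le by (simp add: free_scale_simps)
  next
    case (Suc n)
    let ?r = "complex_of_real ((3 / 2) ^ n)"
    have "free_star (free_scale ?r b) = free_scale ?r b"
      by (simp only: free_star_scale sa complex_cnj_complex_of_real)
    moreover have "q * free_scale ?r b \<simeq> free_scale ?r b" "free_scale ?r b * q \<simeq> free_scale ?r b"
      using eqv_scale q(2,3) by (auto simp: free_scale_central free_scale_simps(6))
    ultimately have "N (q + free_scale (3 / 2) (free_scale ?r b)) \<le> 1" "N (q - free_scale (3 / 2) (free_scale ?r b)) \<le> 1"
      using unit_extreme_step[OF sa(1) _ q(1)] Suc by blast+
    moreover have "free_scale (3 / 2) (free_scale ?r b) = free_scale (of_real ((3 / 2) ^ Suc n)) b"
      by (simp add: free_scale_simps(4))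
    ultimately show ?case by simp
  qed
  have 2: "(3 / 2) ^ n * N b \<le> 1" for n :: nat
  proof -
    let ?x = "free_scale (of_real ((3 / 2) ^ n)) b"
    have "?x + ?x \<simeq> (q + ?x) - (q - ?x)" by simp
    then have "N (?x + ?x) \<le> 2" using 1[of n] N_rules(7)[of "q + ?x" "q - ?x"] eqv_N by force
    moreover have "?x + ?x = free_scale 2 ?x"
      using free_scale_simps(3)[of 1 1 ?x] by (simp add: free_scale_simps(5))
    ultimately have "2 * N ?x \<le> 2" using N_rules(2)[of 2 ?x] by simp
    then show ?thesis using N_rules(2)[of "of_real ((3 / 2) ^ n)" b] by (simp add: norm_power norm_divide)
  qed
  show ?thesis
  proof (rule ccontr)
    assume "N b \<noteq> 0"
    then have "N b > 0" using N_rules(8)[of b] by simp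
    obtain n where "1 / N b < (3 / 2 :: real) ^ n" using real_arch_pow[of "3 / 2" "1 / N b"] by auto
    then show False using 2[of n] \<open>N b > 0\<close> by (simp add: divide_simps)
  qed
qed

lemma N_projection: assumes "free_star e = e" "e * e \<simeq> e" shows "N e \<le> 1"
proof -
  have "(N e)\<^sup>2 = N e" using N_rules(4)[of e] eqv_N[OF assms(2)] assms(1) by simp
  then show ?thesis by (auto simp: power2_eq_square)
qed

text \<open>Compress by \<open>q = e j\<close>: the elements \<open>q e\<^sub>k q\<close> with \<open>k\<close> different from \<open>j\<close> add up to zero, so
  \<open>a = q e\<^sub>i q\<close> is minus the sum of the others. Both \<open>q - a\<close> and \<open>q + a / m\<close> are then contractions,
  with \<open>m - 1\<close> the number of the remaining projections, and \<open>a = 0\<close> by \<open>unit_extreme\<close>.\<close>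

lemma projections_orthogonal:
  fixes e :: "'j \<Rightarrow> 'i free_algebra"
  assumes J: "finite J" and sa: "\<And>j. free_star (e j) = e j" and idem: "\<And>j. e j * e j \<simeq> e j"
    and one: "(\<Sum>j\<in>J. e j) \<simeq> 1" and ij: "i \<in> J" "j \<in> J" "i \<noteq> j"
  shows "e i * e j \<simeq> 0"
proof -
  have star1: "free_star 1 = (1 :: 'i free_algebra)" using free_star_single[of 0 1] by (simp del: free_star_single)
  define q a where "q = e j" and "a = q * e i * q"
  have c1: "N (q * (1 - e k) * q) \<le> 1" for k
  proof -
    have "(1 - e k) * (1 - e k) - (1 - e k) = e k * e k - e k" by (simp add: algebra_simps)
    then have "(1 - e k) * (1 - e k) \<simeq> 1 - e k" using idem[of k] by (simp add: eqv_def)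
    then show ?thesis unfolding q_def
      by (intro unit_ball_mult N_projection sa idem) (simp add: star_diff star1 sa)
  qed
  have qq: "q * q \<simeq> q" unfolding q_def by (rule idem)
  define m where "m = real (card (J - {i, j}) + 1)"
  have m1: "m \<ge> 1" by (simp add: m_def)
  have minus: "N (q - a) \<le> 1"
  proof -
    have "q * (1 - e i) * q \<simeq> q - a" using qq by (simp add: a_def algebra_simps eqv_def)
    then show ?thesis using c1[of i] eqv_N by simp
  qed
  have fsn: "free_scale (of_nat n) q = of_nat n * q" for n
    by (induction n) (auto simp: free_scale_simps distrib_right, simp add: free_scale_def)
  have plus: "N (free_scale (of_real m) q + a) \<le> m"
  proof -
    let ?K = "J - {i, j}"
    have "(\<Sum>k\<in>J. e k) = e j + (e i + (\<Sum>k\<in>?K. e k))"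
    proof -
      have "J = insert j (insert i ?K)" using ij by auto
      then show ?thesis using J ij by (metis (no_types, lifting) Diff_iff finite_Diff finite_insert insert_iff sum.insert)
    qed
    then have "q * (e j + (e i + (\<Sum>k\<in>?K. e k))) * q \<simeq> q * 1 * q" using one by (intro eqv_mult) auto
    then have "N (q * q * q + (a + (\<Sum>k\<in>?K. q * e k * q)) - q * q) = 0"
      by (simp add: eqv_def a_def q_def algebra_simps sum_distrib_left sum_distrib_right)
    moreover have "q * q * q \<simeq> q * q" using qq by (intro eqv_mult) auto
    ultimately have *: "N (a + (\<Sum>k\<in>?K. q * e k * q)) = 0"
      using null_rules(2)[of "q * q * q + (a + (\<Sum>k\<in>?K. q * e k * q)) - q * q" "q * q * q - q * q"]
      by (simp add: eqv_def algebra_simps)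
    have s: "(\<Sum>k\<in>?K. q * (1 - e k) * q) = of_nat (card ?K) * (q * q) - (\<Sum>k\<in>?K. q * e k * q)"
      by (simp add: algebra_simps sum_subtractf)
    have "q + (\<Sum>k\<in>?K. q * (1 - e k) * q) - (free_scale (of_real m) q + a)
        = of_nat (card ?K) * (q * q - q) - (a + (\<Sum>k\<in>?K. q * e k * q))"
      unfolding s m_def by (simp add: free_scale_simps fsn algebra_simps)
    moreover have "N \<dots> = 0"
      by (rule null_rules(2)[OF null_rules(4)[OF qq[unfolded eqv_def]] *])
    ultimately have "q + (\<Sum>k\<in>?K. q * (1 - e k) * q) \<simeq> free_scale (of_real m) q + a"
      unfolding eqv_def by (rule ssubst)
    then have "N (free_scale (of_real m) q + a) = N (q + (\<Sum>k\<in>?K. q * (1 - e k) * q))" by (rule eqv_N[symmetric])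
    also have "\<dots> \<le> N q + N (\<Sum>k\<in>?K. q * (1 - e k) * q)" by (rule N_rules)
    also have "N (\<Sum>k\<in>K. q * (1 - e k) * q) \<le> real (card K)" for K
    proof (induction K rule: infinite_finite_induct)
      case (insert k K)
      then show ?case using c1[of k] N_rules(1)[of "q * (1 - e k) * q" "\<Sum>k\<in>K. q * (1 - e k) * q"] by simp
    qed (auto simp: N_rules)
    finally show ?thesis using N_projection[OF sa idem, of j] by (simp add: m_def q_def)
  qed
  define b where "b = free_scale (of_real (1 / m)) a"
  have "q + b = free_scale (of_real (1 / m)) (free_scale (of_real m) q + a)"
    using m1 by (simp add: b_def free_scale_simps)
  then have "N (q + b) = 1 / m * N (free_scale (of_real m) q + a)" using m1 by (simp only: N_rules(2)) (simp add: norm_divide)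
  also have "\<dots> \<le> 1" using plus m1 by (simp add: divide_simps)
  finally have le1: "N (q + b) \<le> 1" .
  have "q - b = free_scale (of_real (1 / m)) (q - a) + free_scale (of_real (1 - 1 / m)) q"
    by (simp add: b_def free_scale_simps flip: free_scale_simps(3))
  then have "N (q - b) \<le> N (free_scale (of_real (1 / m)) (q - a)) + N (free_scale (of_real (1 - 1 / m)) q)"
    by (simp only: N_rules(1))
  also have "\<dots> = 1 / m * N (q - a) + (1 - 1 / m) * N q"
  proof -
    have "cmod (of_real (1 / m)) = 1 / m" "cmod (of_real (1 - 1 / m)) = 1 - 1 / m"
      using m1 by (simp_all only: norm_of_real) auto
    then show ?thesis by (simp only: N_rules(2))
  qed
  also have "\<dots> \<le> 1 / m * 1 + (1 - 1 / m) * 1"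
    using minus N_projection[OF sa idem, of j] m1 unfolding q_def
    by (intro add_mono mult_left_mono) auto
  finally have le2: "N (q - b) \<le> 1" by simp
  have sq: "free_star q = q" by (simp add: q_def sa)
  have "q * b \<simeq> b" "b * q \<simeq> b"
    unfolding b_def free_scale_central free_scale_simps(6)
    using eqv_mult[OF qq eqv_refl[of "e i * q"]] eqv_mult[OF eqv_refl[of "q * e i"] qq]
    by (auto intro!: eqv_scale simp: a_def mult.assoc)
  moreover have "free_star b = b"
    by (simp add: b_def free_star_scale a_def free_star_mult sq sa mult.assoc)
  ultimately have "N b = 0" using unit_extreme[OF sq _ qq] le1 le2 by blast
  then have "N a = 0" using m1 N_rules(2)[of "of_real (1 / m)" a] by (simp add: b_def norm_divide)
  moreover have "free_star (e i * q) * (e i * q) \<simeq> a"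
    using eqv_mult[OF eqv_mult[OF eqv_refl[of q] idem[of i]] eqv_refl[of q]]
    by (simp add: a_def free_star_mult sq sa mult.assoc)
  ultimately have "(N (e i * q))\<^sup>2 = 0" using N_rules(4)[of "e i * q"] eqv_N by simp
  then show ?thesis by (simp add: eqv_zero_iff q_def)
qed

end

section \<open>The representation on functions on the shift space\<close>

text \<open>A matrix with entries 0 and 1 and nonzero rows; nonzero rows make every path a prefix of some
  point of the shift space.\<close>

locale markov_shift =
  fixes A :: "nat^'i^'i::finite"
  assumes zero_one: "A $ i $ j \<in> {0, 1}" and rows_nonzero: "row i A \<noteq> 0"
begin

sublocale free_cstar_seminorm "ck_norm A"
  by (rule ck_norm_locale)

abbreviation "N \<equiv> ck_norm A"
abbreviation "X \<equiv> shift_space A"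

lemma shift_nth: "shift x n = x (Suc n)"
  by (simp add: shift_def)

lemma X_step: "x \<in> X \<Longrightarrow> A $ x n $ x (Suc n) = 1"
  by (simp add: shift_space_def)

lemma shift_in_X [simp, intro]: "x \<in> X \<Longrightarrow> shift x \<in> X"
  by (simp add: shift_space_def shift_def)

lemma cons_in_X: "case_nat i x \<in> X \<longleftrightarrow> x \<in> X \<and> A $ i $ x 0 = 1"
  by (auto simp: shift_space_def split: nat.splits)

text \<open>The transposed action of a letter on points: the operator of \<open>Gen i\<close> sends a function \<open>v\<close> to the
  function with value \<open>v (shift x)\<close> at a point \<open>x\<close> that begins with \<open>i\<close>, and the operator of
  \<open>Adj i\<close> sends it to \<open>v (i x)\<close> wherever \<open>i x\<close> is a point.\<close>

fun pull :: "'i letter \<Rightarrow> (nat \<Rightarrow> 'i) \<Rightarrow> (nat \<Rightarrow> 'i) option" where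
  "pull (Gen i) x = (if x 0 = i then Some (shift x) else None)"
| "pull (Adj i) x = (if A $ i $ x 0 = 1 then Some (case_nat i x) else None)"

fun word_pull :: "'i letter list \<Rightarrow> (nat \<Rightarrow> 'i) \<Rightarrow> (nat \<Rightarrow> 'i) option" where
  "word_pull [] x = Some x"
| "word_pull (l # ls) x = Option.bind (pull l x) (word_pull ls)"

text \<open>The operator of an element of the free algebra, on functions on the shift space; the
  result is extended by zero outside of the shift space.\<close>

definition rep :: "'i free_algebra \<Rightarrow> ((nat \<Rightarrow> 'i) \<Rightarrow> complex) \<Rightarrow> (nat \<Rightarrow> 'i) \<Rightarrow> complex" where
  "rep a v x = (if x \<in> X then \<Sum>w\<in>Poly_Mapping.keys a. Poly_Mapping.lookup a w *
     (case word_pull (letters w) x of None \<Rightarrow> 0 | Some y \<Rightarrow> v y) else 0)"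

lemma word_pull_append: "word_pull (ks @ ls) x = Option.bind (word_pull ks x) (word_pull ls)"
  by (induction ks arbitrary: x) (auto split: Option.bind_splits)

lemma pull_star:
  assumes "x \<in> X" "pull l x = Some y" shows "y \<in> X" "pull (letter_star l) y = Some x"
proof -
  have "y \<in> X \<and> pull (letter_star l) y = Some x"
  proof (cases l)
    case (Gen i)
    then have y: "x 0 = i" "y = shift x" using assms by (auto split: if_splits)
    have "case_nat (x 0) (shift x) = x" by (auto simp: fun_eq_iff shift_def split: nat.split)
    then show ?thesis using Gen assms(1) X_step[OF assms(1), of 0] y by (simp add: shift_nth)
  next
    case (Adj i)
    then have "A $ i $ x 0 = 1" "y = case_nat i x" using assms by (auto split: if_splits)
    moreover have "shift (case_nat i x) = x" by (auto simp: shift_def)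
    ultimately show ?thesis using Adj assms(1) by (simp add: cons_in_X)
  qed
  then show "y \<in> X" "pull (letter_star l) y = Some x" by auto
qed

lemma word_pull_star:
  assumes "x \<in> X" "word_pull ls x = Some y"
  shows "y \<in> X" "word_pull (rev (map letter_star ls)) y = Some x"
proof -
  have "y \<in> X \<and> word_pull (rev (map letter_star ls)) y = Some x"
    using assms
  proof (induction ls arbitrary: x)
    case (Cons l ls)
    then obtain z where z: "pull l x = Some z" "word_pull ls z = Some y"
      by (auto split: Option.bind_splits)
    note bs = pull_star[OF Cons.prems(1) z(1)]
    show ?case using Cons.IH[OF bs(1) z(2)] bs by (simp add: word_pull_append)
  qed simp
  then show "y \<in> X" "word_pull (rev (map letter_star ls)) y = Some x" by auto
qed

lemma word_pull_star_iff:
  assumes "x \<in> X" "y \<in> X"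
  shows "word_pull (letters (word_star w)) y = Some x \<longleftrightarrow> word_pull (letters w) x = Some y"
  using word_pull_star(2)[OF assms(1), of "letters w" y] word_pull_star(2)[OF assms(2), of "letters (word_star w)" x]
    word_star_star[of w]
  by (auto simp: word_star_def rev_map) (metis star_word.sel)

lemma rep_outside [simp]: "x \<notin> X \<Longrightarrow> rep a v x = 0"
  by (simp add: rep_def)

lemma rep_superset:
  assumes "finite K" "Poly_Mapping.keys a \<subseteq> K" "x \<in> X"
  shows "rep a v x = (\<Sum>w\<in>K. Poly_Mapping.lookup a w * (case word_pull (letters w) x of None \<Rightarrow> 0 | Some y \<Rightarrow> v y))"
  unfolding rep_def using assms by (auto intro!: sum.mono_neutral_left simp: in_keys_iff)

lemma rep_zero [simp]: "rep 0 v x = 0"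
  by (simp add: rep_def)

lemma rep_single:
  "x \<in> X \<Longrightarrow> rep (Poly_Mapping.single w c) v x = c * (case word_pull (letters w) x of None \<Rightarrow> 0 | Some y \<Rightarrow> v y)"
  using rep_superset[of "{w}" "Poly_Mapping.single w c"] by simp

lemma rep_add: "rep (a + b) v x = rep a v x + rep b v x"
proof (cases "x \<in> X")
  case True
  let ?K = "Poly_Mapping.keys a \<union> Poly_Mapping.keys b"
  show ?thesis using True rep_superset[of ?K a x v] rep_superset[of ?K b x v] rep_superset[of ?K "a + b" x v]
    by (simp add: Poly_Mapping.keys_add lookup_add distrib_right sum.distrib)
qed simp

lemma rep_vector_add: "rep a (\<lambda>y. v y + v' y) x = rep a v x + rep a v' x"
  by (auto simp: rep_def sum.distrib[symmetric] algebra_simps intro!: sum.cong split: option.split)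

lemma rep_vector_scale: "rep a (\<lambda>y. c * v y) x = c * rep a v x"
  by (auto simp: rep_def sum_distrib_left algebra_simps intro!: sum.cong split: option.split)

lemma letters_zero [simp]: "letters 0 = []"
  by (simp add: zero_star_word_def)

lemma rep_mult: "rep (a * b) v x = rep a (rep b v) x"
proof (cases "x \<in> X")
  case x: True
  show ?thesis
  proof (induction a rule: free_induct)
    case (single w c)
    show ?case
    proof (induction b rule: free_induct)
      case zero
      show ?case using x by (auto simp: rep_single split: option.splits)
    next
      case (single w' c')
      show ?case using x word_pull_star(1)[OF x]
        by (auto simp: rep_single mult_single plus_star_word_def word_pull_append split: option.splits Option.bind_splits)
    next
      case (add b b')
      then show ?case by (simp add: distrib_left rep_add rep_vector_add)
    qed
  qed (auto simp: distrib_right rep_add)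
qed simp

lemma rep_one: "x \<in> X \<Longrightarrow> rep 1 v x = v x"
  using rep_single[of x 0 1 v] by simp

lemma rep_scale: "rep (free_scale c a) v x = c * rep a v x"
  by (cases "x \<in> X") (auto simp: free_scale_def rep_mult rep_single)

lemma rep_minus: "rep (a - b) v x = rep a v x - rep b v x"
  using rep_add[of "a - b" b v x] by simp

lemma rep_sum: "rep (\<Sum>j\<in>J. f j) v x = (\<Sum>j\<in>J. rep (f j) v x)"
  by (induction J rule: infinite_finite_induct) (auto simp: rep_add)

lemma rep_gen: "x \<in> X \<Longrightarrow> rep (gen i) v x = (if x 0 = i then v (shift x) else 0)"
  and rep_adj: "x \<in> X \<Longrightarrow> rep (adj i) v x = (if A $ i $ x 0 = 1 then v (case_nat i x) else 0)"
  by (auto simp: gen_def adj_def rep_single)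

lemma rep_cong:
  assumes "\<And>y. y \<in> X \<Longrightarrow> v y = v' y" shows "rep a v x = rep a v' x"
proof (cases "x \<in> X")
  case True
  then show ?thesis unfolding rep_def
    using word_pull_star(1)[OF True] assms by (auto intro!: sum.cong split: option.split)
qed simp

lemma rep_range_projection:
  assumes "x \<in> X" shows "rep (gen j * adj j) v x = (if x 0 = j then v x else 0)"
proof -
  have "case_nat (x 0) (shift x) = x" by (auto simp: fun_eq_iff shift_def split: nat.split)
  then show ?thesis using assms X_step[OF assms, of 0]
    by (auto simp: rep_mult rep_gen rep_adj shift_nth)
qed

lemma rep_relator:
  assumes r: "r \<in> ck_relators A" shows "rep r v x = 0"
proof (cases "x \<in> X")
  case x: True
  have inv: "shift (case_nat i x) = x" for i by (simp add: shift_def)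
  consider i where "r = gen i * adj i * gen i - gen i" | "r = (\<Sum>j\<in>UNIV. gen j * adj j) - 1"
    | i where "r = adj i * gen i - (\<Sum>j\<in>UNIV. of_nat (A $ i $ j) * (gen j * adj j))"
    using r unfolding ck_relators_def by blast
  then show ?thesis
  proof cases
    case (1 i)
    then show ?thesis using x rep_range_projection[OF x, of i "rep (gen i) v"] by (simp add: rep_minus rep_mult[of "gen i * adj i"] rep_gen)
  next
    case 2
    then show ?thesis using x by (simp add: rep_minus rep_sum rep_range_projection rep_one)
  next
    case (3 i)
    have "rep (of_nat (A $ i $ j) * (gen j * adj j)) v x = (if x 0 = j then of_nat (A $ i $ j) * v x else 0)" for j
      using x by (simp add: rep_scale rep_range_projection free_scale_def[symmetric] del: of_nat_Suc
          flip: single_of_nat)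
    moreover have "rep (adj i * gen i) v x = of_nat (A $ i $ x 0) * v x"
      using x zero_one[of i "x 0"] by (auto simp: rep_mult rep_adj rep_gen cons_in_X inv)
    ultimately show ?thesis using 3 x by (simp add: rep_minus rep_sum)
  qed
qed simp

subsection \<open>Boundedness\<close>

text \<open>Finitely supported functions on the shift space with the \<open>\<ell>\<^sup>2\<close> inner product; no completion
  is needed for the C*-identity of the operator norm.\<close>

definition supp :: "((nat \<Rightarrow> 'i) \<Rightarrow> complex) \<Rightarrow> (nat \<Rightarrow> 'i) set" where
  "supp v = {x. v x \<noteq> 0}"

definition vecs :: "((nat \<Rightarrow> 'i) \<Rightarrow> complex) set" where
  "vecs = {v. finite (supp v) \<and> supp v \<subseteq> X}"

definition ip :: "((nat \<Rightarrow> 'i) \<Rightarrow> complex) \<Rightarrow> ((nat \<Rightarrow> 'i) \<Rightarrow> complex) \<Rightarrow> complex" where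
  "ip u v = (\<Sum>x\<in>supp v. u x * cnj (v x))"

definition nrm :: "((nat \<Rightarrow> 'i) \<Rightarrow> complex) \<Rightarrow> real" where
  "nrm v = L2_set (\<lambda>x. cmod (v x)) (supp v)"

lemma ip_superset:
  assumes "finite F" "supp u \<inter> supp v \<subseteq> F" "finite (supp v)" shows "ip u v = (\<Sum>x\<in>F. u x * cnj (v x))"
proof -
  have "ip u v = (\<Sum>x\<in>supp u \<inter> supp v. u x * cnj (v x))"
    unfolding ip_def using assms by (intro sum.mono_neutral_right) (auto simp: supp_def)
  also have "\<dots> = (\<Sum>x\<in>F. u x * cnj (v x))"
    using assms by (intro sum.mono_neutral_left) (auto simp: supp_def)
  finally show ?thesis .
qed

lemma nrm_superset:
  assumes "finite F" "supp v \<subseteq> F" shows "nrm v = L2_set (\<lambda>x. cmod (v x)) F"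
  unfolding nrm_def L2_set_def using assms
  by (intro arg_cong[of _ _ sqrt] sum.mono_neutral_left) (auto simp: supp_def)

lemma nrm_nonneg [simp]: "0 \<le> nrm v"
  by (simp add: nrm_def L2_set_nonneg)

lemma ip_self: "ip v v = of_real ((nrm v)\<^sup>2)"
  by (simp add: ip_def nrm_def L2_set_def sum_nonneg complex_norm_square del: of_real_power)

lemma cauchy_schwarz:
  assumes "u \<in> vecs" "v \<in> vecs" shows "cmod (ip u v) \<le> nrm u * nrm v"
proof -
  let ?F = "supp u \<union> supp v"
  have F: "finite ?F" using assms by (auto simp: vecs_def)
  have "cmod (ip u v) = cmod (\<Sum>x\<in>?F. u x * cnj (v x))"
    using ip_superset[OF F] F by (simp add: le_infI1)
  also have "\<dots> \<le> (\<Sum>x\<in>?F. \<bar>cmod (u x)\<bar> * \<bar>cmod (v x)\<bar>)"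
    by (rule order.trans[OF norm_sum]) (simp add: norm_mult)
  also have "\<dots> \<le> nrm u * nrm v"
    using L2_set_mult_ineq[of "\<lambda>x. cmod (u x)" "\<lambda>x. cmod (v x)" ?F] nrm_superset[OF F, of u] nrm_superset[OF F, of v]
    by simp
  finally show ?thesis .
qed

lemma rep_vecs [simp, intro]: assumes "v \<in> vecs" shows "rep a v \<in> vecs"
proof -
  let ?S = "\<Union>w\<in>Poly_Mapping.keys a. \<Union>y\<in>supp v. set_option (word_pull (letters (word_star w)) y)"
  have "supp (rep a v) \<subseteq> ?S"
  proof
    fix x assume "x \<in> supp (rep a v)"
    then have x: "x \<in> X" "rep a v x \<noteq> 0" using rep_outside by (auto simp: supp_def) (metis rep_outside)
    then obtain w where w: "w \<in> Poly_Mapping.keys a"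
      "(case word_pull (letters w) x of None \<Rightarrow> 0 | Some y \<Rightarrow> v y) \<noteq> 0"
      unfolding rep_def by (auto elim!: sum.not_neutral_contains_not_neutral)
    then obtain y where y: "word_pull (letters w) x = Some y" "v y \<noteq> 0" by (auto split: option.splits)
    then have "word_pull (letters (word_star w)) y = Some x"
      using word_pull_star_iff x(1) word_pull_star(1) by blast
    then show "x \<in> ?S" using w y by (auto simp: supp_def)
  qed
  moreover have "finite ?S" using assms by (auto simp: vecs_def)
  moreover have "supp (rep a v) \<subseteq> X" using rep_outside by (metis (mono_tags) mem_Collect_eq subsetI supp_def)
  ultimately show ?thesis by (auto simp: vecs_def intro: finite_subset)
qed

lemma rep_adjoint:
  assumes u: "u \<in> vecs" and v: "v \<in> vecs" shows "ip (rep a u) v = ip u (rep (free_star a) v)"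
proof -
  have fin: "finite (supp u)" "finite (supp v)" "finite (supp (rep b v))" for b
    using u v rep_vecs[OF v] by (auto simp: vecs_def)
  have R: "ip u (rep b v) = (\<Sum>y\<in>supp u. u y * cnj (rep b v y))" for b
    by (rule ip_superset) (auto simp: fin)
  have X: "x \<in> X" if "x \<in> supp u \<or> x \<in> supp v" for x using u v that by (auto simp: vecs_def)
  show ?thesis unfolding R
  proof (induction a rule: free_induct)
    case zero
    show ?case by (simp add: ip_def free_star_def)
  next
    case (add a b)
    then show ?case by (simp add: ip_def rep_add free_star_add distrib_left distrib_right sum.distrib)
  next
    case (single w c)
    have "ip (rep (Poly_Mapping.single w c) u) v =
        (\<Sum>x\<in>supp v. \<Sum>y\<in>supp u. if word_pull (letters w) x = Some y then c * u y * cnj (v x) else 0)"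
      unfolding ip_def
    proof (intro sum.cong refl)
      fix x assume x: "x \<in> supp v"
      show "rep (Poly_Mapping.single w c) u x * cnj (v x) =
          (\<Sum>y\<in>supp u. if word_pull (letters w) x = Some y then c * u y * cnj (v x) else 0)"
        using x X fin by (auto simp: rep_single supp_def sum.delta split: option.split)
    qed
    also have "\<dots> = (\<Sum>y\<in>supp u. \<Sum>x\<in>supp v. if word_pull (letters w) x = Some y then c * u y * cnj (v x) else 0)"
      by (rule sum.swap)
    also have "\<dots> = (\<Sum>y\<in>supp u. u y * cnj (rep (free_star (Poly_Mapping.single w c)) v y))"
    proof (intro sum.cong refl)
      fix y assume y: "y \<in> supp u"
      have "(\<Sum>x\<in>supp v. if word_pull (letters w) x = Some y then c * u y * cnj (v x) else 0) =
          (\<Sum>x\<in>supp v. if word_pull (letters (word_star w)) y = Some x then c * u y * cnj (v x) else 0)"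
        using y X word_pull_star_iff by (intro sum.cong) auto
      also have "\<dots> = u y * cnj (rep (free_star (Poly_Mapping.single w c)) v y)"
        using y X fin by (auto simp: rep_single supp_def sum.delta split: option.split)
      finally show "(\<Sum>x\<in>supp v. if word_pull (letters w) x = Some y then c * u y * cnj (v x) else 0) =
         u y * cnj (rep (free_star (Poly_Mapping.single w c)) v y)" .
    qed
    finally show ?case .
  qed
qed

lemma nrm_add: assumes "u \<in> vecs" "v \<in> vecs" shows "nrm (\<lambda>x. u x + v x) \<le> nrm u + nrm v"
proof -
  let ?F = "supp u \<union> supp v"
  have F: "finite ?F" using assms by (auto simp: vecs_def)
  have "nrm (\<lambda>x. u x + v x) = L2_set (\<lambda>x. cmod (u x + v x)) ?F"
    by (rule nrm_superset[OF F]) (auto simp: supp_def)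
  also have "\<dots> \<le> L2_set (\<lambda>x. cmod (u x) + cmod (v x)) ?F"
    by (rule L2_set_mono) (auto intro: norm_triangle_ineq)
  also have "\<dots> \<le> L2_set (\<lambda>x. cmod (u x)) ?F + L2_set (\<lambda>x. cmod (v x)) ?F"
    by (rule L2_set_triangle_ineq)
  finally show ?thesis using nrm_superset[OF F, of u] nrm_superset[OF F, of v] by simp
qed

lemma nrm_scale: "nrm (\<lambda>x. c * v x) = cmod c * nrm v"
proof (cases "c = 0")
  case False
  then have "supp (\<lambda>x. c * v x) = supp v" by (auto simp: supp_def)
  then show ?thesis by (simp add: nrm_def L2_set_right_distrib norm_mult)
qed (simp add: nrm_def supp_def)

lemma nrm_coordinate: "v \<in> vecs \<Longrightarrow> cmod (v x) \<le> nrm v"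
  unfolding nrm_def by (cases "x \<in> supp v") (auto simp: vecs_def supp_def L2_set_nonneg intro: member_le_L2_set)

lemma rep_bounded: "\<exists>K. \<forall>v\<in>vecs. nrm (rep a v) \<le> K * nrm v"
proof (induction a rule: free_induct)
  case zero
  show ?case by (rule exI[of _ 0]) (simp add: nrm_def supp_def)
next
  case (add a b)
  then obtain K L where KL: "\<forall>v\<in>vecs. nrm (rep a v) \<le> K * nrm v" "\<forall>v\<in>vecs. nrm (rep b v) \<le> L * nrm v" by blast
  have "nrm (rep (a + b) v) \<le> (K + L) * nrm v" if v: "v \<in> vecs" for v
  proof -
    have "rep (a + b) v = (\<lambda>x. rep a v x + rep b v x)" by (simp add: fun_eq_iff rep_add)
    then have "nrm (rep (a + b) v) \<le> nrm (rep a v) + nrm (rep b v)" using nrm_add v by simp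
    then show ?thesis using KL v by (fastforce simp: distrib_right)
  qed
  then show ?case by blast
next
  case (single w c)
  have "nrm (rep (Poly_Mapping.single w c) v) \<le> cmod c * nrm v" if v: "v \<in> vecs" for v
  proof -
    let ?r = "rep (Poly_Mapping.single w c) v" and ?g = "\<lambda>x. the (word_pull (letters w) x)"
    have 1: "x \<in> X \<and> word_pull (letters w) x = Some (?g x) \<and> ?r x = c * v (?g x)" if "x \<in> supp ?r" for x
      using that rep_outside[of x] rep_single[of x w c v]
      by (cases "x \<in> X") (auto simp: supp_def split: option.splits)
    have inj: "inj_on ?g (supp ?r)"
    proof (rule inj_onI)
      fix x x' assume xx: "x \<in> supp ?r" "x' \<in> supp ?r" "?g x = ?g x'"
      note x = 1[OF xx(1)] and x' = 1[OF xx(2)]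
      have "?g x \<in> X" using x word_pull_star(1) by blast
      then show "x = x'" using x x' xx(3) word_pull_star_iff by (metis option.inject)
    qed
    have "?g ` supp ?r \<subseteq> supp v" using 1 by (fastforce simp: supp_def)
    have "(\<Sum>x\<in>supp ?r. (cmod (?r x))\<^sup>2) = (\<Sum>x\<in>supp ?r. (cmod c)\<^sup>2 * (cmod (v (?g x)))\<^sup>2)"
      using 1 by (intro sum.cong refl) (simp add: norm_mult power_mult_distrib)
    also have "\<dots> = (\<Sum>y\<in>?g ` supp ?r. (cmod c)\<^sup>2 * (cmod (v y))\<^sup>2)"
      using inj by (simp add: sum.reindex)
    also have "\<dots> \<le> (\<Sum>y\<in>supp v. (cmod c)\<^sup>2 * (cmod (v y))\<^sup>2)"
      using v \<open>?g ` supp ?r \<subseteq> supp v\<close> by (intro sum_mono2) (auto simp: vecs_def)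
    finally have "nrm ?r \<le> sqrt ((cmod c)\<^sup>2 * (\<Sum>y\<in>supp v. (cmod (v y))\<^sup>2))"
      by (simp add: nrm_def L2_set_def sum_distrib_left)
    then show ?thesis by (simp add: nrm_def L2_set_def real_sqrt_mult)
  qed
  then show ?case by blast
qed

text \<open>The operator norm on finitely supported functions; the supremum is finite by
  \<open>rep_bounded\<close>.\<close>

definition op_norm :: "'i free_algebra \<Rightarrow> real" where
  "op_norm a = (SUP v\<in>{v \<in> vecs. nrm v \<le> 1}. nrm (rep a v))"

lemma zero_vec: "(\<lambda>_. 0) \<in> vecs" "nrm (\<lambda>_. 0) = 0"
  by (auto simp: vecs_def supp_def nrm_def)

lemma op_norm_least: "(\<And>v. v \<in> vecs \<Longrightarrow> nrm v \<le> 1 \<Longrightarrow> nrm (rep a v) \<le> K) \<Longrightarrow> op_norm a \<le> K"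
  unfolding op_norm_def by (rule cSUP_least) (use zero_vec in auto)

lemma op_norm_upper_unit: assumes "v \<in> vecs" "nrm v \<le> 1" shows "nrm (rep a v) \<le> op_norm a"
  unfolding op_norm_def
proof (rule cSUP_upper)
  obtain K where K: "\<forall>v\<in>vecs. nrm (rep a v) \<le> K * nrm v" using rep_bounded by blast
  have "nrm (rep a v) \<le> \<bar>K\<bar>" if "v \<in> vecs" "nrm v \<le> 1" for v
  proof -
    have "nrm (rep a v) \<le> K * nrm v" using K that by blast
    also have "\<dots> \<le> \<bar>K\<bar> * 1" using that by (intro mult_mono) auto
    finally show ?thesis by simp
  qed
  then show "bdd_above ((\<lambda>v. nrm (rep a v)) ` {v \<in> vecs. nrm v \<le> 1})" by (auto simp: bdd_above_def)
qed (use assms in auto)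

lemma op_norm_nonneg: "0 \<le> op_norm a"
  using op_norm_upper_unit[OF zero_vec(1), of a] zero_vec(2) nrm_nonneg order.trans zero_le_one by metis

lemma op_norm_upper: assumes "v \<in> vecs" shows "nrm (rep a v) \<le> op_norm a * nrm v"
proof (cases "nrm v = 0")
  case True
  obtain K where K: "\<forall>v\<in>vecs. nrm (rep a v) \<le> K * nrm v" using rep_bounded by blast
  then show ?thesis using assms True by force
next
  case False
  then have pos: "nrm v > 0" by (simp add: order.strict_iff_order)
  let ?c = "complex_of_real (1 / nrm v)"
  have "(\<lambda>x. ?c * v x) \<in> vecs" using assms pos by (auto simp: vecs_def supp_def)
  moreover have "nrm (\<lambda>x. ?c * v x) = 1" using pos by (simp only: nrm_scale norm_of_real) simp
  moreover have "rep a (\<lambda>x. ?c * v x) = (\<lambda>x. ?c * rep a v x)" by (simp only: fun_eq_iff rep_vector_scale simp_thms)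
  ultimately have "nrm (\<lambda>x. ?c * rep a v x) \<le> op_norm a"
    using op_norm_upper_unit by (metis order_refl)
  then show ?thesis using pos by (simp only: nrm_scale norm_of_real) (simp add: divide_simps mult.commute)
qed

lemma op_norm_ck_seminorm: "op_norm \<in> ck_seminorms A"
proof -
  have add: "op_norm (a + b) \<le> op_norm a + op_norm b" for a b
  proof (rule op_norm_least)
    fix v assume v: "v \<in> vecs" "nrm v \<le> 1"
    have "rep (a + b) v = (\<lambda>x. rep a v x + rep b v x)" by (simp add: fun_eq_iff rep_add)
    then have "nrm (rep (a + b) v) \<le> nrm (rep a v) + nrm (rep b v)" using nrm_add v by simp
    then show "nrm (rep (a + b) v) \<le> op_norm a + op_norm b"
      using op_norm_upper_unit[OF v, of a] op_norm_upper_unit[OF v, of b] by linarith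
  qed
  have scale: "nrm (rep (free_scale c a) v) = cmod c * nrm (rep a v)" for c a v
  proof -
    have "rep (free_scale c a) v = (\<lambda>x. c * rep a v x)" by (simp add: fun_eq_iff rep_scale)
    then show ?thesis by (simp add: nrm_scale)
  qed
  have scale_le: "op_norm (free_scale c a) \<le> cmod c * op_norm a" for c a
    by (rule op_norm_least) (auto simp: scale intro!: mult_left_mono op_norm_upper_unit)
  have scale_eq: "op_norm (free_scale c a) = cmod c * op_norm a" for c a
  proof (cases "c = 0")
    case True
    then show ?thesis using scale_le[of c a] op_norm_nonneg[of "free_scale c a"] by simp
  next
    case False
    have "op_norm a \<le> cmod (inverse c) * op_norm (free_scale c a)"
      using scale_le[of "inverse c" "free_scale c a"] False by (simp add: free_scale_simps)
    then have "cmod c * op_norm a \<le> cmod c * (cmod (inverse c) * op_norm (free_scale c a))"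
      by (rule mult_left_mono) simp
    also have "\<dots> = op_norm (free_scale c a)" using False by (simp add: norm_inverse)
    finally show ?thesis using scale_le[of c a] by simp
  qed
  have mult: "op_norm (a * b) \<le> op_norm a * op_norm b" for a b
  proof (rule op_norm_least)
    fix v assume v: "v \<in> vecs" "nrm v \<le> 1"
    have "rep (a * b) v = rep a (rep b v)" by (simp add: fun_eq_iff rep_mult)
    then have "nrm (rep (a * b) v) \<le> op_norm a * nrm (rep b v)" using op_norm_upper v by simp
    also have "\<dots> \<le> op_norm a * op_norm b"
      by (intro mult_left_mono op_norm_upper_unit v op_norm_nonneg)
    finally show "nrm (rep (a * b) v) \<le> op_norm a * op_norm b" .
  qed
  have sq: "(op_norm a)\<^sup>2 \<le> op_norm (free_star a * a)" for a
  proof -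
    have "op_norm a \<le> sqrt (op_norm (free_star a * a))"
    proof (rule op_norm_least)
      fix v assume v: "v \<in> vecs" "nrm v \<le> 1"
      have "complex_of_real ((nrm (rep a v))\<^sup>2) = ip v (rep (free_star a) (rep a v))"
        using rep_adjoint[OF v(1) rep_vecs[OF v(1)], of a a] by (simp add: ip_self del: of_real_power)
      also have "rep (free_star a) (rep a v) = rep (free_star a * a) v" by (simp add: fun_eq_iff rep_mult)
      finally have "(nrm (rep a v))\<^sup>2 = cmod (ip v (rep (free_star a * a) v))"
        by (metis norm_of_real abs_of_nonneg zero_le_power2)
      also have "\<dots> \<le> nrm v * nrm (rep (free_star a * a) v)" by (intro cauchy_schwarz v rep_vecs)
      also have "\<dots> \<le> 1 * op_norm (free_star a * a)" using v op_norm_nonneg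
        by (intro mult_mono op_norm_upper_unit) auto
      finally show "nrm (rep a v) \<le> sqrt (op_norm (free_star a * a))" by (simp add: real_le_rsqrt)
    qed
    then have "(op_norm a)\<^sup>2 \<le> (sqrt (op_norm (free_star a * a)))\<^sup>2"
      by (rule power_mono[OF _ op_norm_nonneg])
    then show ?thesis by (simp add: op_norm_nonneg)
  qed
  have star_le: "op_norm a \<le> op_norm (free_star a)" for a
  proof (cases "op_norm a = 0")
    case False
    then have "op_norm a > 0" using op_norm_nonneg[of a] by simp
    moreover have "op_norm a * op_norm a \<le> op_norm (free_star a) * op_norm a"
      using sq[of a] mult[of "free_star a" a] by (simp add: power2_eq_square)
    ultimately show ?thesis by simp
  qed (simp add: op_norm_nonneg)
  have "op_norm (free_star a * a) = (op_norm a)\<^sup>2" for a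
    using sq[of a] mult[of "free_star a" a] star_le[of a] star_le[of "free_star a"]
    by (simp add: power2_eq_square)
  moreover have "op_norm r = 0" if "r \<in> ck_relators A" for r
  proof -
    have "rep r v = (\<lambda>_. 0)" for v using rep_relator[OF that] by (simp add: fun_eq_iff)
    then show ?thesis using zero_vec by (auto intro!: antisym op_norm_least op_norm_nonneg)
  qed
  ultimately show ?thesis using add scale_eq mult by (auto simp: cstar_seminorm_def)
qed

text \<open>The function \<open>ind y\<close> is the basis vector of the point \<open>y\<close>, so that \<open>rep a (ind y) x\<close> is a matrix
  coefficient.\<close>

definition ind :: "(nat \<Rightarrow> 'i) \<Rightarrow> (nat \<Rightarrow> 'i) \<Rightarrow> complex" where
  "ind y z = (if z = y then 1 else 0)"

theorem coefficient_bounded: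
  assumes "y \<in> X" shows "cmod (rep a (ind y) x) \<le> N a"
proof -
  have s: "supp (ind y) = {y}" by (auto simp: supp_def ind_def)
  then have v: "ind y \<in> vecs" "nrm (ind y) \<le> 1"
    using assms by (auto simp: vecs_def nrm_def ind_def)
  have "cmod (rep a (ind y) x) \<le> nrm (rep a (ind y))" using nrm_coordinate v by blast
  also have "\<dots> \<le> op_norm a" by (rule op_norm_upper_unit[OF v])
  also have "\<dots> \<le> N a" by (rule ck_norm_upper[OF op_norm_ck_seminorm])
  finally show ?thesis .
qed

end

section \<open>Homogeneous elements\<close>

text \<open>Homogeneous elements of the free algebra for the grading by \<open>word_degree\<close>.\<close>

definition homogeneous :: "int \<Rightarrow> 'i free_algebra \<Rightarrow> bool" where
  "homogeneous d a \<longleftrightarrow> (\<forall>w\<in>Poly_Mapping.keys a. word_degree w = d)"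

lemma homogeneousD: "homogeneous d a \<Longrightarrow> w \<in> Poly_Mapping.keys a \<Longrightarrow> word_degree w = d"
  by (simp add: homogeneous_def)

lemma homogeneous_zero [simp]: "homogeneous d 0"
  by (simp add: homogeneous_def)

lemma homogeneous_single: "word_degree w = d \<Longrightarrow> homogeneous d (Poly_Mapping.single w c)"
  by (auto simp: homogeneous_def)

lemma homogeneous_one: "homogeneous 0 1"
  using homogeneous_single[of 0 0 1] by simp

lemma homogeneous_gen: "homogeneous 1 (gen i)" and homogeneous_adj: "homogeneous (- 1) (adj i)"
  unfolding gen_def adj_def by (auto intro!: homogeneous_single simp: word_degree_def)

lemma homogeneous_add: "homogeneous d a \<Longrightarrow> homogeneous d b \<Longrightarrow> homogeneous d (a + b)"
  using Poly_Mapping.keys_add[of a b] by (auto simp: homogeneous_def)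

lemma homogeneous_minus: "homogeneous d a \<Longrightarrow> homogeneous d b \<Longrightarrow> homogeneous d (a - b)"
  using keys_diff[of a b] by (auto simp: homogeneous_def)

lemma homogeneous_sum: "(\<And>j. j \<in> J \<Longrightarrow> homogeneous d (f j)) \<Longrightarrow> homogeneous d (\<Sum>j\<in>J. f j)"
  by (induction J rule: infinite_finite_induct) (auto intro: homogeneous_add)

lemma homogeneous_mult: "homogeneous d a \<Longrightarrow> homogeneous e b \<Longrightarrow> homogeneous (d + e) (a * b)"
  using keys_mult[of a b] by (auto simp: homogeneous_def word_degree_add)

lemma homogeneous_scale: "homogeneous d a \<Longrightarrow> homogeneous d (free_scale c a)"
  using homogeneous_mult[of 0 "Poly_Mapping.single 0 c" d a] homogeneous_single[of 0 0 c]
  by (simp add: free_scale_def)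

lemma homogeneous_star: assumes "homogeneous d a" shows "homogeneous (- d) (free_star a)"
  unfolding homogeneous_def
proof
  fix w assume "w \<in> Poly_Mapping.keys (free_star a)"
  then have "word_star w \<in> Poly_Mapping.keys a" by (simp add: in_keys_iff lookup_free_star)
  then show "word_degree w = - d" using homogeneousD[OF assms] by (force simp: word_degree_star)
qed

lemma free_expand: "a = (\<Sum>w\<in>Poly_Mapping.keys a. free_scale (Poly_Mapping.lookup a w) (Poly_Mapping.single w 1))"
  by (rule poly_mapping_eqI)
     (simp add: lookup_sum free_scale_def mult_single lookup_single when_def in_keys_iff sum.delta cong: if_cong)

section \<open>The Cuntz--Krieger relations modulo the null ideal\<close>

text \<open>The list of the first \<open>n\<close> letters of a point.\<close>

definition point_prefix :: "(nat \<Rightarrow> 'i) \<Rightarrow> nat \<Rightarrow> 'i list" where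
  "point_prefix x n = map x [0..<n]"

lemma length_point_prefix [simp]: "length (point_prefix x n) = n"
  by (simp add: point_prefix_def)

lemma point_prefix_Suc: "point_prefix x (Suc n) = x 0 # point_prefix (shift x) n"
  unfolding point_prefix_def shift_def by (subst upt_conv_Cons) (auto simp: map_Suc_upt[symmetric] simp del: upt_Suc)

lemma point_prefix_eq_iff: "point_prefix x n = point_prefix y n \<longleftrightarrow> (\<forall>m<n. x m = y m)"
  by (auto simp: point_prefix_def)

text \<open>The product \<open>S\<^sub>\<mu>\<close> of generators along a list of letters, which need not be admissible.\<close>

definition path_monomial :: "'i list \<Rightarrow> 'i free_algebra" where
  "path_monomial \<mu> = prod_list (map gen \<mu>)"

lemma path_monomial_simps [simp]:
  "path_monomial [] = 1" "path_monomial (i # \<mu>) = gen i * path_monomial \<mu>"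
  "path_monomial (\<mu> @ \<nu>) = path_monomial \<mu> * path_monomial \<nu>"
  by (auto simp: path_monomial_def)

lemma homogeneous_path: "homogeneous (int (length \<mu>)) (path_monomial \<mu>)"
proof (induction \<mu>)
  case (Cons i \<mu>)
  then show ?case using homogeneous_mult[OF homogeneous_gen[of i] Cons] by (simp add: algebra_simps)
qed (simp add: homogeneous_one)

lemma free_star_one [simp]: "free_star 1 = (1 :: 'i free_algebra)"
  using free_star_single[of 0 1] by (simp del: free_star_single)

lemma words_of_length_Suc:
  "{\<mu> :: 'i::finite list. length \<mu> = Suc n} = (\<lambda>(i, \<mu>). i # \<mu>) ` (UNIV \<times> {\<mu>. length \<mu> = n})"
  by (auto simp: image_iff length_Suc_conv)

lemma finite_words_of_length: "finite {\<mu> :: 'i::finite list. length \<mu> = n}"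
  using finite_lists_length_eq[of "UNIV :: 'i set" n] by simp

lemma sum_words_of_length_Suc:
  "(\<Sum>\<mu> | length \<mu> = Suc n. f \<mu>) = (\<Sum>i\<in>UNIV. \<Sum>\<mu> | length \<mu> = n. f (i # \<mu> :: 'i::finite list))"
  unfolding words_of_length_Suc
  by (subst sum.reindex) (auto simp: inj_on_def sum.cartesian_product intro!: sum.cong)

context markov_shift
begin

notation eqv (infix "\<simeq>" 50)

lemma relator_eqv: "x - y \<in> ck_relators A \<Longrightarrow> x \<simeq> y"
  using ck_norm_seminorm[of A] by (auto simp: eqv_def)

lemma gen_partial_isometry: "gen i * adj i * gen i \<simeq> gen i"
  and range_sum: "(\<Sum>j\<in>UNIV. gen j * adj j) \<simeq> 1"
  and initial_projection: "adj i * gen i \<simeq> (\<Sum>j\<in>UNIV. of_nat (A $ i $ j) * (gen j * adj j))"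
  by (rule relator_eqv, force simp: ck_relators_def)+

lemma adj_partial_isometry: "adj i * gen i * adj i \<simeq> adj i"
  using eqv_star[OF gen_partial_isometry[of i]] by (simp add: free_star_mult mult.assoc)

lemma ranges_orthogonal:
  assumes "i \<noteq> j" shows "adj i * gen j \<simeq> 0"
proof -
  have idem: "gen j * adj j * (gen j * adj j) \<simeq> gen j * adj j" for j
    using eqv_mult[OF gen_partial_isometry[of j] eqv_refl[of "adj j"]] by (simp add: mult.assoc)
  have "gen i * adj i * (gen j * adj j) \<simeq> 0"
    by (rule projections_orthogonal[where e="\<lambda>i. gen i * adj i" and J=UNIV])
       (use assms idem range_sum in \<open>auto simp: free_star_mult\<close>)
  from eqv_mult[OF eqv_mult[OF eqv_refl[of "adj i"] this] eqv_refl[of "gen j"]]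
  have "adj i * gen i * adj i * (gen j * adj j * gen j) \<simeq> 0" by (simp add: mult.assoc)
  with eqv_sym[OF eqv_mult[OF adj_partial_isometry[of i] gen_partial_isometry[of j]]]
  show ?thesis by (rule eqv_trans)
qed

lemma initial_gen: "adj i * gen i * gen j \<simeq> (if A $ i $ j = 1 then gen j else 0)"
proof -
  have "adj i * gen i * gen j \<simeq> (\<Sum>l\<in>UNIV. of_nat (A $ i $ l) * (gen l * adj l)) * gen j"
    by (intro eqv_mult initial_projection) simp
  also have "\<dots> = (\<Sum>l\<in>UNIV. of_nat (A $ i $ l) * (gen l * (adj l * gen j)))"
    by (simp add: sum_distrib_right mult.assoc)
  also have "\<dots> \<simeq> (\<Sum>l\<in>UNIV. if l = j then of_nat (A $ i $ j) * gen j else 0)"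
  proof (rule eqv_sum)
    fix l
    show "of_nat (A $ i $ l) * (gen l * (adj l * gen j)) \<simeq> (if l = j then of_nat (A $ i $ j) * gen j else 0)"
    proof (cases "l = j")
      case True
      then show ?thesis using eqv_mult[OF eqv_refl gen_partial_isometry[of j]] by (simp add: mult.assoc)
    next
      case False
      have "of_nat (A $ i $ l) * (gen l * (adj l * gen j)) \<simeq> of_nat (A $ i $ l) * (gen l * 0)"
        by (intro eqv_mult eqv_refl ranges_orthogonal[OF False])
      then show ?thesis using False by simp
    qed
  qed
  also have "\<dots> = (if A $ i $ j = 1 then gen j else 0)"
    using zero_one[of i j] by auto
  finally show ?thesis .
qed

lemma gen_gen_null: assumes "A $ i $ j \<noteq> 1" shows "gen i * gen j \<simeq> 0"
proof -
  have "gen i * gen j \<simeq> gen i * adj i * gen i * gen j"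
    by (intro eqv_mult eqv_refl eqv_sym[OF gen_partial_isometry])
  also have "\<dots> = gen i * (adj i * gen i * gen j)" by (simp add: mult.assoc)
  also have "\<dots> \<simeq> gen i * 0"
    using initial_gen[of i j] assms by (intro eqv_mult eqv_refl) simp
  finally show ?thesis by simp
qed

lemma exists_point: obtains y where "y \<in> X" "y 0 = i"
proof -
  have "\<exists>j. A $ i $ j = 1" for i
  proof -
    obtain j where "A $ i $ j \<noteq> 0" using rows_nonzero[of i] by (auto simp: vec_eq_iff row_def)
    then show ?thesis using zero_one[of i j] by auto
  qed
  then obtain f where f: "\<And>i. A $ i $ f i = 1" by metis
  have "(\<lambda>n. (f ^^ n) i) \<in> X" by (simp add: shift_space_def f)
  then show ?thesis using that by force
qed

lemma path_monomial_cases: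
  assumes "\<nu> \<noteq> []"
  shows "(\<exists>y\<in>X. point_prefix y (length \<nu>) = \<nu>) \<or> path_monomial \<nu> \<simeq> 0"
  using assms
proof (induction \<nu>)
  case (Cons i \<nu>)
  show ?case
  proof (cases "\<nu> = []")
    case True
    obtain y where "y \<in> X" "y 0 = i" by (rule exists_point)
    then show ?thesis using True by (auto simp: point_prefix_def)
  next
    case False
    from Cons.IH[OF this] consider y where "y \<in> X" "point_prefix y (length \<nu>) = \<nu>" | "path_monomial \<nu> \<simeq> 0" by blast
    then show ?thesis
    proof cases
      case (1 y)
      have inv: "shift (case_nat i y) = y" by (simp add: shift_def)
      obtain \<nu>' where \<nu>': "\<nu> = y 0 # \<nu>'"
        using 1 False by (metis length_greater_0_conv gr0_conv_Suc point_prefix_Suc)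
      show ?thesis
      proof (cases "A $ i $ y 0 = 1")
        case True
        then have "case_nat i y \<in> X" using 1 by (simp add: cons_in_X)
        moreover have "point_prefix (case_nat i y) (length (i # \<nu>)) = i # \<nu>"
          using 1 by (simp add: point_prefix_Suc inv)
        ultimately show ?thesis by blast
      next
        case False
        have "gen i * gen (y 0) * path_monomial \<nu>' \<simeq> 0 * path_monomial \<nu>'"
          by (intro eqv_mult gen_gen_null False eqv_refl)
        then show ?thesis by (simp add: \<nu>' mult.assoc)
      qed
    next
      case 2
      then show ?thesis using eqv_mult[OF eqv_refl[of "gen i"], of "path_monomial \<nu>" 0] by simp
    qed
  qed
qed simp

lemma path_range_sum: "(\<Sum>\<mu> | length \<mu> = n. path_monomial \<mu> * free_star (path_monomial \<mu>)) \<simeq> 1"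
proof (induction n)
  case (Suc n)
  let ?s = "\<lambda>n. \<Sum>\<mu> | length \<mu> = n. path_monomial \<mu> * free_star (path_monomial \<mu>) :: 'i free_algebra"
  have "?s (Suc n) = (\<Sum>i\<in>UNIV. gen i * ?s n * adj i)"
    by (simp add: sum_words_of_length_Suc free_star_mult sum_distrib_left sum_distrib_right mult.assoc)
  also have "\<dots> \<simeq> (\<Sum>i\<in>UNIV. gen i * 1 * adj i)" by (intro eqv_sum eqv_mult Suc eqv_refl)
  also have "\<dots> \<simeq> 1" using range_sum by simp
  finally show ?case .
qed simp

text \<open>A word moves a sufficiently long path monomial to a path monomial, in parallel with its action
  on points; the length of the result is determined by the degree.\<close>

lemma word_times_path:
  assumes y: "y \<in> X" and n: "length ls < n"
  shows "Poly_Mapping.single (Word ls) 1 * path_monomial (point_prefix y n) \<simeq>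
    (case word_pull (rev (map letter_star ls)) y of None \<Rightarrow> 0
     | Some x \<Rightarrow> path_monomial (point_prefix x (nat (int n + word_degree (Word ls)))))"
  using n
proof (induction ls)
  case Nil
  then show ?case by (simp add: word_degree_def flip: zero_star_word_def)
next
  case (Cons l ls)
  define g where "g = (case l of Gen i \<Rightarrow> gen i | Adj i \<Rightarrow> adj i)"
  have s: "Poly_Mapping.single (Word (l # ls)) 1 = g * Poly_Mapping.single (Word ls) 1"
    by (simp add: g_def gen_def adj_def mult_single plus_star_word_def split: letter.split)
  have IH: "Poly_Mapping.single (Word ls) 1 * path_monomial (point_prefix y n) \<simeq>
    (case word_pull (rev (map letter_star ls)) y of None \<Rightarrow> 0
     | Some x \<Rightarrow> path_monomial (point_prefix x (nat (int n + word_degree (Word ls)))))"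
    using Cons by simp
  show ?case
  proof (cases "word_pull (rev (map letter_star ls)) y")
    case None
    then show ?thesis using eqv_mult[OF eqv_refl[of g] IH] by (simp add: s mult.assoc word_pull_append)
  next
    case (Some x)
    have x: "x \<in> X" using word_pull_star(1)[OF y Some] .
    have "\<bar>word_degree (Word ls)\<bar> \<le> int (length ls)"
    proof -
      have "\<bar>sum_list (map letter_degree ls)\<bar> \<le> int (length ls)"
      proof (induction ls)
        case (Cons l ls) then show ?case by (cases l) auto
      qed simp
      then show ?thesis by (simp add: word_degree_def)
    qed
    then have "int n + word_degree (Word ls) = int (Suc (Suc (nat (int n + word_degree (Word ls) - 2))))"
      using Cons.prems by simp
    then obtain m where m: "int n + word_degree (Word ls) = int (Suc (Suc m))" by blast
    then have m': "nat (int n + word_degree (Word ls)) = Suc (Suc m)" by simp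
    have deg: "word_degree (Word (l # ls)) = letter_degree l + word_degree (Word ls)"
      by (simp add: word_degree_def)
    have M: "point_prefix x (Suc (Suc m)) = x 0 # x 1 # point_prefix (shift (shift x)) m"
      by (simp add: point_prefix_Suc shift_nth)
    have 1: "Poly_Mapping.single (Word (l # ls)) 1 * path_monomial (point_prefix y n) \<simeq>
        g * path_monomial (point_prefix x (Suc (Suc m)))"
      using eqv_mult[OF eqv_refl[of g] IH] by (simp add: s mult.assoc Some m' del: path_monomial_simps)
    have pull: "word_pull (rev (map letter_star (l # ls))) y = pull (letter_star l) x"
      by (cases "pull (letter_star l) x") (simp_all add: word_pull_append Some)
    let ?r = "path_monomial (point_prefix (shift (shift x)) m)"
    have 2: "g * path_monomial (point_prefix x (Suc (Suc m))) \<simeq>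
      (case pull (letter_star l) x of None \<Rightarrow> 0
       | Some x' \<Rightarrow> path_monomial (point_prefix x' (nat (int n + word_degree (Word (l # ls))))))"
    proof (cases l)
      case (Gen i)
      have "nat (int n + word_degree (Word (l # ls))) = Suc (Suc (Suc m))"
        using m deg Gen by simp
      moreover have "shift (case_nat i x) = x" by (simp add: shift_def)
      moreover have "A $ i $ x 0 \<noteq> 1 \<Longrightarrow> gen i * (gen (x 0) * (gen (x 1) * ?r)) \<simeq> 0"
        using eqv_mult[OF gen_gen_null[of i "x 0"] eqv_refl[of "gen (x 1) * ?r"]] by (simp add: mult.assoc)
      ultimately show ?thesis using Gen
        by (auto simp: g_def M point_prefix_Suc[of "case_nat i x"])
    next
      case (Adj i)
      have d: "nat (int n + word_degree (Word (l # ls))) = Suc m" using m deg Adj by simp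
      show ?thesis
      proof (cases "x 0 = i")
        case True
        have "adj i * gen i * gen (x 1) \<simeq> gen (x 1)"
          using initial_gen[of i "x 1"] X_step[OF x, of 0] True by simp
        from eqv_mult[OF this eqv_refl[of ?r]] show ?thesis
          using True Adj d by (simp add: g_def M point_prefix_Suc shift_nth mult.assoc)
      next
        case False
        then have "adj i * gen (x 0) * (gen (x 1) * ?r) \<simeq> 0 * (gen (x 1) * ?r)"
          by (intro eqv_mult ranges_orthogonal eqv_refl) auto
        then show ?thesis using False Adj by (simp add: g_def M mult.assoc)
      qed
    qed
    show ?thesis unfolding pull using eqv_trans[OF 1 2] .
  qed
qed

text \<open>On homogeneous elements, the representation is faithful modulo the null ideal, also when there
  are isolated periodic points: homogeneity makes a path monomial of the right length determined
  by the point to which a word moves a given point.\<close>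

theorem homogeneous_faithful:
  assumes hom: "homogeneous d a" and null: "\<And>x y. x \<in> X \<Longrightarrow> y \<in> X \<Longrightarrow> rep a (ind y) x = 0"
  shows "a \<simeq> 0"
proof -
  let ?K = "Poly_Mapping.keys a" and ?a = "Poly_Mapping.lookup a"
  define n where "n = Suc (Max (insert 0 ((\<lambda>w. length (letters w)) ` ?K)))"
  have n: "length (letters w) < n" if "w \<in> ?K" for w
    unfolding n_def using that by (auto simp: less_Suc_eq_le intro!: Max_ge)
  have path: "a * path_monomial (point_prefix y n) \<simeq> 0" if y: "y \<in> X" for y
  proof -
    define g where "g w = word_pull (letters (word_star w)) y" for w
    define T where "T = (\<Union>w\<in>?K. set_option (g w))"
    define S where "S x = (path_monomial (point_prefix x (nat (int n + d))) :: 'i free_algebra)" for x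
    have T: "finite T" "\<And>x. x \<in> T \<Longrightarrow> x \<in> X"
      using word_pull_star(1)[OF y] by (auto simp: T_def g_def)
    have "a * path_monomial (point_prefix y n) =
        (\<Sum>w\<in>?K. free_scale (?a w) (Poly_Mapping.single w 1)) * path_monomial (point_prefix y n)"
      by (subst (1) free_expand) simp
    also have "\<dots> = (\<Sum>w\<in>?K. free_scale (?a w) (Poly_Mapping.single w 1 * path_monomial (point_prefix y n)))"
      by (simp add: sum_distrib_right free_scale_simps(6))
    also have "\<dots> \<simeq> (\<Sum>w\<in>?K. \<Sum>x\<in>T. if g w = Some x then free_scale (?a w) (S x) else 0)"
    proof (rule eqv_sum)
      fix w assume w: "w \<in> ?K"
      have "Poly_Mapping.single w 1 * path_monomial (point_prefix y n) \<simeq> (case g w of None \<Rightarrow> 0 | Some x \<Rightarrow> S x)"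
      proof -
        have deg: "word_degree (Word (letters w)) = d" using homogeneousD[OF hom w] by simp
        show ?thesis using word_times_path[OF y n[OF w]] unfolding g_def S_def deg
          by (simp add: word_star_def)
      qed
      moreover have "free_scale (?a w) (case g w of None \<Rightarrow> 0 | Some x \<Rightarrow> S x) =
          (\<Sum>x\<in>T. if g w = Some x then free_scale (?a w) (S x) else 0)"
      proof (cases "g w")
        case (Some x)
        then have "x \<in> T" using w by (auto simp: T_def)
        then show ?thesis using Some T by (simp add: sum.delta)
      qed (simp add: free_scale_def)
      ultimately show "free_scale (?a w) (Poly_Mapping.single w 1 * path_monomial (point_prefix y n)) \<simeq>
          (\<Sum>x\<in>T. if g w = Some x then free_scale (?a w) (S x) else 0)"
        using eqv_scale by metis
    qed
    also have "\<dots> = (\<Sum>x\<in>T. \<Sum>w\<in>?K. if g w = Some x then free_scale (?a w) (S x) else 0)"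
      by (rule sum.swap)
    also have "\<dots> = (\<Sum>x\<in>T. 0)"
    proof (rule sum.cong[OF refl])
      fix x assume "x \<in> T"
      then have x: "x \<in> X" by (rule T)
      have "rep a (ind y) x = (\<Sum>w\<in>?K. if g w = Some x then ?a w else 0)"
        unfolding rep_def using x y
        by (auto simp: g_def ind_def word_pull_star_iff[OF x y] intro!: sum.cong split: option.split)
      then have 0: "(\<Sum>w\<in>?K. if g w = Some x then ?a w else 0) = 0" using null[OF x y] by simp
      have "free_scale (\<Sum>w\<in>K. if g w = Some x then ?a w else 0) (S x) =
          (\<Sum>w\<in>K. if g w = Some x then free_scale (?a w) (S x) else 0)" for K
      proof (induction K rule: infinite_finite_induct)
        case (insert w K)
        then show ?case by (auto simp: free_scale_simps) (simp add: free_scale_def)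
      qed (auto simp: free_scale_def)
      from this[of ?K] show "(\<Sum>w\<in>?K. if g w = Some x then free_scale (?a w) (S x) else 0) = 0"
        unfolding 0 by (simp add: free_scale_def)
    qed
    finally show ?thesis by simp
  qed
  have path': "a * path_monomial \<nu> \<simeq> 0" if "length \<nu> = n" for \<nu>
  proof -
    have "\<nu> \<noteq> []" using that by (auto simp: n_def)
    from path_monomial_cases[OF this] have "(\<exists>y\<in>X. point_prefix y n = \<nu>) \<or> path_monomial \<nu> \<simeq> 0"
      unfolding that .
    then consider y where "y \<in> X" "point_prefix y n = \<nu>" | "path_monomial \<nu> \<simeq> 0" by blast
    then show ?thesis
    proof cases
      case (1 y)
      then show ?thesis using path[OF 1(1)] by simp
    qed (use eqv_mult[OF eqv_refl[of a], of "path_monomial \<nu>" 0] in simp)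
  qed
  have "a * 1 \<simeq> a * (\<Sum>\<nu> | length \<nu> = n. path_monomial \<nu> * free_star (path_monomial \<nu>))"
    by (intro eqv_mult eqv_refl eqv_sym[OF path_range_sum])
  also have "\<dots> = (\<Sum>\<nu> | length \<nu> = n. a * path_monomial \<nu> * free_star (path_monomial \<nu>))"
    by (simp add: sum_distrib_left mult.assoc)
  also have "\<dots> \<simeq> (\<Sum>\<nu> | length \<nu> = n. 0 * free_star (path_monomial \<nu>))"
    by (intro eqv_sum eqv_mult path' eqv_refl) simp
  finally show ?thesis by simp
qed

corollary homogeneous_eqvI:
  assumes "homogeneous d a" "homogeneous d b" "\<And>v x. x \<in> X \<Longrightarrow> rep a v x = rep b v x"
  shows "a \<simeq> b"
  using homogeneous_faithful[OF homogeneous_minus[OF assms(1,2)]] assms(3)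
  by (simp add: rep_minus eqv_def)

end

section \<open>Continuity on the shift space\<close>

lemma topspace_shift_topology [simp]: "topspace (shift_topology A) = shift_space A"
  by (auto simp: shift_topology_def)

lemma openin_cylinder:
  "openin (shift_topology A) {y \<in> shift_space A. \<forall>m<n. y m = x m}"
proof -
  let ?U = "\<Pi>\<^sub>E m\<in>UNIV. if m < n then {x m} else UNIV"
  have "openin (product_topology (\<lambda>_. discrete_topology UNIV) UNIV) ?U"
    by (rule product_topology_basis) (auto intro: finite_subset[of _ "{..<n}"] split: if_splits)
  moreover have "{y \<in> shift_space A. \<forall>m<n. y m = x m} = ?U \<inter> shift_space A"
    by (auto simp: PiE_iff split: if_split_asm)
  ultimately show ?thesis unfolding shift_topology_def openin_subtopology by blast
qed

lemma open_contains_cylinder: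
  assumes "openin (shift_topology A) U" "x \<in> U"
  obtains n where "{y \<in> shift_space A. \<forall>m<n. y m = x m} \<subseteq> U"
proof -
  obtain V where V: "openin (product_topology (\<lambda>_. discrete_topology UNIV) UNIV) V" "U = V \<inter> shift_space A"
    using assms(1) unfolding shift_topology_def openin_subtopology by blast
  then obtain W where W: "x \<in> (\<Pi>\<^sub>E i\<in>UNIV. W i)" "finite {i. W i \<noteq> UNIV}" "(\<Pi>\<^sub>E i\<in>UNIV. W i) \<subseteq> V"
    using product_topology_open_contains_basis[OF V(1), of x] assms(2) by auto
  obtain n where n: "\<And>i. W i \<noteq> UNIV \<Longrightarrow> i < n"
    using W(2) unfolding finite_nat_set_iff_bounded by auto
  have "y \<in> U" if "y \<in> shift_space A" "\<forall>m<n. y m = x m" for y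
  proof -
    have "y i \<in> W i" for i using that W(1) n[of i] by (cases "W i = UNIV") (auto simp: PiE_iff)
    then have "y \<in> V" using W(3) by (auto simp: PiE_iff)
    then show ?thesis using V that by simp
  qed
  then show ?thesis using that[of n] by blast
qed

lemma compact_shift_space: "compact_space (shift_topology (A :: nat^'i^'i::finite))"
proof -
  let ?T = "product_topology (\<lambda>_ :: nat. discrete_topology (UNIV :: 'i set)) UNIV"
  have "openin ?T {x. x n = i}" for n i
  proof -
    have "{x. x n = i} = {x \<in> topspace ?T. x n \<in> {i}}" by auto
    also have "openin ?T \<dots>"
      by (rule openin_continuous_map_preimage[OF continuous_map_product_projection]) auto
    finally show ?thesis .
  qed
  then have "openin ?T ({x. x n = i} \<inter> {x. x (Suc n) = j})" for n i j by blast
  moreover have "UNIV - shift_space A =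
      (\<Union>(n, i, j)\<in>{(n, i, j). A $ i $ j \<noteq> 1}. {x. x n = i} \<inter> {x. x (Suc n) = j})"
    by (auto simp: shift_space_def)
  ultimately have "openin ?T (UNIV - shift_space A)" by auto
  then have "closedin ?T (shift_space A)" by (simp add: closedin_def)
  moreover have "compact_space ?T"
    by (simp add: compact_space_product_topology compact_space_discrete_topology)
  ultimately show ?thesis
    unfolding shift_topology_def by (intro compact_space_subtopology closedin_compact_space)
qed

lemma finitely_determined:
  assumes f: "continuous_map (shift_topology (A :: nat^'i^'i::finite)) (discrete_topology UNIV) f"
  obtains n where "\<And>x y. x \<in> shift_space A \<Longrightarrow> y \<in> shift_space A \<Longrightarrow> \<forall>m<n. x m = y m \<Longrightarrow> f x = f y"
proof -
  let ?C = "\<lambda>x n. {y \<in> shift_space A. \<forall>m<n. y m = x m}"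
  have "\<exists>n. \<forall>y\<in>?C x n. f y = f x" if x: "x \<in> shift_space A" for x
  proof -
    have "openin (shift_topology A) {y \<in> topspace (shift_topology A). f y \<in> {f x}}"
      by (rule openin_continuous_map_preimage[OF f]) simp
    then obtain n where "?C x n \<subseteq> {y \<in> topspace (shift_topology A). f y \<in> {f x}}"
      by (rule open_contains_cylinder) (use x in auto)
    then show ?thesis by blast
  qed
  then have "\<forall>x. \<exists>n. x \<in> shift_space A \<longrightarrow> (\<forall>y\<in>?C x n. f y = f x)" by blast
  from choice[OF this] obtain n
    where n: "\<And>x y. x \<in> shift_space A \<Longrightarrow> y \<in> ?C x (n x) \<Longrightarrow> f y = f x" by blast
  define W where "W x = ?C x (n x)" for x
  have "\<forall>U\<in>W ` shift_space A. openin (shift_topology A) U"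
    unfolding W_def using openin_cylinder by blast
  moreover have "topspace (shift_topology A) \<subseteq> \<Union>(W ` shift_space A)"
    by (auto simp: W_def)
  ultimately obtain \<F> where \<F>: "finite \<F>" "\<F> \<subseteq> W ` shift_space A" "shift_space A \<subseteq> \<Union>\<F>"
    using compact_shift_space[of A] unfolding compact_space_alt topspace_shift_topology by meson
  obtain F where F: "F \<subseteq> shift_space A" "finite F" "\<F> = W ` F"
    using finite_subset_image[OF \<F>(1,2)] by blast
  have "f x = f y" if xy: "x \<in> shift_space A" "y \<in> shift_space A" "\<forall>m<Max (insert 0 (n ` F)). x m = y m" for x y
  proof -
    obtain z where z: "z \<in> F" "x \<in> W z" using F \<F>(3) xy(1) by blast
    then have zX: "z \<in> shift_space A" using F by blast
    have "n z \<le> Max (insert 0 (n ` F))" using F z by (intro Max_ge) auto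
    then have "\<forall>m<n z. x m = y m" using xy(3) by (meson order.strict_trans2)
    then have "y \<in> W z" using z(2) xy(2) unfolding W_def by force
    then show ?thesis using n[OF zX, of x] n[OF zX, of y] z(2) by (simp add: W_def)
  qed
  then show ?thesis using that by blast
qed

lemma finite_range_of_finitely_determined:
  assumes "\<And>x y. x \<in> shift_space (A :: nat^'i^'i::finite) \<Longrightarrow> y \<in> shift_space A \<Longrightarrow> \<forall>m<n. x m = y m \<Longrightarrow> f x = f y"
  shows "finite (f ` shift_space A)"
proof -
  define g where "g \<mu> = f (SOME x. x \<in> shift_space A \<and> point_prefix x n = \<mu>)" for \<mu>
  have "f x \<in> g ` {\<mu>. length \<mu> = n}" if x: "x \<in> shift_space A" for x
  proof -
    define y where "y = (SOME y. y \<in> shift_space A \<and> point_prefix y n = point_prefix x n)"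
    have "\<exists>y. y \<in> shift_space A \<and> point_prefix y n = point_prefix x n" using x by blast
    from someI_ex[OF this] have y: "y \<in> shift_space A" "point_prefix y n = point_prefix x n"
      unfolding y_def by auto
    have "f x = f y" by (rule assms[OF x y(1)]) (use y(2) in \<open>simp add: point_prefix_eq_iff\<close>)
    then have "f x = g (point_prefix x n)" by (simp add: g_def y_def)
    then show ?thesis by simp
  qed
  then have "f ` shift_space A \<subseteq> g ` {\<mu>. length \<mu> = n}" by blast
  then show ?thesis by (rule finite_subset) (rule finite_imageI[OF finite_words_of_length])
qed

text \<open>Uniform continuity for the prefix metric.\<close>

definition uniformly_determined ::
  "nat^'i^'i \<Rightarrow> ((nat \<Rightarrow> 'i::finite) \<Rightarrow> nat \<Rightarrow> 'j) \<Rightarrow> bool" where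
  "uniformly_determined A h \<longleftrightarrow> (\<forall>n. \<exists>m. \<forall>x\<in>shift_space A. \<forall>y\<in>shift_space A.
     (\<forall>l<m. x l = y l) \<longrightarrow> (\<forall>l<n. h x l = h y l))"

lemma uniformly_determinedD:
  assumes "uniformly_determined A h"
  obtains m where "\<And>x y. x \<in> shift_space A \<Longrightarrow> y \<in> shift_space A \<Longrightarrow> \<forall>l<m. x l = y l \<Longrightarrow> \<forall>l<n. h x l = h y l"
proof -
  from assms obtain m where "\<forall>x\<in>shift_space A. \<forall>y\<in>shift_space A. (\<forall>l<m. x l = y l) \<longrightarrow> (\<forall>l<n. h x l = h y l)"
    unfolding uniformly_determined_def by blast
  then show ?thesis by (intro that[of m]) blast
qed

lemma continuous_map_coordinate:
  assumes "continuous_map (shift_topology A) (shift_topology B) h"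
  shows "continuous_map (shift_topology A) (discrete_topology UNIV) (\<lambda>x. h x n)"
proof -
  have "continuous_map (shift_topology A) (product_topology (\<lambda>_. discrete_topology UNIV) UNIV) h"
    using assms unfolding shift_topology_def[of B] continuous_map_in_subtopology by simp
  then show ?thesis by (simp add: continuous_map_componentwise_UNIV)
qed

lemma continuous_imp_uniformly_determined:
  fixes A :: "nat^'i^'i::finite" and B :: "nat^'j^'j::finite"
  assumes h: "continuous_map (shift_topology A) (shift_topology B) h"
  shows "uniformly_determined A h"
  unfolding uniformly_determined_def
proof
  fix n
  have "\<forall>l. \<exists>m. \<forall>x\<in>shift_space A. \<forall>y\<in>shift_space A. (\<forall>k<m. x k = y k) \<longrightarrow> h x l = h y l"
  proof
    fix l
    obtain m where "\<And>x y. x \<in> shift_space A \<Longrightarrow> y \<in> shift_space A \<Longrightarrow> \<forall>k<m. x k = y k \<Longrightarrow> h x l = h y l"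
      by (rule finitely_determined[OF continuous_map_coordinate[OF h, of l]]) (rule that)
    then show "\<exists>m. \<forall>x\<in>shift_space A. \<forall>y\<in>shift_space A. (\<forall>k<m. x k = y k) \<longrightarrow> h x l = h y l" by blast
  qed
  from choice[OF this] obtain m
    where m: "\<And>l x y. x \<in> shift_space A \<Longrightarrow> y \<in> shift_space A \<Longrightarrow> \<forall>k<m l. x k = y k \<Longrightarrow> h x l = h y l"
    by blast
  have "\<forall>x\<in>shift_space A. \<forall>y\<in>shift_space A. (\<forall>k<Max (m ` {..n}). x k = y k) \<longrightarrow> (\<forall>l<n. h x l = h y l)"
  proof (intro ballI impI allI)
    fix x y l assume xy: "x \<in> shift_space A" "y \<in> shift_space A" "\<forall>k<Max (m ` {..n}). x k = y k" "l < n"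
    have "m l \<le> Max (m ` {..n})" using xy by (intro Max_ge) auto
    then have "\<forall>k<m l. x k = y k" using xy(3) by (meson order.strict_trans2)
    then show "h x l = h y l" by (rule m[OF xy(1,2)])
  qed
  then show "\<exists>m. \<forall>x\<in>shift_space A. \<forall>y\<in>shift_space A. (\<forall>k<m. x k = y k) \<longrightarrow> (\<forall>l<n. h x l = h y l)" ..
qed

lemma uniformly_determined_imp_continuous:
  assumes maps: "\<And>x. x \<in> shift_space A \<Longrightarrow> h x \<in> shift_space B" and h: "uniformly_determined A h"
  shows "continuous_map (shift_topology A) (shift_topology B) h"
proof -
  have "continuous_map (shift_topology A) (discrete_topology UNIV) (\<lambda>x. h x n)" for n
  proof -
    obtain m where m: "\<And>x y. x \<in> shift_space A \<Longrightarrow> y \<in> shift_space A \<Longrightarrow> \<forall>l<m. x l = y l \<Longrightarrow> \<forall>l<Suc n. h x l = h y l"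
      by (rule uniformly_determinedD[OF h, of "Suc n"]) (rule that)
    have "openin (shift_topology A) {x \<in> shift_space A. h x n \<in> U}" for U
    proof (subst openin_subopen, intro ballI)
      fix x assume "x \<in> {x \<in> shift_space A. h x n \<in> U}"
      then have x: "x \<in> shift_space A" "h x n \<in> U" by auto
      have "h y n \<in> U" if y: "y \<in> shift_space A" "\<forall>l<m. y l = x l" for y
      proof -
        have "h y n = h x n" using m[OF y(1) x(1) y(2)] by (rule allE[of _ n]) simp
        then show ?thesis using x(2) by simp
      qed
      then have "{y \<in> shift_space A. \<forall>l<m. y l = x l} \<subseteq> {x \<in> shift_space A. h x n \<in> U}" by blast
      moreover have "x \<in> {y \<in> shift_space A. \<forall>l<m. y l = x l}" using x(1) by blast
      ultimately show "\<exists>T. openin (shift_topology A) T \<and> x \<in> T \<and> T \<subseteq> {x \<in> shift_space A. h x n \<in> U}"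
        using openin_cylinder by blast
    qed
    then show ?thesis unfolding continuous_map_def by simp
  qed
  then show ?thesis
    unfolding shift_topology_def[of B] continuous_map_in_subtopology
    using maps by (simp add: continuous_map_componentwise_UNIV image_subset_iff)
qed

section \<open>Homomorphisms of free algebras\<close>

fun letter_subst :: "('i \<Rightarrow> 'j free_algebra) \<Rightarrow> 'i letter \<Rightarrow> 'j free_algebra" where
  "letter_subst t (Gen i) = t i"
| "letter_subst t (Adj i) = free_star (t i)"

definition word_subst :: "('i \<Rightarrow> 'j free_algebra) \<Rightarrow> 'i star_word \<Rightarrow> 'j free_algebra" where
  "word_subst t w = prod_list (map (letter_subst t) (letters w))"

text \<open>The unital star-homomorphism of free algebras that maps each generator \<open>gen i\<close> to \<open>t i\<close>.\<close>

definition subst :: "('i \<Rightarrow> 'j free_algebra) \<Rightarrow> 'i free_algebra \<Rightarrow> 'j free_algebra" where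
  "subst t a = (\<Sum>w\<in>Poly_Mapping.keys a. free_scale (Poly_Mapping.lookup a w) (word_subst t w))"

lemma free_scale_zero [simp]: "free_scale 0 x = 0" "free_scale c 0 = 0"
  by (simp_all add: free_scale_def)

lemma subst_superset:
  assumes "finite K" "Poly_Mapping.keys a \<subseteq> K"
  shows "subst t a = (\<Sum>w\<in>K. free_scale (Poly_Mapping.lookup a w) (word_subst t w))"
  unfolding subst_def using assms by (intro sum.mono_neutral_left) (auto simp: in_keys_iff)

lemma subst_zero [simp]: "subst t 0 = 0"
  by (simp add: subst_def)

lemma subst_single: "subst t (Poly_Mapping.single w c) = free_scale c (word_subst t w)"
  by (subst subst_superset[of "{w}"]) auto

lemma subst_add: "subst t (a + b) = subst t a + subst t b"
proof -
  let ?K = "Poly_Mapping.keys a \<union> Poly_Mapping.keys b"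
  show ?thesis using subst_superset[of ?K a t] subst_superset[of ?K b t] subst_superset[of ?K "a + b" t]
    by (simp add: Poly_Mapping.keys_add lookup_add free_scale_simps(3) sum.distrib)
qed

lemma word_subst_add: "word_subst t (u + v) = word_subst t u * word_subst t v"
  by (simp add: word_subst_def plus_star_word_def)

lemma word_subst_star: "word_subst t (word_star w) = free_star (word_subst t w)"
proof -
  have "letter_subst t (letter_star l) = free_star (letter_subst t l)" for l by (cases l) auto
  then have "prod_list (map (letter_subst t) (rev (map letter_star ls))) = free_star (prod_list (map (letter_subst t) ls))" for ls
    by (induction ls) (auto simp: free_star_mult)
  then show ?thesis by (simp add: word_subst_def word_star_def)
qed

lemma subst_mult: "subst t (a * b) = subst t a * subst t b"
proof (induction a rule: free_induct)
  case (single w c)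
  show ?case
    by (induction b rule: free_induct)
       (auto simp: mult_single subst_single word_subst_add free_scale_simps free_scale_central subst_add distrib_left mult.commute)
qed (auto simp: subst_add distrib_right)

lemma subst_one [simp]: "subst t 1 = 1"
proof -
  have "word_subst t 0 = 1" by (simp add: word_subst_def zero_star_word_def)
  then show ?thesis using subst_single[of t 0 1] by (simp add: free_scale_simps(5))
qed

lemma subst_scale: "subst t (free_scale c a) = free_scale c (subst t a)"
proof (induction a rule: free_induct)
  case (single w d)
  have "free_scale c (Poly_Mapping.single w d) = Poly_Mapping.single w (c * d)"
    by (simp add: free_scale_def mult_single)
  then show ?case by (simp add: subst_single free_scale_simps(4))
qed (auto simp: subst_add free_scale_simps(1))

lemma subst_star: "subst t (free_star a) = free_star (subst t a)"
  by (induction a rule: free_induct)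
     (auto simp: free_star_add subst_add subst_single word_subst_star free_star_scale free_star_def[of 0])

lemma subst_minus: "subst t (a - b) = subst t a - subst t b"
  using subst_add[of t "a - b" b] by (simp add: algebra_simps)

lemma homogeneous_subst:
  assumes t: "\<And>i. homogeneous 1 (t i)" and a: "homogeneous d a" shows "homogeneous d (subst t a)"
  unfolding subst_def
proof (intro homogeneous_sum homogeneous_scale)
  fix w assume "w \<in> Poly_Mapping.keys a"
  then have d: "d = word_degree w" using homogeneousD[OF a] by simp
  have l: "homogeneous (letter_degree l) (letter_subst t l)" for l
    using t homogeneous_star[OF t] by (cases l) auto
  have "homogeneous (sum_list (map letter_degree ls)) (prod_list (map (letter_subst t) ls))" for ls
    by (induction ls) (auto intro: homogeneous_one homogeneous_mult l)
  then show "homogeneous d (word_subst t w)" by (simp add: d word_subst_def word_degree_def)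
qed

lemma lookup_free_scale: "Poly_Mapping.lookup (free_scale c a) w = c * Poly_Mapping.lookup a w"
  by (induction a rule: free_induct)
     (auto simp: free_scale_simps(1) lookup_add algebra_simps free_scale_def mult_single lookup_single when_def)

lemma free_gauge_homogeneous: "homogeneous d a \<Longrightarrow> free_gauge z a = free_scale (z powi d) a"
proof (rule poly_mapping_eqI)
  fix w assume a: "homogeneous d a"
  show "Poly_Mapping.lookup (free_gauge z a) w = Poly_Mapping.lookup (free_scale (z powi d) a) w"
    using a by (cases "Poly_Mapping.lookup a w = 0")
      (auto simp: free_gauge_lookup homogeneous_def in_keys_iff lookup_free_scale)
qed

lemma free_gauge_subst:
  assumes t: "\<And>i. homogeneous 1 (t i)" shows "free_gauge z (subst t a) = subst t (free_gauge z a)"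
proof (induction a rule: free_induct)
  case (single w c)
  have "homogeneous (word_degree w) (subst t (Poly_Mapping.single w c))"
    by (intro homogeneous_subst t homogeneous_single refl)
  then have "free_gauge z (subst t (Poly_Mapping.single w c)) =
      subst t (free_scale (z powi word_degree w) (Poly_Mapping.single w c))"
    by (simp add: free_gauge_homogeneous subst_scale)
  then show ?case by (simp add: free_scale_def mult_single)
qed (auto simp: subst_add free_gauge_add)

section \<open>Matrix coefficients and path projections\<close>

lemma shift_funpow_nth: "(shift ^^ n) x m = x (m + n)"
  by (induction n arbitrary: m) (auto simp: shift_def)

text \<open>Putting a list in front of a point; the result need not be a point of the shift space.\<close>

primrec conc :: "'i list \<Rightarrow> (nat \<Rightarrow> 'i) \<Rightarrow> nat \<Rightarrow> 'i" where
  "conc [] y = y"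
| "conc (i # \<nu>) y = case_nat i (conc \<nu> y)"

lemma conc_nth: "conc \<nu> y m = (if m < length \<nu> then \<nu> ! m else y (m - length \<nu>))"
  by (induction \<nu> arbitrary: m) (auto split: nat.split)

lemma conc_prefix: "conc (point_prefix y n) ((shift ^^ n) y) = y"
  by (auto simp: fun_eq_iff conc_nth shift_funpow_nth) (simp add: point_prefix_def)

text \<open>The range projection of a path, at the level of the free algebra.\<close>

definition path_projection :: "'i list \<Rightarrow> 'i free_algebra" where
  "path_projection \<mu> = path_monomial \<mu> * free_star (path_monomial \<mu>)"

lemma homogeneous_path_projection: "homogeneous 0 (path_projection \<mu>)"
  using homogeneous_mult[OF homogeneous_path homogeneous_star[OF homogeneous_path], of \<mu> \<mu>]
  by (simp add: path_projection_def)

lemma cstar_subalgebraI: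
  assumes "D \<subseteq> carrier R" "\<zero>\<^bsub>R\<^esub> \<in> D"
    and "\<And>x y. x \<in> D \<Longrightarrow> y \<in> D \<Longrightarrow> x \<oplus>\<^bsub>R\<^esub> y \<in> D"
    and "\<And>c x. x \<in> D \<Longrightarrow> c \<odot>\<^bsub>R\<^esub> x \<in> D"
    and "\<And>x y. x \<in> D \<Longrightarrow> y \<in> D \<Longrightarrow> x \<otimes>\<^bsub>R\<^esub> y \<in> D"
    and "\<And>x. x \<in> D \<Longrightarrow> star R x \<in> D"
    and "\<And>f l. (\<And>n::nat. f n \<in> D) \<Longrightarrow> l \<in> carrier R \<Longrightarrow> (\<lambda>n. alg_norm R (f n \<ominus>\<^bsub>R\<^esub> l)) \<longlonglongrightarrow> 0 \<Longrightarrow> l \<in> D"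
  shows "cstar_subalgebra D R"
  unfolding cstar_subalgebra_def
proof (intro conjI ballI allI impI)
  fix f l assume *: "(\<forall>n::nat. f n \<in> D) \<and> l \<in> carrier R \<and> (\<lambda>n. alg_norm R (f n \<ominus>\<^bsub>R\<^esub> l)) \<longlonglongrightarrow> 0"
  show "l \<in> D" by (rule assms(7)[of f]) (use * in simp_all)
qed (rule assms; assumption)+

lemma cstar_subalgebraD:
  assumes "cstar_subalgebra D R"
  shows "D \<subseteq> carrier R" "\<zero>\<^bsub>R\<^esub> \<in> D"
    and "\<And>x y. x \<in> D \<Longrightarrow> y \<in> D \<Longrightarrow> x \<oplus>\<^bsub>R\<^esub> y \<in> D"
    and "\<And>c x. x \<in> D \<Longrightarrow> c \<odot>\<^bsub>R\<^esub> x \<in> D"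
    and "\<And>x y. x \<in> D \<Longrightarrow> y \<in> D \<Longrightarrow> x \<otimes>\<^bsub>R\<^esub> y \<in> D"
    and "\<And>x. x \<in> D \<Longrightarrow> star R x \<in> D"
    and "\<And>f l. (\<And>n::nat. f n \<in> D) \<Longrightarrow> l \<in> carrier R \<Longrightarrow> (\<lambda>n. alg_norm R (f n \<ominus>\<^bsub>R\<^esub> l)) \<longlonglongrightarrow> 0 \<Longrightarrow> l \<in> D"
proof -
  note u1 = assms[unfolded cstar_subalgebra_def]
  note u2 = u1[THEN conjunct2] note u3 = u2[THEN conjunct2] note u4 = u3[THEN conjunct2]
  note u5 = u4[THEN conjunct2] note u6 = u5[THEN conjunct2] note u7 = u6[THEN conjunct2]
  show "D \<subseteq> carrier R" "\<zero>\<^bsub>R\<^esub> \<in> D" by (rule u1[THEN conjunct1], rule u2[THEN conjunct1])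
  show "\<And>x y. x \<in> D \<Longrightarrow> y \<in> D \<Longrightarrow> x \<oplus>\<^bsub>R\<^esub> y \<in> D" by (rule u3[THEN conjunct1, THEN bspec, THEN bspec])
  show "\<And>c x. x \<in> D \<Longrightarrow> c \<odot>\<^bsub>R\<^esub> x \<in> D" by (rule u4[THEN conjunct1, THEN spec, THEN bspec])
  show "\<And>x y. x \<in> D \<Longrightarrow> y \<in> D \<Longrightarrow> x \<otimes>\<^bsub>R\<^esub> y \<in> D" by (rule u5[THEN conjunct1, THEN bspec, THEN bspec])
  show "\<And>x. x \<in> D \<Longrightarrow> star R x \<in> D" by (rule u6[THEN conjunct1, THEN bspec])
  fix f l assume f: "\<And>n::nat. f n \<in> D" "l \<in> carrier R" "(\<lambda>n. alg_norm R (f n \<ominus>\<^bsub>R\<^esub> l)) \<longlonglongrightarrow> 0"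
  show "l \<in> D" by (rule u7[THEN spec, THEN spec, THEN mp, of f]) (use f in simp)
qed

lemma cstar_generated_minimal: "cstar_subalgebra D R \<Longrightarrow> X \<subseteq> D \<Longrightarrow> cstar_generated R X \<subseteq> D"
  unfolding cstar_generated_def by blast

lemma cstar_generated_superset: "X \<subseteq> cstar_generated R X"
  unfolding cstar_generated_def by blast

lemma cstar_generated_subalgebra:
  assumes "cstar_algebra R" "X \<subseteq> carrier R" shows "cstar_subalgebra (cstar_generated R X) R"
proof -
  interpret cstar_algebra R by fact
  have c: "cstar_subalgebra (carrier R) R" by (auto simp: cstar_subalgebra_def)
  have mem: "x \<in> cstar_generated R X \<longleftrightarrow> (\<forall>D. cstar_subalgebra D R \<longrightarrow> X \<subseteq> D \<longrightarrow> x \<in> D)" for x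
    by (auto simp: cstar_generated_def)
  show ?thesis
  proof (rule cstar_subalgebraI)
    show "cstar_generated R X \<subseteq> carrier R" by (rule cstar_generated_minimal[OF c assms(2)])
    fix f l assume f: "\<And>n::nat. f n \<in> cstar_generated R X" "l \<in> carrier R" "(\<lambda>n. alg_norm R (f n \<ominus>\<^bsub>R\<^esub> l)) \<longlonglongrightarrow> 0"
    show "l \<in> cstar_generated R X" unfolding mem
    proof (intro allI impI)
      fix D assume D: "cstar_subalgebra D R" "X \<subseteq> D"
      then have "f n \<in> D" for n using f(1) mem by blast
      then show "l \<in> D" by (rule cstar_subalgebraD(7)[OF D(1) _ f(2,3)])
    qed
  qed (simp_all add: mem cstar_subalgebraD)
qed

context markov_shift
begin

lemma ind_vec: "y \<in> X \<Longrightarrow> ind y \<in> vecs"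
  by (auto simp: vecs_def supp_def ind_def)

lemma rep_star_ind:
  assumes x: "x \<in> X" and y: "y \<in> X" shows "rep (free_star a) (ind x) y = cnj (rep a (ind y) x)"
proof -
  have s: "supp (ind x) = {x}" "supp (ind y) = {y}" by (auto simp: supp_def ind_def)
  let ?v = "rep (free_star a) (ind x)"
  have "ip (rep a (ind y)) (ind x) = rep a (ind y) x" unfolding ip_def s by (simp add: ind_def)
  moreover have "ip (ind y) ?v = (\<Sum>z\<in>{y}. ind y z * cnj (?v z))"
    using rep_vecs[OF ind_vec[OF x], of "free_star a"]
    by (intro ip_superset) (auto simp: s vecs_def)
  ultimately have "rep a (ind y) x = cnj (?v y)"
    using rep_adjoint[OF ind_vec[OF y] ind_vec[OF x], of a] by (simp add: ind_def)
  then show ?thesis by simp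
qed

lemma rep_expand:
  assumes x: "x \<in> X"
  obtains U where "finite U" "U \<subseteq> X" "\<And>v. rep a v x = (\<Sum>z\<in>U. rep a (ind z) x * v z)"
proof -
  let ?K = "Poly_Mapping.keys a" and ?a = "Poly_Mapping.lookup a"
  define U where "U = (\<Union>w\<in>?K. set_option (word_pull (letters w) x))"
  have U: "finite U" "U \<subseteq> X" using word_pull_star(1)[OF x] by (auto simp: U_def)
  have "rep a v x = (\<Sum>z\<in>U. rep a (ind z) x * v z)" for v
  proof -
    have "(case word_pull (letters w) x of None \<Rightarrow> 0 | Some y \<Rightarrow> v y) =
        (\<Sum>z\<in>U. (case word_pull (letters w) x of None \<Rightarrow> 0 | Some y \<Rightarrow> ind z y) * v z)" if w: "w \<in> ?K" for w
    proof (cases "word_pull (letters w) x")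
      case (Some y)
      then have "y \<in> U" using w by (auto simp: U_def)
      have "(\<Sum>z\<in>U. ind z y * v z) = (\<Sum>z\<in>U. if y = z then v z else 0)"
        by (intro sum.cong) (auto simp: ind_def)
      then show ?thesis using Some U(1) \<open>y \<in> U\<close> by (simp add: sum.delta')
    qed simp
    then have "rep a v x = (\<Sum>w\<in>?K. \<Sum>z\<in>U. ?a w * (case word_pull (letters w) x of None \<Rightarrow> 0 | Some y \<Rightarrow> ind z y) * v z)"
      using x by (simp add: rep_def sum_distrib_left mult.assoc)
    also have "\<dots> = (\<Sum>z\<in>U. \<Sum>w\<in>?K. ?a w * (case word_pull (letters w) x of None \<Rightarrow> 0 | Some y \<Rightarrow> ind z y) * v z)"
      by (rule sum.swap)
    also have "\<dots> = (\<Sum>z\<in>U. rep a (ind z) x * v z)"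
      using x by (simp add: rep_def sum_distrib_right)
    finally show ?thesis .
  qed
  then show ?thesis using that U by blast
qed

lemma rep_eq_evaluation:
  assumes x: "x \<in> X" and u: "u \<in> X" and a: "\<And>z. z \<in> X \<Longrightarrow> rep a (ind z) x = (if z = u then 1 else 0)"
  shows "rep a v x = v u"
proof -
  obtain U where U: "finite U" "U \<subseteq> X" "\<And>v. rep a v x = (\<Sum>z\<in>U. rep a (ind z) x * v z)"
    using rep_expand[OF x] by blast
  have eq: "rep a v x = (if u \<in> U then v u else 0)" for v
  proof -
    have "rep a v x = (\<Sum>z\<in>U. if z = u then v z else 0)"
      unfolding U(3)[of v] using U(2) a by (intro sum.cong) auto
    then show ?thesis using U(1) by (simp add: sum.delta)
  qed
  have "u \<in> U" using eq[of "ind u"] a[OF u] by (auto split: if_splits)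
  then show ?thesis using eq by simp
qed

lemma rep_eq_zero:
  assumes x: "x \<in> X" and a: "\<And>z. z \<in> X \<Longrightarrow> rep a (ind z) x = 0"
  shows "rep a v x = 0"
proof -
  obtain U where U: "finite U" "U \<subseteq> X" "\<And>v. rep a v x = (\<Sum>z\<in>U. rep a (ind z) x * v z)"
    using rep_expand[OF x] by blast
  show ?thesis unfolding U(3)[of v] using U(2) a by (intro sum.neutral) auto
qed

lemma rep_path:
  "y \<in> X \<Longrightarrow> rep (path_monomial \<mu>) v y =
    (if point_prefix y (length \<mu>) = \<mu> then v ((shift ^^ length \<mu>) y) else 0)"
proof (induction \<mu> arbitrary: y)
  case Nil
  then show ?case by (simp add: rep_one point_prefix_def)
next
  case (Cons i \<mu>)
  then show ?case
    by (auto simp: rep_mult rep_gen point_prefix_Suc funpow_swap1)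
qed

lemma rep_star_path:
  "y \<in> X \<Longrightarrow> rep (free_star (path_monomial \<nu>)) v y = (if conc \<nu> y \<in> X then v (conc \<nu> y) else 0)"
proof (induction \<nu> arbitrary: v)
  case (Cons i \<nu>)
  then show ?case
    by (auto simp: free_star_mult rep_mult[of _ "adj i"] rep_adj cons_in_X)
qed (simp add: rep_one)

lemma shift_funpow_in_X [simp]: "y \<in> X \<Longrightarrow> (shift ^^ n) y \<in> X"
  by (induction n) auto

lemma rep_path_pair:
  assumes "y \<in> X"
  shows "rep (path_monomial \<mu> * free_star (path_monomial \<nu>)) v y =
    (if point_prefix y (length \<mu>) = \<mu> \<and> conc \<nu> ((shift ^^ length \<mu>) y) \<in> X
     then v (conc \<nu> ((shift ^^ length \<mu>) y)) else 0)"
  using assms by (simp add: rep_mult rep_path rep_star_path)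

lemma rep_path_projection:
  assumes y: "y \<in> X"
  shows "rep (path_projection \<mu>) v y = (if point_prefix y (length \<mu>) = \<mu> then v y else 0)"
  using y conc_prefix[of y "length \<mu>"]
  by (auto simp: path_projection_def rep_path_pair)

lemma relator_homogeneous: "r \<in> ck_relators A \<Longrightarrow> \<exists>d. homogeneous d r"
proof -
  assume r: "r \<in> ck_relators A"
  have gg: "homogeneous 0 (gen j * adj j)" "homogeneous 0 (adj j * gen j)" for j :: 'i
    using homogeneous_mult[OF homogeneous_gen[of j] homogeneous_adj[of j]]
      homogeneous_mult[OF homogeneous_adj[of j] homogeneous_gen[of j]] by simp_all
  have ggg: "homogeneous 1 (gen j * adj j * gen j)" for j :: 'i
    using homogeneous_mult[OF gg(1)[of j] homogeneous_gen[of j]] by simp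
  have n: "homogeneous 0 (of_nat n * (gen j * adj j))" for n and j :: 'i
    using homogeneous_scale[OF gg(1)[of j], of "of_nat n"] by (simp add: free_scale_def)
  consider i where "r = gen i * adj i * gen i - gen i" | "r = (\<Sum>j\<in>UNIV. gen j * adj j) - 1"
    | i where "r = adj i * gen i - (\<Sum>j\<in>UNIV. of_nat (A $ i $ j) * (gen j * adj j))"
    using r unfolding ck_relators_def by blast
  then show ?thesis
  proof cases
    case 1
    have "homogeneous 1 r" unfolding 1 by (intro homogeneous_minus ggg homogeneous_gen)
    then show ?thesis ..
  next
    case 2
    have "homogeneous 0 r" unfolding 2 by (intro homogeneous_minus homogeneous_sum homogeneous_one gg)
    then show ?thesis ..
  next
    case 3
    have "homogeneous 0 r" unfolding 3 by (intro homogeneous_minus homogeneous_sum gg n)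
    then show ?thesis ..
  qed
qed

sublocale alg: cstar_algebra "ck_algebra A"
  by (rule ck_algebra_cstar)

lemmas alg_cls = cls_in[folded ck_algebra_def] add_cls[folded ck_algebra_def] mult_cls[folded ck_algebra_def]
  smult_cls[folded ck_algebra_def] star_cls[folded ck_algebra_def] zero_C[folded ck_algebra_def]
  one_C[folded ck_algebra_def] minus_cls[folded ck_algebra_def] norm_const[folded ck_algebra_def]
lemmas alg_cases = cls_cases[folded ck_algebra_def]
lemmas alg_norm_cls = norm_cls[folded ck_algebra_def]

abbreviation const_cls :: "'i free_algebra \<Rightarrow> 'i ck_element" where
  "const_cls a \<equiv> cls (\<lambda>_. a)"

lemma const_cls_eqI: "a \<simeq> b \<Longrightarrow> const_cls a = const_cls b"
  by (simp add: cls_eq_iff eqv_def)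

lemma ck_gen_cls: "ck_gen A i = const_cls (gen i)"
  by (simp add: ck_gen_def const_class_def)

lemma path_proj_cls: "path_proj A \<mu> = const_cls (path_projection \<mu>)"
proof (induction \<mu>)
  case Nil
  then show ?case by (simp add: path_proj_def path_projection_def alg_cls)
next
  case (Cons i \<mu>)
  then have "path_proj A (i # \<mu>) =
      ck_gen A i \<otimes>\<^bsub>ck_algebra A\<^esub> const_cls (path_projection \<mu>) \<otimes>\<^bsub>ck_algebra A\<^esub> star (ck_algebra A) (ck_gen A i)"
    by (simp add: path_proj_def)
  then show ?case
    by (simp add: ck_gen_cls alg_cls path_projection_def free_star_mult mult.assoc)
qed

lemma diagonal_subalgebra: "cstar_subalgebra (ck_diagonal A) (ck_algebra A)"
  unfolding ck_diagonal_def
  by (rule cstar_generated_subalgebra[OF ck_algebra_cstar]) (auto simp: path_proj_cls alg_cls)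

lemma path_projection_diagonal: assumes "\<mu> \<noteq> []" shows "const_cls (path_projection \<mu>) \<in> ck_diagonal A"
  using cstar_generated_superset[of "{path_proj A \<mu> | \<mu>. \<mu> \<noteq> []}" "ck_algebra A"] assms
  unfolding ck_diagonal_def path_proj_cls by auto

lemma diagonal_minimal:
  assumes "cstar_subalgebra D (ck_algebra A)" "\<And>\<mu>. \<mu> \<noteq> [] \<Longrightarrow> const_cls (path_projection \<mu>) \<in> D"
  shows "ck_diagonal A \<subseteq> D"
  unfolding ck_diagonal_def using assms by (intro cstar_generated_minimal) (auto simp: path_proj_cls)

lemma diagonal_sum:
  assumes "finite J" "\<And>j. j \<in> J \<Longrightarrow> const_cls (f j) \<in> ck_diagonal A"
  shows "const_cls (\<Sum>j\<in>J. f j) \<in> ck_diagonal A"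
  using assms
proof (induction J)
  case empty
  then show ?case using cstar_subalgebraD(2)[OF diagonal_subalgebra] by (simp add: alg_cls)
next
  case (insert j J)
  then show ?case using cstar_subalgebraD(3)[OF diagonal_subalgebra, of "const_cls (f j)" "const_cls (\<Sum>j\<in>J. f j)"]
    by (simp add: alg_cls)
qed

end

section \<open>From eventual conjugacy to an isomorphism\<close>

text \<open>An eventual conjugacy with a constant lag \<open>K\<close>; by compactness, every eventual conjugacy is of
  this form.\<close>

locale shift_conjugacy = A: markov_shift A + B: markov_shift B
  for A :: "nat^'i^'i::finite" and B :: "nat^'j^'j::finite" +
  fixes h :: "(nat \<Rightarrow> 'i) \<Rightarrow> nat \<Rightarrow> 'j" and h' :: "(nat \<Rightarrow> 'j) \<Rightarrow> nat \<Rightarrow> 'i" and K :: nat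
  assumes h_maps: "x \<in> A.X \<Longrightarrow> h x \<in> B.X" and h'_maps: "y \<in> B.X \<Longrightarrow> h' y \<in> A.X"
    and h'_h: "x \<in> A.X \<Longrightarrow> h' (h x) = x" and h_h': "y \<in> B.X \<Longrightarrow> h (h' y) = y"
    and h_determined: "uniformly_determined A h" and h'_determined: "uniformly_determined B h'"
    and h_conj: "x \<in> A.X \<Longrightarrow> (shift ^^ K) (h (shift x)) = (shift ^^ Suc K) (h x)"
    and h'_conj: "y \<in> B.X \<Longrightarrow> (shift ^^ K) (h' (shift y)) = (shift ^^ Suc K) (h' y)"
begin

lemma swapped: "shift_conjugacy B A h' h K"
  by unfold_locales (fact h_maps h'_maps h'_h h_h' h_determined h'_determined h_conj h'_conj)+

lemma h_conj_nth: assumes "z \<in> A.X" "K \<le> m" shows "h (shift z) m = h z (Suc m)"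
proof -
  have "(shift ^^ K) (h (shift z)) (m - K) = (shift ^^ Suc K) (h z) (m - K)"
    using h_conj[OF assms(1)] by (rule arg_cong)
  then show ?thesis using assms(2) by (simp add: shift_funpow_nth del: funpow.simps)
qed

text \<open>A window length \<open>n\<close> such that the first \<open>n\<close> letters of \<open>h (shift z)\<close> determine whether the letter
  \<open>z 0\<close> can be put in front of the point, and then the first \<open>K + 1\<close> letters of the image under \<open>h\<close>.\<close>

lemma window_exists:
  "\<exists>n\<ge>K. \<forall>z\<in>A.X. \<forall>u\<in>B.X. (\<forall>l<n. h (shift z) l = u l) \<longrightarrow>
     case_nat (z 0) (h' u) \<in> A.X \<and> (\<forall>l<Suc K. h (case_nat (z 0) (h' u)) l = h z l)"
proof -
  obtain M where M: "\<And>x y. x \<in> A.X \<Longrightarrow> y \<in> A.X \<Longrightarrow> \<forall>l<M. x l = y l \<Longrightarrow> \<forall>l<Suc K. h x l = h y l"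
    by (rule uniformly_determinedD[OF h_determined, of "Suc K"]) (rule that)
  obtain n where n: "\<And>x y. x \<in> B.X \<Longrightarrow> y \<in> B.X \<Longrightarrow> \<forall>l<n. x l = y l \<Longrightarrow> \<forall>l<Suc M. h' x l = h' y l"
    by (rule uniformly_determinedD[OF h'_determined, of "Suc M"]) (rule that)
  have "case_nat (z 0) (h' u) \<in> A.X \<and> (\<forall>l<Suc K. h (case_nat (z 0) (h' u)) l = h z l)"
    if z: "z \<in> A.X" and u: "u \<in> B.X" and zu: "\<forall>l<max n K. h (shift z) l = u l" for z u
  proof -
    have "\<forall>l<n. h (shift z) l = u l" using zu by simp
    from n[OF h_maps[OF A.shift_in_X[OF z]] u this]
    have 1: "\<forall>l<Suc M. shift z l = h' u l" by (simp only: h'_h[OF A.shift_in_X[OF z]])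
    then have "A $ z 0 $ h' u 0 = 1" using A.X_step[OF z, of 0] by (auto simp: A.shift_nth)
    then have c: "case_nat (z 0) (h' u) \<in> A.X" using h'_maps[OF u] by (simp add: A.cons_in_X)
    have "\<forall>l<M. case_nat (z 0) (h' u) l = z l"
    proof (intro allI impI)
      fix l assume "l < M"
      then show "case_nat (z 0) (h' u) l = z l" using 1 by (cases l) (auto simp: A.shift_nth)
    qed
    from c M[OF c z this] show ?thesis by blast
  qed
  then show ?thesis by (intro exI[of _ "max n K"]) simp
qed

definition window :: nat where
  "window = (SOME n. n \<ge> K \<and> (\<forall>z\<in>A.X. \<forall>u\<in>B.X. (\<forall>l<n. h (shift z) l = u l) \<longrightarrow>
     case_nat (z 0) (h' u) \<in> A.X \<and> (\<forall>l<Suc K. h (case_nat (z 0) (h' u)) l = h z l)))"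

lemma window_ge: "K \<le> window"
  and window: "z \<in> A.X \<Longrightarrow> u \<in> B.X \<Longrightarrow> \<forall>l<window. h (shift z) l = u l \<Longrightarrow>
     case_nat (z 0) (h' u) \<in> A.X \<and> (\<forall>l<Suc K. h (case_nat (z 0) (h' u)) l = h z l)"
  using someI_ex[OF window_exists] unfolding window_def[symmetric] by blast+

text \<open>The partial isometry over \<open>B\<close> that implements the partial homeomorphism
  \<open>h (shift z) \<mapsto> h z\<close> of the points \<open>z\<close> with \<open>z 0 = i\<close>. Its path pairs have lengths
  \<open>window + 1\<close> and \<open>window\<close>, so it is homogeneous of degree one.\<close>

definition path_pairs :: "'i \<Rightarrow> ('j list \<times> 'j list) set" where
  "path_pairs i = {(point_prefix (h z) (Suc window), point_prefix (h (shift z)) window) | z. z \<in> A.X \<and> z 0 = i}"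

definition transport :: "'i \<Rightarrow> 'j free_algebra" where
  "transport i = (\<Sum>(\<mu>, \<nu>)\<in>path_pairs i. path_monomial \<mu> * free_star (path_monomial \<nu>))"

lemma path_pairs_length: "(\<mu>, \<nu>) \<in> path_pairs i \<Longrightarrow> length \<mu> = Suc window \<and> length \<nu> = window"
  by (auto simp: path_pairs_def)

lemma finite_path_pairs: "finite (path_pairs i)"
proof (rule finite_subset)
  show "path_pairs i \<subseteq> {\<mu>. length \<mu> = Suc window} \<times> {\<nu>. length \<nu> = window}"
    using path_pairs_length by auto
  show "finite ({\<mu> :: 'j list. length \<mu> = Suc window} \<times> {\<nu> :: 'j list. length \<nu> = window})"
    by (intro finite_cartesian_product finite_words_of_length)
qed

lemma homogeneous_transport: "homogeneous 1 (transport i)"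
proof -
  have "homogeneous 1 (path_monomial \<mu> * free_star (path_monomial \<nu>) :: 'j free_algebra)" if "(\<mu>, \<nu>) \<in> path_pairs i" for \<mu> \<nu>
    using homogeneous_mult[OF homogeneous_path homogeneous_star[OF homogeneous_path], of \<mu> \<nu>]
      path_pairs_length[OF that] by simp
  then show ?thesis unfolding transport_def by (intro homogeneous_sum) auto
qed

lemma rep_transport:
  assumes y: "y \<in> B.X"
  shows "B.rep (transport i) v y = (if h' y 0 = i then v (h (shift (h' y))) else 0)"
proof -
  let ?n = window
  define u where "u = h (shift (h' y))"
  define p where "p = (point_prefix y (Suc ?n), point_prefix u ?n)"
  define T where "T = (\<lambda>(\<mu>, \<nu>). B.rep (path_monomial \<mu> * free_star (path_monomial \<nu>)) v y)"
  have rep: "B.rep (transport i) v y = (\<Sum>q\<in>path_pairs i. T q)"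
    unfolding transport_def B.rep_sum T_def by (intro sum.cong) auto
  have hy: "h' y \<in> A.X" "h (h' y) = y" using h'_maps h_h' y by auto
  have uX: "u \<in> B.X" unfolding u_def by (intro h_maps A.shift_in_X hy)
  have u_nth: "u m = y (Suc m)" if "K \<le> m" for m
    using h_conj_nth[OF hy(1) that] hy(2) by (simp add: u_def)
  have u_conc: "conc (point_prefix u ?n) ((shift ^^ Suc ?n) y) = u"
  proof
    fix m
    show "conc (point_prefix u ?n) ((shift ^^ Suc ?n) y) m = u m"
      using u_nth[of m] window_ge
      by (auto simp: conc_nth shift_funpow_nth simp del: funpow.simps) (auto simp: point_prefix_def)
  qed
  \<comment> \<open>only one path pair contributes at \<open>y\<close>\<close>
  have only: "h' y 0 = i \<and> q = p" if q: "q \<in> path_pairs i" "T q \<noteq> 0" for q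
  proof -
    obtain z where z: "z \<in> A.X" "z 0 = i" "q = (point_prefix (h z) (Suc ?n), point_prefix (h (shift z)) ?n)"
      using q(1) by (auto simp: path_pairs_def)
    define u' where "u' = conc (point_prefix (h (shift z)) ?n) ((shift ^^ Suc ?n) y)"
    have "point_prefix y (Suc ?n) = point_prefix (h z) (Suc ?n) \<and> u' \<in> B.X"
      using q(2) unfolding T_def z(3) prod.case B.rep_path_pair[OF y] u'_def
      by (simp del: funpow.simps split: if_splits)
    then have yz: "\<And>m. m < Suc ?n \<Longrightarrow> y m = h z m" and u': "u' \<in> B.X"
      by (auto simp: point_prefix_eq_iff)
    have u'_nth: "u' m = (if m < ?n then h (shift z) m else y (Suc m))" for m
      by (auto simp: u'_def conc_nth shift_funpow_nth simp del: funpow.simps) (auto simp: point_prefix_def)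
    define z' where "z' = case_nat i (h' u')"
    have "z' \<in> A.X \<and> (\<forall>l<Suc K. h z' l = h z l)"
      using window[OF z(1) u'] z(2) u'_nth by (simp add: z'_def)
    then have z': "z' \<in> A.X" "\<And>l. l < Suc K \<Longrightarrow> h z' l = h z l" by auto
    have sz': "shift z' = h' u'" by (simp add: z'_def shift_def)
    have "h z' m = y m" for m
    proof (cases "m < Suc K")
      case True
      then show ?thesis using z'(2) yz[of m] window_ge by simp
    next
      case False
      then obtain l where l: "m = Suc l" "K \<le> l" by (cases m) auto
      have "h z' m = u' l"
        using h_conj_nth[OF z'(1) l(2)] by (simp add: l(1) sz' h_h'[OF u'])
      also have "\<dots> = y m"
        using u'_nth[of l] h_conj_nth[OF z(1) l(2)] yz[of "Suc l"] by (simp add: l(1))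
      finally show ?thesis .
    qed
    then have "h z' = y" by (rule ext)
    then have hz': "h' y = z'" using h'_h[OF z'(1)] by simp
    have "u = u'" unfolding u_def hz' sz' by (rule h_h'[OF u'])
    moreover have "point_prefix u' ?n = point_prefix (h (shift z)) ?n"
      by (simp add: point_prefix_eq_iff u'_nth)
    moreover have "point_prefix y (Suc ?n) = point_prefix (h z) (Suc ?n)"
      unfolding point_prefix_eq_iff using yz by blast
    ultimately show ?thesis using z(3) hz' by (simp add: p_def z'_def)
  qed
  show ?thesis
  proof (cases "h' y 0 = i")
    case True
    have p: "p \<in> path_pairs i"
      unfolding path_pairs_def p_def u_def using hy True by (intro CollectI exI[of _ "h' y"]) simp
    have "(\<Sum>q\<in>path_pairs i. T q) = (\<Sum>q\<in>{p}. T q)"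
      using p only by (intro sum.mono_neutral_right finite_path_pairs) auto
    also have "T p = v u"
      unfolding T_def p_def prod.case B.rep_path_pair[OF y] length_point_prefix u_conc using uX by simp
    then have "(\<Sum>q\<in>{p}. T q) = v u" by simp
    finally show ?thesis using True rep by (simp add: u_def)
  next
    case False
    then have "(\<Sum>q\<in>path_pairs i. T q) = 0" using only by (intro sum.neutral) blast
    then show ?thesis using False rep by simp
  qed
qed

lemma rep_transport_star:
  assumes y: "y \<in> B.X"
  shows "B.rep (free_star (transport i)) v y = (if A $ i $ h' y 0 = 1 then v (h (case_nat i (h' y))) else 0)"
proof -
  have ind: "B.rep (free_star (transport i)) (B.ind z) y = (if h' z 0 = i \<and> h (shift (h' z)) = y then 1 else 0)"
    if z: "z \<in> B.X" for z
    unfolding B.rep_star_ind[OF z y] rep_transport[OF z] B.ind_def by simp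
  have cond: "h' z 0 = i \<and> h (shift (h' z)) = y \<longleftrightarrow> A $ i $ h' y 0 = 1 \<and> z = h (case_nat i (h' y))"
    if z: "z \<in> B.X" for z
  proof
    assume a: "h' z 0 = i \<and> h (shift (h' z)) = y"
    have 1: "h' y = shift (h' z)"
      using h'_h[OF A.shift_in_X[OF h'_maps[OF z]]] unfolding a[THEN conjunct2] .
    have "A $ i $ h' y 0 = 1"
      using A.X_step[OF h'_maps[OF z], of 0] a[THEN conjunct1] unfolding 1 by (simp add: A.shift_nth)
    moreover have "case_nat i (h' y) = h' z"
      unfolding 1 a[THEN conjunct1, symmetric] by (auto simp: fun_eq_iff A.shift_nth split: nat.split)
    ultimately show "A $ i $ h' y 0 = 1 \<and> z = h (case_nat i (h' y))" using h_h'[OF z] by simp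
  next
    assume a: "A $ i $ h' y 0 = 1 \<and> z = h (case_nat i (h' y))"
    then have c: "case_nat i (h' y) \<in> A.X" using h'_maps[OF y] by (simp add: A.cons_in_X)
    have hz: "h' z = case_nat i (h' y)" unfolding a[THEN conjunct2] by (rule h'_h[OF c])
    have s: "shift (case_nat i (h' y)) = h' y" by (simp add: shift_def)
    show "h' z 0 = i \<and> h (shift (h' z)) = y" unfolding hz s h_h'[OF y] by simp
  qed
  show ?thesis
  proof (cases "A $ i $ h' y 0 = 1")
    case True
    then have "h (case_nat i (h' y)) \<in> B.X" using h'_maps[OF y] by (intro h_maps) (simp add: A.cons_in_X)
    then have "B.rep (free_star (transport i)) v y = v (h (case_nat i (h' y)))"
      by (rule B.rep_eq_evaluation[OF y]) (simp only: ind cond True simp_thms)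
    then show ?thesis using True by simp
  next
    case False
    have "B.rep (free_star (transport i)) v y = 0"
      by (rule B.rep_eq_zero[OF y]) (simp only: ind cond False simp_thms if_False)
    then show ?thesis using False by simp
  qed
qed

lemma rep_subst:
  assumes y: "y \<in> B.X" shows "B.rep (subst transport a) v y = A.rep a (\<lambda>x. v (h x)) (h' y)"
proof (induction a rule: free_induct)
  case (single w c)
  have "B.rep (prod_list (map (letter_subst transport) ls)) v y =
      (case A.word_pull ls (h' y) of None \<Rightarrow> 0 | Some x \<Rightarrow> v (h x))" if "y \<in> B.X" for ls y
    using that
  proof (induction ls arbitrary: y)
    case Nil
    then show ?case by (simp add: B.rep_one h_h')
  next
    case (Cons l ls)
    let ?r = "prod_list (map (letter_subst transport) ls)"
    have "B.rep (letter_subst transport l) (B.rep ?r v) y =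
        (case A.pull l (h' y) of None \<Rightarrow> 0 | Some x \<Rightarrow> B.rep ?r v (h x))"
      by (cases l) (simp_all add: rep_transport rep_transport_star Cons.prems)
    also have "\<dots> = (case A.word_pull (l # ls) (h' y) of None \<Rightarrow> 0 | Some x \<Rightarrow> v (h x))"
    proof (cases "A.pull l (h' y)")
      case (Some x)
      then have "x \<in> A.X" using A.pull_star(1) h'_maps[OF Cons.prems] by blast
      then show ?thesis using Some Cons.IH[OF h_maps] by (simp add: h'_h)
    qed simp
    finally show ?case by (simp add: B.rep_mult)
  qed
  then show ?case using y h'_maps[OF y]
    by (simp add: subst_single word_subst_def B.rep_scale A.rep_single)
qed (simp_all add: subst_add B.rep_add A.rep_add)

lemma subst_relator: assumes "r \<in> ck_relators A" shows "B.N (subst transport r) = 0"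
proof -
  obtain d where "homogeneous d r" using A.relator_homogeneous[OF assms] ..
  then have "homogeneous d (subst transport r)" by (intro homogeneous_subst homogeneous_transport)
  from B.homogeneous_faithful[OF this] show ?thesis
    using rep_subst A.rep_relator[OF assms] by (simp add: B.eqv_def)
qed

lemma subst_bounded: "B.N (subst transport a) \<le> A.N a"
proof -
  have "cstar_seminorm (\<lambda>a. B.N (subst transport a))"
    unfolding cstar_seminorm_def subst_add subst_scale subst_mult subst_star by (simp add: B.N_rules)
  then have "(\<lambda>a. B.N (subst transport a)) \<in> ck_seminorms A" using subst_relator by simp
  from ck_norm_upper[OF this] show ?thesis .
qed

lemma cauchy_subst:
  assumes "Z \<in> cauchy_seqs A.N" shows "(\<lambda>n. subst transport (Z n)) \<in> cauchy_seqs B.N"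
  unfolding cauchy_seqs_def
proof safe
  fix e :: real assume "e > 0"
  then obtain M where "\<forall>m\<ge>M. \<forall>n\<ge>M. A.N (Z m - Z n) < e" using A.cauchyD[OF assms] by blast
  then show "\<exists>M. \<forall>m\<ge>M. \<forall>n\<ge>M. B.N (subst transport (Z m) - subst transport (Z n)) < e"
    using subst_bounded unfolding subst_minus[symmetric] by (meson order.strict_trans1)
qed

text \<open>The extension of \<open>subst transport\<close> to the completions.\<close>

definition lift :: "'i ck_element \<Rightarrow> 'j ck_element" where
  "lift a = B.cls (\<lambda>n. subst transport (class_rep a n))"

lemma lift_cls:
  assumes Z: "Z \<in> cauchy_seqs A.N" shows "lift (A.cls Z) = B.cls (\<lambda>n. subst transport (Z n))"
  unfolding lift_def
proof (subst B.cls_eq_iff)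
  let ?Y = "class_rep (A.cls Z)"
  note Y = A.rep_cls[OF Z]
  show "(\<lambda>n. subst transport (?Y n)) \<in> cauchy_seqs B.N" "(\<lambda>n. subst transport (Z n)) \<in> cauchy_seqs B.N"
    by (rule cauchy_subst, fact)+
  show "(\<lambda>n. B.N (subst transport (?Y n) - subst transport (Z n))) \<longlonglongrightarrow> 0"
    by (rule Lim_null_comparison[OF always_eventually Y(2)])
       (use subst_bounded in \<open>simp add: B.N_rules flip: subst_minus\<close>)
qed

lemma lift_const: "lift (A.const_cls a) = B.const_cls (subst transport a)"
  using lift_cls[OF A.cauchy_const] by simp

lemma lift_closed: "a \<in> carrier (ck_algebra A) \<Longrightarrow> lift a \<in> carrier (ck_algebra B)"
  by (auto elim!: A.alg_cases simp: lift_cls B.alg_cls cauchy_subst)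

lemma lift_hom: "lift \<in> star_hom (ck_algebra A) (ck_algebra B)"
proof -
  have "lift \<in> ring_hom (ck_algebra A) (ck_algebra B)"
    by (rule ring_hom_memI)
       (auto elim!: A.alg_cases simp: lift_cls cauchy_subst A.alg_cls B.alg_cls subst_mult subst_add)
  then show ?thesis unfolding star_hom_def
    by (auto elim!: A.alg_cases simp: lift_cls cauchy_subst A.alg_cls B.alg_cls subst_scale subst_star)
qed

lemma lift_norm: assumes "a \<in> carrier (ck_algebra A)" shows "alg_norm (ck_algebra B) (lift a) \<le> alg_norm (ck_algebra A) a"
proof -
  obtain Z where Z: "Z \<in> cauchy_seqs A.N" "a = A.cls Z" using assms by (rule A.alg_cases)
  show ?thesis unfolding Z(2) lift_cls[OF Z(1)]
    by (rule LIMSEQ_le[OF B.alg_norm_cls[OF cauchy_subst[OF Z(1)]] A.alg_norm_cls[OF Z(1)]])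
       (use subst_bounded in blast)
qed

lemma lift_minus:
  assumes "a \<in> carrier (ck_algebra A)" "b \<in> carrier (ck_algebra A)"
  shows "lift (a \<ominus>\<^bsub>ck_algebra A\<^esub> b) = lift a \<ominus>\<^bsub>ck_algebra B\<^esub> lift b"
proof -
  obtain Y where Y: "Y \<in> cauchy_seqs A.N" "a = A.cls Y" using assms(1) by (rule A.alg_cases)
  obtain Z where Z: "Z \<in> cauchy_seqs A.N" "b = A.cls Z" using assms(2) by (rule A.alg_cases)
  show ?thesis using Y Z
    by (simp add: A.alg_cls B.alg_cls lift_cls cauchy_subst subst_minus)
qed

lemma lift_diagonal: "lift ` ck_diagonal A \<subseteq> ck_diagonal B"
proof -
  note D = cstar_subalgebraD[OF B.diagonal_subalgebra]
  note hom = lift_hom[unfolded star_hom_def]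
  have "ck_diagonal A \<subseteq> {a \<in> carrier (ck_algebra A). lift a \<in> ck_diagonal B}"
  proof (rule A.diagonal_minimal)
    show "cstar_subalgebra {a \<in> carrier (ck_algebra A). lift a \<in> ck_diagonal B} (ck_algebra A)"
    proof (rule cstar_subalgebraI)
      have "lift \<zero>\<^bsub>ck_algebra A\<^esub> = \<zero>\<^bsub>ck_algebra B\<^esub>"
        by (simp add: A.alg_cls B.alg_cls lift_const)
      then show "\<zero>\<^bsub>ck_algebra A\<^esub> \<in> {a \<in> carrier (ck_algebra A). lift a \<in> ck_diagonal B}" using D(2) by simp
      fix f l assume f: "\<And>n::nat. f n \<in> {a \<in> carrier (ck_algebra A). lift a \<in> ck_diagonal B}"
        and l: "l \<in> carrier (ck_algebra A)"
        and lim: "(\<lambda>n. alg_norm (ck_algebra A) (f n \<ominus>\<^bsub>ck_algebra A\<^esub> l)) \<longlonglongrightarrow> 0"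
      have fc: "f n \<in> carrier (ck_algebra A)" for n using f by blast
      have "lift l \<in> ck_diagonal B"
      proof (rule D(7))
        show "lift (f n) \<in> ck_diagonal B" for n using f by blast
        show "lift l \<in> carrier (ck_algebra B)" by (rule lift_closed[OF l])
        show "(\<lambda>n. alg_norm (ck_algebra B) (lift (f n) \<ominus>\<^bsub>ck_algebra B\<^esub> lift l)) \<longlonglongrightarrow> 0"
        proof (rule Lim_null_comparison[OF always_eventually lim], rule allI)
          fix n
          have "f n \<ominus>\<^bsub>ck_algebra A\<^esub> l \<in> carrier (ck_algebra A)" using fc l by simp
          from lift_norm[OF this] B.alg.norm_nonneg[OF lift_closed[OF this]]
          show "norm (alg_norm (ck_algebra B) (lift (f n) \<ominus>\<^bsub>ck_algebra B\<^esub> lift l))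
              \<le> alg_norm (ck_algebra A) (f n \<ominus>\<^bsub>ck_algebra A\<^esub> l)"
            by (simp add: lift_minus[OF fc l])
        qed
      qed
      then show "l \<in> {a \<in> carrier (ck_algebra A). lift a \<in> ck_diagonal B}" using l by simp
    qed (use hom D(3-6) in \<open>auto simp: ring_hom_add ring_hom_mult\<close>)
  next
    fix \<mu> :: "'i list" assume "\<mu> \<noteq> []"
    obtain m0 where m0: "\<And>x y. x \<in> B.X \<Longrightarrow> y \<in> B.X \<Longrightarrow> \<forall>l<m0. x l = y l \<Longrightarrow> \<forall>l<length \<mu>. h' x l = h' y l"
      by (rule uniformly_determinedD[OF h'_determined, of "length \<mu>"]) (rule that)
    define m where "m = Suc m0"
    define Q where "Q = {point_prefix y m | y. y \<in> B.X \<and> point_prefix (h' y) (length \<mu>) = \<mu>}"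
    have Qlen: "length \<nu> = m" if "\<nu> \<in> Q" for \<nu> using that by (auto simp: Q_def)
    have Qfin: "finite Q"
      by (rule finite_subset[OF _ finite_words_of_length[where n=m]]) (use Qlen in auto)
    have Q: "point_prefix y m \<in> Q \<longleftrightarrow> point_prefix (h' y) (length \<mu>) = \<mu>" if y: "y \<in> B.X" for y
    proof
      assume "point_prefix y m \<in> Q"
      then obtain x where x: "x \<in> B.X" "point_prefix (h' x) (length \<mu>) = \<mu>" "point_prefix y m = point_prefix x m"
        by (auto simp: Q_def)
      then have "\<forall>l<m0. x l = y l" by (simp add: point_prefix_eq_iff m_def)
      then have "point_prefix (h' x) (length \<mu>) = point_prefix (h' y) (length \<mu>)"
        unfolding point_prefix_eq_iff by (rule m0[OF x(1) y])
      then show "point_prefix (h' y) (length \<mu>) = \<mu>" using x(2) by metis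
    qed (use y in \<open>auto simp: Q_def\<close>)
    let ?p = "subst transport (path_projection \<mu>)" and ?q = "\<Sum>\<nu>\<in>Q. path_projection \<nu>"
    have "B.eqv ?p ?q"
    proof (rule B.homogeneous_eqvI)
      show "homogeneous 0 ?p" by (intro homogeneous_subst homogeneous_transport homogeneous_path_projection)
      show "homogeneous 0 ?q" by (intro homogeneous_sum homogeneous_path_projection)
      fix v y assume y: "y \<in> B.X"
      have "B.rep ?q v y = (\<Sum>\<nu>\<in>Q. if point_prefix y m = \<nu> then v y else 0)"
        unfolding B.rep_sum by (intro sum.cong) (simp_all add: B.rep_path_projection[OF y] Qlen)
      also have "\<dots> = (if point_prefix (h' y) (length \<mu>) = \<mu> then v y else 0)"
        using Qfin Q[OF y] by (simp add: sum.delta')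
      also have "\<dots> = B.rep ?p v y"
        by (simp add: rep_subst[OF y] A.rep_path_projection[OF h'_maps[OF y]] h_h'[OF y])
      finally show "B.rep ?p v y = B.rep ?q v y" ..
    qed
    then have "lift (A.const_cls (path_projection \<mu>)) = B.const_cls ?q"
      unfolding lift_const by (rule B.const_cls_eqI)
    also have "\<dots> \<in> ck_diagonal B"
    proof (rule B.diagonal_sum[OF Qfin])
      fix \<nu> assume "\<nu> \<in> Q"
      from Qlen[OF this] have "\<nu> \<noteq> []" by (auto simp: m_def)
      then show "B.const_cls (path_projection \<nu>) \<in> ck_diagonal B" by (rule B.path_projection_diagonal)
    qed
    finally show "A.const_cls (path_projection \<mu>) \<in> {a \<in> carrier (ck_algebra A). lift a \<in> ck_diagonal B}"
      by (simp add: A.alg_cls)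
  qed
  then show ?thesis by blast
qed

lemma lift_gauge:
  assumes z: "cmod z = 1" and a: "a \<in> carrier (ck_algebra A)"
  shows "gauge_action B z (lift a) = lift (gauge_action A z a)"
proof -
  obtain Z where Z: "Z \<in> cauchy_seqs A.N" "a = A.cls Z" using a by (rule A.alg_cases)
  show ?thesis unfolding Z(2)
    by (simp add: lift_cls[OF Z(1)] gauge_cls[OF z] Z(1) cauchy_subst lift_cls free_gauge_subst homogeneous_transport)
qed

interpretation sw: shift_conjugacy B A h' h K
  by (rule swapped)

lemma subst_inverse: "A.eqv (subst sw.transport (subst transport a)) a"
proof (induction a rule: free_induct)
  case (single w c)
  let ?a = "Poly_Mapping.single w c"
  have hom: "homogeneous (word_degree w) ?a" by (simp add: homogeneous_single)
  show ?case
  proof (rule A.homogeneous_eqvI[OF _ hom])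
    show "homogeneous (word_degree w) (subst sw.transport (subst transport ?a))"
      by (intro homogeneous_subst homogeneous_transport sw.homogeneous_transport hom)
    fix v x assume x: "x \<in> A.X"
    have "A.rep (subst sw.transport (subst transport ?a)) v x = A.rep ?a (\<lambda>x. v (h' (h x))) (h' (h x))"
      by (simp add: sw.rep_subst[OF x] rep_subst[OF h_maps[OF x]])
    also have "\<dots> = A.rep ?a v x"
      unfolding h'_h[OF x] by (rule A.rep_cong) (simp add: h'_h)
    finally show "A.rep (subst sw.transport (subst transport ?a)) v x = A.rep ?a v x" .
  qed
qed (auto simp: subst_add intro: A.eqv_add)

lemma lift_inverse: assumes "a \<in> carrier (ck_algebra A)" shows "sw.lift (lift a) = a"
proof -
  obtain Z where Z: "Z \<in> cauchy_seqs A.N" "a = A.cls Z" using assms by (rule A.alg_cases)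
  have "sw.lift (lift a) = A.cls (\<lambda>n. subst sw.transport (subst transport (Z n)))"
    by (simp add: Z lift_cls sw.lift_cls cauchy_subst)
  also have "\<dots> = a" unfolding Z(2)
    using subst_inverse sw.cauchy_subst[OF cauchy_subst[OF Z(1)]] Z(1)
    by (simp add: A.cls_eq_iff A.eqv_def)
  finally show ?thesis .
qed

end

context shift_conjugacy
begin

interpretation sw: shift_conjugacy B A h' h K
  by (rule swapped)

theorem diagonal_gauge_isomorphism:
  "\<exists>\<Psi>\<in>star_iso (ck_algebra A) (ck_algebra B). \<Psi> ` ck_diagonal A = ck_diagonal B \<and>
    (\<forall>z. cmod z = 1 \<longrightarrow> (\<forall>a\<in>carrier (ck_algebra A). gauge_action B z (\<Psi> a) = \<Psi> (gauge_action A z a)))"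
proof (rule bexI[of _ lift])
  have inv: "lift (sw.lift b) = b" if "b \<in> carrier (ck_algebra B)" for b
    using sw.lift_inverse[OF that] .
  have "bij_betw lift (carrier (ck_algebra A)) (carrier (ck_algebra B))"
  proof (rule bij_betw_byWitness[where f'=sw.lift])
    show "\<forall>a\<in>carrier (ck_algebra A). sw.lift (lift a) = a" by (intro ballI lift_inverse)
    show "\<forall>b\<in>carrier (ck_algebra B). lift (sw.lift b) = b" by (intro ballI inv)
    show "lift ` carrier (ck_algebra A) \<subseteq> carrier (ck_algebra B)" by (intro image_subsetI lift_closed)
    show "sw.lift ` carrier (ck_algebra B) \<subseteq> carrier (ck_algebra A)" by (intro image_subsetI sw.lift_closed)
  qed
  then show "lift \<in> star_iso (ck_algebra A) (ck_algebra B)" using lift_hom unfolding star_iso_def by (intro CollectI conjI)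
  have "ck_diagonal B \<subseteq> lift ` ck_diagonal A"
  proof
    fix b assume b: "b \<in> ck_diagonal B"
    have "sw.lift b \<in> ck_diagonal A" by (rule subsetD[OF sw.lift_diagonal imageI[OF b]])
    moreover have "b = lift (sw.lift b)"
      by (rule inv[symmetric]) (rule subsetD[OF cstar_subalgebraD(1)[OF B.diagonal_subalgebra] b])
    ultimately show "b \<in> lift ` ck_diagonal A" by (rule rev_image_eqI)
  qed
  then have "lift ` ck_diagonal A = ck_diagonal B" using lift_diagonal by (intro equalityI)
  then show "lift ` ck_diagonal A = ck_diagonal B \<and> (\<forall>z. cmod z = 1 \<longrightarrow>
      (\<forall>a\<in>carrier (ck_algebra A). gauge_action B z (lift a) = lift (gauge_action A z a)))"
    by (intro conjI allI impI ballI lift_gauge)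
qed

end

lemma constant_lag:
  fixes A :: "nat^'i^'i::finite"
  assumes k: "continuous_map (shift_topology A) (discrete_topology (UNIV :: nat set)) k"
  obtains K where "\<And>x. x \<in> shift_space A \<Longrightarrow> k x \<le> K"
proof -
  obtain n where "\<And>x y. x \<in> shift_space A \<Longrightarrow> y \<in> shift_space A \<Longrightarrow> \<forall>m<n. x m = y m \<Longrightarrow> k x = k y"
    by (rule finitely_determined[OF k]) (rule that)
  then have "finite (k ` shift_space A)" by (rule finite_range_of_finitely_determined)
  then have "k x \<le> Max (k ` shift_space A)" if "x \<in> shift_space A" for x using that by simp
  then show ?thesis using that by blast
qed

lemma larger_lag:
  assumes "(shift ^^ k) u = (shift ^^ (k + 1)) w" "k \<le> K" shows "(shift ^^ K) u = (shift ^^ Suc K) w"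
proof -
  have "(shift ^^ K) u = (shift ^^ (K - k)) ((shift ^^ k) u)"
  proof -
    have "(shift ^^ (K - k + k)) u = (shift ^^ (K - k)) ((shift ^^ k) u)" by (simp only: funpow_add comp_apply)
    then show ?thesis using assms(2) by simp
  qed
  also have "\<dots> = (shift ^^ (K - k + (k + 1))) w" unfolding assms(1) by (simp only: funpow_add comp_apply)
  also have "K - k + (k + 1) = Suc K" using assms(2) by simp
  finally show ?thesis .
qed

theorem eventually_conjugate_imp_isomorphic:
  assumes A: "markov_shift A" and B: "markov_shift B" and conj: "eventually_conjugate A B"
  shows "\<exists>\<Psi>\<in>star_iso (ck_algebra A) (ck_algebra B). \<Psi> ` ck_diagonal A = ck_diagonal B \<and>
    (\<forall>z. cmod z = 1 \<longrightarrow> (\<forall>a\<in>carrier (ck_algebra A). gauge_action B z (\<Psi> a) = \<Psi> (gauge_action A z a)))"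
proof -
  interpret A: markov_shift A by fact
  interpret B: markov_shift B by fact
  obtain h h' k k' where hom: "homeomorphic_maps (shift_topology A) (shift_topology B) h h'"
    and k: "continuous_map (shift_topology A) (discrete_topology (UNIV :: nat set)) k"
    and k': "continuous_map (shift_topology B) (discrete_topology (UNIV :: nat set)) k'"
    and c: "\<forall>x\<in>A.X. (shift ^^ k x) (h (shift x)) = (shift ^^ (k x + 1)) (h x)"
    and c': "\<forall>y\<in>B.X. (shift ^^ k' y) (h' (shift y)) = (shift ^^ (k' y + 1)) (h' y)"
    using conj unfolding eventually_conjugate_def by blast
  have cont: "continuous_map (shift_topology A) (shift_topology B) h"
    "continuous_map (shift_topology B) (shift_topology A) h'"
    and inv: "\<forall>x\<in>A.X. h' (h x) = x" "\<forall>y\<in>B.X. h (h' y) = y"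
    using hom by (simp_all add: homeomorphic_maps_def)
  obtain K where K: "\<And>x. x \<in> A.X \<Longrightarrow> k x \<le> K" by (rule constant_lag[OF k]) (rule that)
  obtain K' where K': "\<And>y. y \<in> B.X \<Longrightarrow> k' y \<le> K'" by (rule constant_lag[OF k']) (rule that)
  interpret shift_conjugacy A B h h' "max K K'"
  proof unfold_locales
    show "h x \<in> B.X" if "x \<in> A.X" for x using continuous_map_image_subset_topspace[OF cont(1)] that by auto
    show "h' y \<in> A.X" if "y \<in> B.X" for y using continuous_map_image_subset_topspace[OF cont(2)] that by auto
    show "uniformly_determined A h" "uniformly_determined B h'"
      using cont by (auto intro: continuous_imp_uniformly_determined)
    show "(shift ^^ max K K') (h (shift x)) = (shift ^^ Suc (max K K')) (h x)" if "x \<in> A.X" for x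
      using c[rule_format, OF that] by (rule larger_lag) (use K[OF that] in simp)
    show "(shift ^^ max K K') (h' (shift y)) = (shift ^^ Suc (max K K')) (h' y)" if "y \<in> B.X" for y
      using c'[rule_format, OF that] by (rule larger_lag) (use K'[OF that] in simp)
  qed (use inv in auto)
  show ?thesis by (rule diagonal_gauge_isomorphism)
qed

section \<open>Characters\<close>

text \<open>A character of a closed unital subalgebra is contractive: otherwise some \<open>e\<close> of norm less than
  one has the value one, and applying the character to the Neumann series \<open>l = 1 + e l\<close> gives
  a contradiction.\<close>

lemma character_contractive:
  assumes R: "cstar_algebra R" and D: "cstar_subalgebra D R" and one: "\<one>\<^bsub>R\<^esub> \<in> D"
    and add: "\<And>x y. x \<in> D \<Longrightarrow> y \<in> D \<Longrightarrow> \<phi> (x \<oplus>\<^bsub>R\<^esub> y) = \<phi> x + \<phi> y"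
    and scale: "\<And>c x. x \<in> D \<Longrightarrow> \<phi> (c \<odot>\<^bsub>R\<^esub> x) = c * \<phi> x"
    and mult: "\<And>x y. x \<in> D \<Longrightarrow> y \<in> D \<Longrightarrow> \<phi> (x \<otimes>\<^bsub>R\<^esub> y) = \<phi> x * \<phi> y"
    and \<phi>1: "\<phi> \<one>\<^bsub>R\<^esub> = (1 :: complex)" and d: "d \<in> D"
  shows "cmod (\<phi> d) \<le> alg_norm R d"
proof (rule ccontr)
  interpret cstar_algebra R by fact
  note DD = cstar_subalgebraD[OF D]
  have DC: "x \<in> carrier R" if "x \<in> D" for x using DD(1) that by blast
  assume "\<not> cmod (\<phi> d) \<le> alg_norm R d"
  then have gt: "alg_norm R d < cmod (\<phi> d)" by simp
  then have pos: "cmod (\<phi> d) > 0" using norm_nonneg[OF DC[OF d]] by linarith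
  define e where "e = inverse (\<phi> d) \<odot>\<^bsub>R\<^esub> d"
  define r where "r = alg_norm R e"
  have e: "e \<in> D" "\<phi> e = 1" using pos d DD(4) scale by (auto simp: e_def)
  have eC: "e \<in> carrier R" by (rule DC[OF e(1)])
  have "r = alg_norm R d / cmod (\<phi> d)"
    unfolding r_def e_def norm_smult[OF DC[OF d]] by (simp add: norm_inverse divide_inverse)
  then have r: "0 \<le> r" "r < 1"
    using gt pos norm_nonneg[OF DC[OF d]] by simp_all
  define s where "s = rec_nat \<zero>\<^bsub>R\<^esub> (\<lambda>_ x. \<one>\<^bsub>R\<^esub> \<oplus>\<^bsub>R\<^esub> e \<otimes>\<^bsub>R\<^esub> x)"
  have s0: "s 0 = \<zero>\<^bsub>R\<^esub>" and sS: "s (Suc n) = \<one>\<^bsub>R\<^esub> \<oplus>\<^bsub>R\<^esub> e \<otimes>\<^bsub>R\<^esub> s n" for n by (simp_all add: s_def)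
  have sD: "s n \<in> D" for n
  proof (induction n)
    case 0
    show ?case unfolding s0 by (rule DD(2))
  next
    case (Suc n)
    show ?case unfolding sS by (rule DD(3)[OF one DD(5)[OF e(1) Suc]])
  qed
  have sC: "s n \<in> carrier R" for n by (rule DC[OF sD])
  define c where "c = alg_norm R \<one>\<^bsub>R\<^esub>"
  have step: "alg_norm R (s (Suc n) \<ominus>\<^bsub>R\<^esub> s n) \<le> c * r ^ n" for n
  proof (induction n)
    case 0
    show ?case using eC by (simp add: s0 sS c_def a_minus_def)
  next
    case (Suc n)
    have "s (Suc (Suc n)) \<ominus>\<^bsub>R\<^esub> s (Suc n) = e \<otimes>\<^bsub>R\<^esub> (s (Suc n) \<ominus>\<^bsub>R\<^esub> s n)"
    proof -
      have "\<one>\<^bsub>R\<^esub> \<oplus>\<^bsub>R\<^esub> x \<ominus>\<^bsub>R\<^esub> (\<one>\<^bsub>R\<^esub> \<oplus>\<^bsub>R\<^esub> y) = x \<ominus>\<^bsub>R\<^esub> y" if "x \<in> carrier R" "y \<in> carrier R" for x y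
      proof -
        have "\<one>\<^bsub>R\<^esub> \<oplus>\<^bsub>R\<^esub> x \<ominus>\<^bsub>R\<^esub> (\<one>\<^bsub>R\<^esub> \<oplus>\<^bsub>R\<^esub> y) = (\<one>\<^bsub>R\<^esub> \<oplus>\<^bsub>R\<^esub> \<ominus>\<^bsub>R\<^esub> \<one>\<^bsub>R\<^esub>) \<oplus>\<^bsub>R\<^esub> (x \<oplus>\<^bsub>R\<^esub> \<ominus>\<^bsub>R\<^esub> y)"
          using that by (simp add: a_minus_def minus_add a_ac)
        then show ?thesis using that by (simp add: r_neg a_minus_def)
      qed
      then have "s (Suc (Suc n)) \<ominus>\<^bsub>R\<^esub> s (Suc n) = e \<otimes>\<^bsub>R\<^esub> s (Suc n) \<ominus>\<^bsub>R\<^esub> e \<otimes>\<^bsub>R\<^esub> s n"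
        using sS[of "Suc n"] sS[of n] eC sC by simp
      then show ?thesis using eC sC by (simp add: a_minus_def r_distr r_minus)
    qed
    then have "alg_norm R (s (Suc (Suc n)) \<ominus>\<^bsub>R\<^esub> s (Suc n)) \<le> r * alg_norm R (s (Suc n) \<ominus>\<^bsub>R\<^esub> s n)"
      using norm_mult[OF eC, of "s (Suc n) \<ominus>\<^bsub>R\<^esub> s n"] sC by (simp add: r_def)
    also have "\<dots> \<le> r * (c * r ^ n)" using Suc r by (intro mult_left_mono)
    finally show ?case by (simp add: ac_simps)
  qed
  have c0: "0 \<le> c" unfolding c_def by (rule norm_nonneg) simp
  have dist: "alg_norm R (s (n + k) \<ominus>\<^bsub>R\<^esub> s n) \<le> c * (r ^ n - r ^ (n + k)) / (1 - r)" for n k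
  proof (induction k)
    case 0
    show ?case using sC[of n] norm_zero_iff[of "\<zero>\<^bsub>R\<^esub>"] by (simp add: a_minus_def r_neg)
  next
    case (Suc k)
    have "alg_norm R (s (n + Suc k) \<ominus>\<^bsub>R\<^esub> s n) \<le>
        alg_norm R (s (Suc (n + k)) \<ominus>\<^bsub>R\<^esub> s (n + k)) + alg_norm R (s (n + k) \<ominus>\<^bsub>R\<^esub> s n)"
      using diff_split[OF sC[of "Suc (n + k)"] sC[of "n + k"] sC[of n]]
        norm_add[of "s (Suc (n + k)) \<ominus>\<^bsub>R\<^esub> s (n + k)" "s (n + k) \<ominus>\<^bsub>R\<^esub> s n"] sC by simp
    also have "\<dots> \<le> c * r ^ (n + k) + c * (r ^ n - r ^ (n + k)) / (1 - r)"
      using step[of "n + k"] Suc by linarith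
    also have "\<dots> = c * (r ^ n - r ^ (n + Suc k)) / (1 - r)" using r by (simp add: field_simps)
    finally show ?case .
  qed
  have dist': "alg_norm R (s m \<ominus>\<^bsub>R\<^esub> s n) \<le> c * r ^ n / (1 - r)" if "n \<le> m" for m n
  proof -
    have "c * (r ^ n - r ^ m) / (1 - r) \<le> c * r ^ n / (1 - r)"
      using c0 r by (intro divide_right_mono mult_left_mono) auto
    then show ?thesis using dist[of n "m - n"] that by simp
  qed
  have "\<exists>l\<in>carrier R. (\<lambda>n. alg_norm R (s n \<ominus>\<^bsub>R\<^esub> l)) \<longlonglongrightarrow> 0"
  proof (rule complete[OF sC])
    fix \<epsilon> :: real assume "\<epsilon> > 0"
    have "(\<lambda>n. c * r ^ n / (1 - r)) \<longlonglongrightarrow> c * 0 / (1 - r)"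
      using r by (intro tendsto_intros LIMSEQ_power_zero) auto
    then have "\<forall>\<^sub>F n in sequentially. c * r ^ n / (1 - r) < \<epsilon>" using \<open>\<epsilon> > 0\<close> by (intro order_tendstoD(2)) auto
    then obtain M where M: "\<And>n. n \<ge> M \<Longrightarrow> c * r ^ n / (1 - r) < \<epsilon>" by (auto simp: eventually_sequentially)
    have comm: "alg_norm R (s m \<ominus>\<^bsub>R\<^esub> s n) = alg_norm R (s n \<ominus>\<^bsub>R\<^esub> s m)" for m n
      using norm_minus[of "s m \<ominus>\<^bsub>R\<^esub> s n"] sC[of m] sC[of n] by (simp add: a_minus_def minus_add a_comm)
    have "alg_norm R (s m \<ominus>\<^bsub>R\<^esub> s n) < \<epsilon>" if "m \<ge> M" "n \<ge> M" for m n
    proof (cases "n \<le> m")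
      case True
      then show ?thesis using dist'[OF True] M[OF that(2)] by linarith
    next
      case False
      then show ?thesis using dist'[of m n] M[OF that(1)] comm[of m n] by linarith
    qed
    then show "\<exists>M. \<forall>m\<ge>M. \<forall>n\<ge>M. alg_norm R (s m \<ominus>\<^bsub>R\<^esub> s n) < \<epsilon>" by blast
  qed
  then obtain l where l: "l \<in> carrier R" "(\<lambda>n. alg_norm R (s n \<ominus>\<^bsub>R\<^esub> l)) \<longlonglongrightarrow> 0" by blast
  have lD: "l \<in> D" by (rule DD(7)[OF sD l])
  have conv: "converges s l" using sC l by (simp add: converges_def)
  have "converges (\<lambda>n. s (Suc n)) (\<one>\<^bsub>R\<^esub> \<oplus>\<^bsub>R\<^esub> e \<otimes>\<^bsub>R\<^esub> l)"
    unfolding sS by (intro converges_add converges_mult converges_const conv) (use eC in auto)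
  moreover have "converges (\<lambda>n. s (Suc n)) l"
    using conv LIMSEQ_Suc[OF l(2)] by (simp add: converges_def)
  ultimately have "l = \<one>\<^bsub>R\<^esub> \<oplus>\<^bsub>R\<^esub> e \<otimes>\<^bsub>R\<^esub> l" by (rule converges_unique[rotated])
  then have "\<phi> l = 1 + \<phi> l"
    using add[OF one DD(5)[OF e(1) lD]] mult[OF e(1) lD] e(2) \<phi>1 by simp
  then show False by simp
qed

section \<open>Matrix coefficients on the Cuntz--Krieger algebra\<close>

context markov_shift
begin

abbreviation "\<O> \<equiv> ck_algebra A"
abbreviation "\<D> \<equiv> ck_diagonal A"

lemma diagonal_carrier: "d \<in> \<D> \<Longrightarrow> d \<in> carrier \<O>"
  using cstar_subalgebraD(1)[OF diagonal_subalgebra] by blast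

lemma const_cls_closed [simp, intro]: "const_cls a \<in> carrier \<O>"
  by (simp add: alg_cls)

text \<open>The extension of the matrix coefficients \<open>rep a (ind y) x\<close> to the completion.\<close>

definition coef :: "(nat \<Rightarrow> 'i) \<Rightarrow> (nat \<Rightarrow> 'i) \<Rightarrow> 'i ck_element \<Rightarrow> complex" where
  "coef x y a = lim (\<lambda>n. rep (class_rep a n) (ind y) x)"

lemma coefficient_diff: "y \<in> X \<Longrightarrow> cmod (rep a (ind y) x - rep b (ind y) x) \<le> N (a - b)"
  using coefficient_bounded[of y "a - b" x] by (simp add: rep_minus)

lemma coef_cls:
  assumes y: "y \<in> X" and Z: "Z \<in> cauchy_seqs N" shows "(\<lambda>n. rep (Z n) (ind y) x) \<longlonglongrightarrow> coef x y (cls Z)"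
proof -
  let ?Y = "class_rep (cls Z)"
  have "Cauchy (\<lambda>n. rep (?Y n) (ind y) x)"
    unfolding Cauchy_def dist_norm
    using cauchyD[OF rep_cls(1)[OF Z]] coefficient_diff[OF y] by (meson order.strict_trans1)
  then have "(\<lambda>n. rep (?Y n) (ind y) x) \<longlonglongrightarrow> coef x y (cls Z)"
    unfolding coef_def using Cauchy_convergent convergent_LIMSEQ_iff by blast
  moreover have "(\<lambda>n. rep (?Y n) (ind y) x - rep (Z n) (ind y) x) \<longlonglongrightarrow> 0"
    by (rule Lim_null_comparison[OF always_eventually rep_cls(2)[OF Z]]) (simp add: coefficient_diff[OF y])
  ultimately have "(\<lambda>n. rep (?Y n) (ind y) x - (rep (?Y n) (ind y) x - rep (Z n) (ind y) x)) \<longlonglongrightarrow> coef x y (cls Z) - 0"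
    by (rule tendsto_diff)
  then show ?thesis by simp
qed

lemma coef_eqI:
  assumes "y \<in> X" "Z \<in> cauchy_seqs N" "(\<lambda>n. rep (Z n) (ind y) x) \<longlonglongrightarrow> l" shows "coef x y (cls Z) = l"
  using LIMSEQ_unique[OF coef_cls[OF assms(1,2)] assms(3)] .

lemma coef_const: "y \<in> X \<Longrightarrow> coef x y (const_cls a) = rep a (ind y) x"
  by (rule coef_eqI) auto

lemma coef_add:
  assumes "y \<in> X" "a \<in> carrier \<O>" "b \<in> carrier \<O>" shows "coef x y (a \<oplus>\<^bsub>\<O>\<^esub> b) = coef x y a + coef x y b"
proof -
  obtain Y where Y: "Y \<in> cauchy_seqs N" "a = cls Y" using assms(2) by (rule alg_cases)
  obtain Z where Z: "Z \<in> cauchy_seqs N" "b = cls Z" using assms(3) by (rule alg_cases)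
  show ?thesis unfolding Y(2) Z(2) alg_cls(2)[OF Y(1) Z(1)]
    by (rule coef_eqI[OF assms(1) cauchy_add[OF Y(1) Z(1)]])
       (unfold rep_add, intro tendsto_add coef_cls assms(1) Y(1) Z(1))
qed

lemma coef_smult:
  assumes "y \<in> X" "a \<in> carrier \<O>" shows "coef x y (c \<odot>\<^bsub>\<O>\<^esub> a) = c * coef x y a"
proof -
  obtain Y where Y: "Y \<in> cauchy_seqs N" "a = cls Y" using assms(2) by (rule alg_cases)
  show ?thesis unfolding Y(2) alg_cls(4)[OF Y(1)]
    by (rule coef_eqI[OF assms(1) cauchy_scale[OF Y(1)]])
       (unfold rep_scale, intro tendsto_mult_left coef_cls assms(1) Y(1))
qed

lemma coef_minus:
  assumes "y \<in> X" "a \<in> carrier \<O>" "b \<in> carrier \<O>" shows "coef x y (a \<ominus>\<^bsub>\<O>\<^esub> b) = coef x y a - coef x y b"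
proof -
  have "a \<ominus>\<^bsub>\<O>\<^esub> b = a \<oplus>\<^bsub>\<O>\<^esub> (- 1) \<odot>\<^bsub>\<O>\<^esub> b" using assms by (simp add: a_minus_def alg.smult_minus1)
  then show ?thesis using assms by (simp add: coef_add coef_smult)
qed

lemma coef_star:
  assumes "x \<in> X" "y \<in> X" "a \<in> carrier \<O>" shows "coef x y (star \<O> a) = cnj (coef y x a)"
proof -
  obtain Y where Y: "Y \<in> cauchy_seqs N" "a = cls Y" using assms(3) by (rule alg_cases)
  have "(\<lambda>n. rep (free_star (Y n)) (ind y) x) \<longlonglongrightarrow> cnj (coef y x (cls Y))"
    unfolding rep_star_ind[OF assms(2,1)] by (intro tendsto_cnj coef_cls assms(1) Y(1))
  then show ?thesis unfolding Y(2) alg_cls(5)[OF Y(1)]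
    by (intro coef_eqI assms(2) cauchy_star Y(1))
qed

lemma coef_norm:
  assumes "y \<in> X" "a \<in> carrier \<O>" shows "cmod (coef x y a) \<le> alg_norm \<O> a"
proof -
  obtain Y where Y: "Y \<in> cauchy_seqs N" "a = cls Y" using assms(2) by (rule alg_cases)
  show ?thesis unfolding Y(2)
    by (rule LIMSEQ_le[OF tendsto_norm[OF coef_cls[OF assms(1) Y(1)]] alg_norm_cls[OF Y(1)]])
       (use coefficient_bounded[OF assms(1)] in blast)
qed

lemma coef_converges:
  assumes y: "y \<in> X" and f: "alg.converges f l" shows "(\<lambda>n. coef x y (f n)) \<longlonglongrightarrow> coef x y l"
proof -
  note c = f[unfolded alg.converges_def]
  have "(\<lambda>n. coef x y (f n) - coef x y l) \<longlonglongrightarrow> 0"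
  proof (rule Lim_null_comparison[OF always_eventually])
    show "(\<lambda>n. alg_norm \<O> (f n \<ominus>\<^bsub>\<O>\<^esub> l)) \<longlonglongrightarrow> 0" using c by blast
    show "\<forall>n. norm (coef x y (f n) - coef x y l) \<le> alg_norm \<O> (f n \<ominus>\<^bsub>\<O>\<^esub> l)"
    proof
      fix n
      have "f n \<in> carrier \<O>" "l \<in> carrier \<O>" using c by blast+
      then show "norm (coef x y (f n) - coef x y l) \<le> alg_norm \<O> (f n \<ominus>\<^bsub>\<O>\<^esub> l)"
        using coef_norm[OF y, of "f n \<ominus>\<^bsub>\<O>\<^esub> l" x] by (simp add: coef_minus[OF y])
    qed
  qed
  then show ?thesis by (simp add: LIM_zero_iff)
qed

lemma coef_one: "x \<in> X \<Longrightarrow> y \<in> X \<Longrightarrow> coef x y \<one>\<^bsub>\<O>\<^esub> = (if x = y then 1 else 0)"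
  by (simp add: alg_cls coef_const rep_one ind_def)

lemma coef_zero: "y \<in> X \<Longrightarrow> coef x y \<zero>\<^bsub>\<O>\<^esub> = 0"
  by (simp add: alg_cls coef_const)

lemma coef_left:
  assumes x: "x \<in> X" and y: "y \<in> X" and a: "a \<in> carrier \<O>"
  shows "coef x y (const_cls f \<otimes>\<^bsub>\<O>\<^esub> a) = (\<Sum>w\<in>Poly_Mapping.keys f. Poly_Mapping.lookup f w *
    (case word_pull (letters w) x of None \<Rightarrow> 0 | Some x' \<Rightarrow> coef x' y a))"
proof -
  obtain Z where Z: "Z \<in> cauchy_seqs N" "a = cls Z" using a by (rule alg_cases)
  show ?thesis unfolding Z(2) alg_cls(3)[OF cauchy_const Z(1)]
  proof (rule coef_eqI[OF y cauchy_mult[OF cauchy_const Z(1)]])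
    have "(\<lambda>n. case word_pull (letters w) x of None \<Rightarrow> 0 | Some x' \<Rightarrow> rep (Z n) (ind y) x')
        \<longlonglongrightarrow> (case word_pull (letters w) x of None \<Rightarrow> 0 | Some x' \<Rightarrow> coef x' y (cls Z))" for w
      by (cases "word_pull (letters w) x") (auto intro: coef_cls y Z(1))
    then show "(\<lambda>n. rep (f * Z n) (ind y) x) \<longlonglongrightarrow> (\<Sum>w\<in>Poly_Mapping.keys f. Poly_Mapping.lookup f w *
        (case word_pull (letters w) x of None \<Rightarrow> 0 | Some x' \<Rightarrow> coef x' y (cls Z)))"
      unfolding rep_mult rep_def[of f] using x by (auto intro!: tendsto_sum tendsto_mult_left)
  qed
qed

lemma rep_vector_sum: "rep a (\<lambda>z. \<Sum>j\<in>J. v j z) x = (\<Sum>j\<in>J. rep a (v j) x)"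
proof (induction J rule: infinite_finite_induct)
  case (insert j J)
  then show ?case by (simp add: rep_vector_add)
qed (use rep_vector_scale[of a 0 "\<lambda>_. 0" x] in simp_all)

lemma coef_right:
  assumes x: "x \<in> X" and y: "y \<in> X" and a: "a \<in> carrier \<O>"
  shows "coef x y (a \<otimes>\<^bsub>\<O>\<^esub> const_cls f) = (\<Sum>w\<in>Poly_Mapping.keys f. Poly_Mapping.lookup f w *
    (case word_pull (letters (word_star w)) y of None \<Rightarrow> 0 | Some y' \<Rightarrow> coef x y' a))"
proof -
  obtain Z where Z: "Z \<in> cauchy_seqs N" "a = cls Z" using a by (rule alg_cases)
  let ?t = "\<lambda>w g. Poly_Mapping.lookup f w * (case word_pull (letters (word_star w)) y of None \<Rightarrow> 0 | Some y' \<Rightarrow> g y')"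
  have rep: "rep (b * f) (ind y) x = (\<Sum>w\<in>Poly_Mapping.keys f. ?t w (\<lambda>y'. rep b (ind y') x))" for b
  proof -
    have "rep b (rep f (ind y)) x = rep b (\<lambda>z. \<Sum>w\<in>Poly_Mapping.keys f. ?t w (\<lambda>y'. ind y' z)) x"
    proof (rule rep_cong)
      fix z assume z: "z \<in> X"
      show "rep f (ind y) z = (\<Sum>w\<in>Poly_Mapping.keys f. ?t w (\<lambda>y'. ind y' z))"
      proof -
        have "(case q of None \<Rightarrow> 0 | Some y' \<Rightarrow> ind y y') = (if q = Some y then 1 else 0)"
          "(case q of None \<Rightarrow> 0 | Some y' \<Rightarrow> ind y' z) = (if q = Some z then 1 else 0)" for q
          by (auto simp: ind_def split: option.split)
        then show ?thesis unfolding rep_def using z word_pull_star_iff[OF z y] by simp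
      qed
    qed
    also have "\<dots> = (\<Sum>w\<in>Poly_Mapping.keys f. rep b (\<lambda>z. ?t w (\<lambda>y'. ind y' z)) x)"
      by (rule rep_vector_sum)
    also have "\<dots> = (\<Sum>w\<in>Poly_Mapping.keys f. ?t w (\<lambda>y'. rep b (ind y') x))"
    proof (intro sum.cong refl)
      fix w
      show "rep b (\<lambda>z. ?t w (\<lambda>y'. ind y' z)) x = ?t w (\<lambda>y'. rep b (ind y') x)"
        using rep_vector_scale[of b 0 "\<lambda>_. 0" x]
        by (cases "word_pull (letters (word_star w)) y") (simp_all add: rep_vector_scale)
    qed
    finally show ?thesis by (simp add: rep_mult)
  qed
  show ?thesis unfolding Z(2) alg_cls(3)[OF Z(1) cauchy_const]
  proof (rule coef_eqI[OF y cauchy_mult[OF Z(1) cauchy_const]])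
    have "(\<lambda>n. case word_pull (letters (word_star w)) y of None \<Rightarrow> 0 | Some y' \<Rightarrow> rep (Z n) (ind y') x)
        \<longlonglongrightarrow> (case word_pull (letters (word_star w)) y of None \<Rightarrow> 0 | Some y' \<Rightarrow> coef x y' (cls Z))" for w
      using word_pull_star(1)[OF y] by (cases "word_pull (letters (word_star w)) y") (auto intro: coef_cls Z(1))
    then show "(\<lambda>n. rep (Z n * f) (ind y) x) \<longlonglongrightarrow> (\<Sum>w\<in>Poly_Mapping.keys f. ?t w (\<lambda>y'. coef x y' (cls Z)))"
      unfolding rep by (intro tendsto_sum tendsto_mult_left)
  qed
qed

lemma coef_left_scalar:
  assumes y: "y \<in> X" and a: "a \<in> carrier \<O>" and f: "\<And>v. rep f v x = c * v x"
  shows "coef x y (const_cls f \<otimes>\<^bsub>\<O>\<^esub> a) = c * coef x y a"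
proof -
  obtain Z where Z: "Z \<in> cauchy_seqs N" "a = cls Z" using a by (rule alg_cases)
  show ?thesis unfolding Z(2) alg_cls(3)[OF cauchy_const Z(1)]
    by (rule coef_eqI[OF y cauchy_mult[OF cauchy_const Z(1)]])
       (unfold rep_mult f, intro tendsto_mult_left coef_cls y Z(1))
qed

subsection \<open>The diagonal acts diagonally\<close>

abbreviation pproj :: "'i list \<Rightarrow> 'i ck_element" where
  "pproj \<mu> \<equiv> const_cls (path_projection \<mu>)"

lemma coef_pproj: "x \<in> X \<Longrightarrow> coef x x (pproj \<mu>) = (if point_prefix x (length \<mu>) = \<mu> then 1 else 0)"
  by (simp add: coef_const rep_path_projection ind_def)

lemma star_pproj: "star \<O> (pproj \<mu>) = pproj \<mu>"
  by (simp add: alg_cls path_projection_def free_star_mult)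

lemma path_projection_sum: "(\<Sum>i\<in>UNIV. path_projection (\<nu> @ [i])) \<simeq> path_projection \<nu>"
proof (rule homogeneous_eqvI)
  show "homogeneous 0 (\<Sum>i\<in>UNIV. path_projection (\<nu> @ [i]))" "homogeneous 0 (path_projection \<nu>)"
    by (intro homogeneous_sum homogeneous_path_projection)+
  fix v x assume x: "x \<in> X"
  have "point_prefix x (Suc n) = point_prefix x n @ [x n]" for n by (simp add: point_prefix_def)
  then have "point_prefix x (length (\<nu> @ [i])) = \<nu> @ [i] \<longleftrightarrow> i = x (length \<nu>) \<and> point_prefix x (length \<nu>) = \<nu>" for i
    by auto
  then have "rep (\<Sum>i\<in>UNIV. path_projection (\<nu> @ [i])) v x =
      (\<Sum>i\<in>UNIV. if i = x (length \<nu>) then (if point_prefix x (length \<nu>) = \<nu> then v x else 0) else 0)"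
    unfolding rep_sum by (intro sum.cong refl) (simp only: rep_path_projection[OF x] if_if_eq_conj simp_thms split: if_split)
  then show "rep (\<Sum>i\<in>UNIV. path_projection (\<nu> @ [i])) v x = rep (path_projection \<nu>) v x"
    by (simp add: rep_path_projection[OF x])
qed

lemma pproj_diagonal: "pproj \<mu> \<in> \<D>"
proof (cases "\<mu> = []")
  case True
  have "pproj \<mu> = const_cls (\<Sum>i\<in>UNIV. path_projection (\<mu> @ [i]))"
    by (rule const_cls_eqI[OF eqv_sym[OF path_projection_sum]])
  also have "\<dots> \<in> \<D>" by (intro diagonal_sum path_projection_diagonal) auto
  finally show ?thesis .
qed (rule path_projection_diagonal)

lemma one_diagonal: "\<one>\<^bsub>\<O>\<^esub> \<in> \<D>"
  using pproj_diagonal[of "[]"] by (simp add: path_projection_def alg_cls)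

lemma diagonal_left:
  assumes d: "d \<in> \<D>" and a: "a \<in> carrier \<O>" and xy: "x \<in> X" "y \<in> X"
  shows "coef x y (d \<otimes>\<^bsub>\<O>\<^esub> a) = coef x x d * coef x y a"
proof -
  define L where "L d \<longleftrightarrow> (\<forall>a\<in>carrier \<O>. \<forall>x\<in>X. \<forall>y\<in>X. coef x y (d \<otimes>\<^bsub>\<O>\<^esub> a) = coef x x d * coef x y a)" for d
  have L: "coef x y (d \<otimes>\<^bsub>\<O>\<^esub> a) = coef x x d * coef x y a" if "L d" "a \<in> carrier \<O>" "x \<in> X" "y \<in> X" for d a x y
    using that by (simp add: L_def)
  have L_add: "L (d \<oplus>\<^bsub>\<O>\<^esub> e)" if "L d" "L e" "d \<in> carrier \<O>" "e \<in> carrier \<O>" for d e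
    unfolding L_def using that by (simp add: alg.l_distr coef_add L distrib_right)
  have L_scale: "L (c \<odot>\<^bsub>\<O>\<^esub> d)" if "L d" "d \<in> carrier \<O>" for c d
    unfolding L_def using that by (simp add: alg.smult_mult_l coef_smult L)
  have L_mult: "L (d \<otimes>\<^bsub>\<O>\<^esub> e)" if "L d" "L e" "d \<in> carrier \<O>" "e \<in> carrier \<O>" for d e
    unfolding L_def using that by (simp add: alg.m_assoc L)
  have L_lim: "L l" if f: "\<And>n. L (f n)" "alg.converges f l" for f l
    unfolding L_def
  proof (intro ballI)
    fix a x y assume a: "a \<in> carrier \<O>" "x \<in> X" "y \<in> X"
    have fC: "f n \<in> carrier \<O>" for n using f(2) by (simp add: alg.converges_def)
    have "(\<lambda>n. coef x y (f n \<otimes>\<^bsub>\<O>\<^esub> a)) \<longlonglongrightarrow> coef x y (l \<otimes>\<^bsub>\<O>\<^esub> a)"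
      by (intro coef_converges a alg.converges_mult f(2) alg.converges_const)
    moreover have "(\<lambda>n. coef x y (f n \<otimes>\<^bsub>\<O>\<^esub> a)) \<longlonglongrightarrow> coef x x l * coef x y a"
      unfolding L[OF f(1) a] by (intro tendsto_mult_right coef_converges a f(2))
    ultimately show "coef x y (l \<otimes>\<^bsub>\<O>\<^esub> a) = coef x x l * coef x y a" by (rule LIMSEQ_unique)
  qed
  have L_pproj: "L (pproj \<mu>)" for \<mu>
    unfolding L_def
  proof (intro ballI)
    fix a x y assume a: "a \<in> carrier \<O>" "x \<in> X" "y \<in> X"
    show "coef x y (pproj \<mu> \<otimes>\<^bsub>\<O>\<^esub> a) = coef x x (pproj \<mu>) * coef x y a"
      by (rule coef_left_scalar[OF a(3,1)]) (simp add: rep_path_projection[OF a(2)] coef_pproj[OF a(2)])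
  qed
  have "\<D> \<subseteq> {d \<in> carrier \<O>. L d \<and> L (star \<O> d)}"
  proof (rule diagonal_minimal)
    show "cstar_subalgebra {d \<in> carrier \<O>. L d \<and> L (star \<O> d)} \<O>"
    proof (rule cstar_subalgebraI)
      show "\<zero>\<^bsub>\<O>\<^esub> \<in> {d \<in> carrier \<O>. L d \<and> L (star \<O> d)}" by (simp add: L_def coef_zero)
      fix f l assume f: "\<And>n::nat. f n \<in> {d \<in> carrier \<O>. L d \<and> L (star \<O> d)}" "l \<in> carrier \<O>"
        "(\<lambda>n. alg_norm \<O> (f n \<ominus>\<^bsub>\<O>\<^esub> l)) \<longlonglongrightarrow> 0"
      then have c: "alg.converges f l" by (simp add: alg.converges_def)
      show "l \<in> {d \<in> carrier \<O>. L d \<and> L (star \<O> d)}"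
        using L_lim[OF _ c] L_lim[OF _ alg.converges_star[OF c]] f(1,2) by simp
    qed (auto simp: alg.star_add alg.star_smult alg.star_mult intro: L_add L_scale L_mult)
  qed (simp add: star_pproj L_pproj)
  then show ?thesis using d L[OF _ a xy] by blast
qed

lemma diagonal_star: "d \<in> \<D> \<Longrightarrow> star \<O> d \<in> \<D>"
  by (rule cstar_subalgebraD(6)[OF diagonal_subalgebra])

lemma diagonal_right:
  assumes d: "d \<in> \<D>" and a: "a \<in> carrier \<O>" and xy: "x \<in> X" "y \<in> X"
  shows "coef x y (a \<otimes>\<^bsub>\<O>\<^esub> d) = coef x y a * coef y y d"
proof -
  have dc: "d \<in> carrier \<O>" by (rule diagonal_carrier[OF d])
  have "coef y x (star \<O> (a \<otimes>\<^bsub>\<O>\<^esub> d)) = coef y y (star \<O> d) * coef y x (star \<O> a)"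
    using diagonal_left[OF diagonal_star[OF d] alg.star_closed[OF a] xy(2,1)] a dc by (simp add: alg.star_mult)
  then have "cnj (coef x y (a \<otimes>\<^bsub>\<O>\<^esub> d)) = cnj (coef x y a * coef y y d)"
    using a dc xy by (simp add: coef_star mult.commute)
  then show ?thesis by (simp only: complex_cnj_cancel_iff)
qed

lemma diagonal_mult_coef:
  assumes "d \<in> \<D>" "e \<in> \<D>" "x \<in> X" shows "coef x x (d \<otimes>\<^bsub>\<O>\<^esub> e) = coef x x d * coef x x e"
  using diagonal_left[OF assms(1) diagonal_carrier[OF assms(2)] assms(3,3)] .

lemma diagonal_separates:
  assumes "x \<in> X" "y \<in> X" "\<And>d. d \<in> \<D> \<Longrightarrow> coef x x d = coef y y d" shows "x = y"
proof
  fix n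
  have "coef y y (pproj (point_prefix x (Suc n))) = 1"
    using assms(3)[OF pproj_diagonal[of "point_prefix x (Suc n)"]] by (simp add: coef_pproj assms)
  then have "point_prefix y (Suc n) = point_prefix x (Suc n)" using assms(2) by (simp add: coef_pproj split: if_splits)
  then show "x n = y n" by (simp add: point_prefix_eq_iff)
qed

text \<open>The function \<open>x \<mapsto> coef x x d\<close> of an element \<open>d\<close> of the diagonal is uniformly continuous; this holds
  for path projections and passes to the closed subalgebra that they generate.\<close>

lemma diagonal_coef_continuous:
  assumes d: "d \<in> \<D>" and e: "0 < (e::real)"
  obtains m where "\<And>x y. x \<in> X \<Longrightarrow> y \<in> X \<Longrightarrow> \<forall>l<m. x l = y l \<Longrightarrow> cmod (coef x x d - coef y y d) < e"
proof -
  define C where "C d \<longleftrightarrow> (\<forall>e>0. \<exists>m. \<forall>x\<in>X. \<forall>y\<in>X. (\<forall>l<m. x l = y l) \<longrightarrow> cmod (coef x x d - coef y y d) < e)" for d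
  have CI: "C d" if "\<And>e. e > 0 \<Longrightarrow> \<exists>m. \<forall>x\<in>X. \<forall>y\<in>X. (\<forall>l<m. x l = y l) \<longrightarrow> cmod (coef x x d - coef y y d) < e" for d
    using that by (simp add: C_def)
  have CD: "\<exists>m. \<forall>x\<in>X. \<forall>y\<in>X. (\<forall>l<m. x l = y l) \<longrightarrow> cmod (coef x x d - coef y y d) < e" if "C d" "e > 0" for d e
    using that by (simp add: C_def)
  \<comment> \<open>closure under combinations with a Lipschitz estimate\<close>
  have C2: "C f" if Cd: "C d" "C d'" and K: "K > 0" and
    le: "\<And>x y. x \<in> X \<Longrightarrow> y \<in> X \<Longrightarrow> cmod (coef x x f - coef y y f) \<le>
      K * (cmod (coef x x d - coef y y d) + cmod (coef x x d' - coef y y d'))" for f d d' K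
  proof (rule CI)
    fix e :: real assume e: "e > 0"
    obtain m where m: "\<forall>x\<in>X. \<forall>y\<in>X. (\<forall>l<m. x l = y l) \<longrightarrow> cmod (coef x x d - coef y y d) < e / (2 * K)"
      using CD[OF Cd(1), of "e / (2 * K)"] e K by auto
    obtain m' where m': "\<forall>x\<in>X. \<forall>y\<in>X. (\<forall>l<m'. x l = y l) \<longrightarrow> cmod (coef x x d' - coef y y d') < e / (2 * K)"
      using CD[OF Cd(2), of "e / (2 * K)"] e K by auto
    have "cmod (coef x x f - coef y y f) < e" if xy: "x \<in> X" "y \<in> X" "\<forall>l<max m m'. x l = y l" for x y
    proof -
      have 1: "cmod (coef x x d - coef y y d) < e / (2 * K)" by (rule m[rule_format]) (use xy in simp_all)
      have 2: "cmod (coef x x d' - coef y y d') < e / (2 * K)" by (rule m'[rule_format]) (use xy in simp_all)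
      have "cmod (coef x x f - coef y y f) \<le> K * (cmod (coef x x d - coef y y d) + cmod (coef x x d' - coef y y d'))"
        by (rule le[OF xy(1,2)])
      also have "\<dots> < K * (e / (2 * K) + e / (2 * K))" using 1 2 K by (intro mult_strict_left_mono add_strict_mono)
      also have "\<dots> = e" using K by (simp add: field_simps)
      finally show ?thesis .
    qed
    then show "\<exists>m. \<forall>x\<in>X. \<forall>y\<in>X. (\<forall>l<m. x l = y l) \<longrightarrow> cmod (coef x x f - coef y y f) < e" by blast
  qed
  have "\<D> \<subseteq> {d \<in> \<D>. C d}"
  proof (rule diagonal_minimal)
    note D = cstar_subalgebraD[OF diagonal_subalgebra]
    show "cstar_subalgebra {d \<in> \<D>. C d} \<O>"
    proof (rule cstar_subalgebraI)
      show "{d \<in> \<D>. C d} \<subseteq> carrier \<O>" using diagonal_carrier by blast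
      have "C \<zero>\<^bsub>\<O>\<^esub>" by (rule CI) (auto simp: coef_zero)
      then show "\<zero>\<^bsub>\<O>\<^esub> \<in> {d \<in> \<D>. C d}" using D(2) by simp
    next
      fix d d' assume "d \<in> {d \<in> \<D>. C d}" "d' \<in> {d \<in> \<D>. C d}"
      then have dd: "d \<in> \<D>" "d' \<in> \<D>" "C d" "C d'" by auto
      have "C (d \<oplus>\<^bsub>\<O>\<^esub> d')"
      proof (rule C2[OF dd(3,4) zero_less_one])
        fix x y assume xy: "x \<in> X" "y \<in> X"
        have "coef x x (d \<oplus>\<^bsub>\<O>\<^esub> d') - coef y y (d \<oplus>\<^bsub>\<O>\<^esub> d') = (coef x x d - coef y y d) + (coef x x d' - coef y y d')"
          using xy dd diagonal_carrier by (simp add: coef_add)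
        then show "cmod (coef x x (d \<oplus>\<^bsub>\<O>\<^esub> d') - coef y y (d \<oplus>\<^bsub>\<O>\<^esub> d'))
          \<le> 1 * (cmod (coef x x d - coef y y d) + cmod (coef x x d' - coef y y d'))"
          by (simp add: norm_triangle_ineq)
      qed
      then show "d \<oplus>\<^bsub>\<O>\<^esub> d' \<in> {d \<in> \<D>. C d}" using D(3) dd by simp
      let ?K = "1 + alg_norm \<O> d + alg_norm \<O> d'"
      have nn: "alg_norm \<O> d \<ge> 0" "alg_norm \<O> d' \<ge> 0" using dd diagonal_carrier by (auto intro: alg.norm_nonneg)
      have "C (d \<otimes>\<^bsub>\<O>\<^esub> d')"
      proof (rule C2[OF dd(3,4), of ?K])
        fix x y assume xy: "x \<in> X" "y \<in> X"
        let ?u = "coef x x d" and ?u' = "coef x x d'" and ?w = "coef y y d" and ?w' = "coef y y d'"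
        have "coef x x (d \<otimes>\<^bsub>\<O>\<^esub> d') - coef y y (d \<otimes>\<^bsub>\<O>\<^esub> d') = ?u * (?u' - ?w') + (?u - ?w) * ?w'"
          using xy dd by (simp add: diagonal_mult_coef algebra_simps)
        then have "cmod (coef x x (d \<otimes>\<^bsub>\<O>\<^esub> d') - coef y y (d \<otimes>\<^bsub>\<O>\<^esub> d')) \<le>
            cmod ?u * cmod (?u' - ?w') + cmod (?u - ?w) * cmod ?w'"
          using norm_triangle_ineq[of "?u * (?u' - ?w')" "(?u - ?w) * ?w'"] by (simp add: norm_mult)
        also have "\<dots> \<le> ?K * cmod (?u' - ?w') + cmod (?u - ?w) * ?K"
        proof (intro add_mono mult_right_mono mult_left_mono)
          show "cmod ?u \<le> ?K" using coef_norm[OF xy(1) diagonal_carrier[OF dd(1)], of x] nn by linarith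
          show "cmod ?w' \<le> ?K" using coef_norm[OF xy(2) diagonal_carrier[OF dd(2)], of y] nn by linarith
        qed auto
        finally show "cmod (coef x x (d \<otimes>\<^bsub>\<O>\<^esub> d') - coef y y (d \<otimes>\<^bsub>\<O>\<^esub> d')) \<le> ?K * (cmod (?u - ?w) + cmod (?u' - ?w'))"
          by (simp add: algebra_simps)
      qed (use nn in linarith)
      then show "d \<otimes>\<^bsub>\<O>\<^esub> d' \<in> {d \<in> \<D>. C d}" using D(5) dd by simp
    next
      fix c d assume "d \<in> {d \<in> \<D>. C d}"
      then have dd: "d \<in> \<D>" "C d" by auto
      have "C (c \<odot>\<^bsub>\<O>\<^esub> d)"
      proof (rule C2[OF dd(2,2), of "1 + cmod c"])
        fix x y assume xy: "x \<in> X" "y \<in> X"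
        have "coef x x (c \<odot>\<^bsub>\<O>\<^esub> d) - coef y y (c \<odot>\<^bsub>\<O>\<^esub> d) = c * (coef x x d - coef y y d)"
          using xy dd diagonal_carrier by (simp add: coef_smult algebra_simps)
        then have "cmod (coef x x (c \<odot>\<^bsub>\<O>\<^esub> d) - coef y y (c \<odot>\<^bsub>\<O>\<^esub> d)) = cmod c * cmod (coef x x d - coef y y d)"
          by (simp add: norm_mult)
        also have "\<dots> \<le> (1 + cmod c) * (cmod (coef x x d - coef y y d) + cmod (coef x x d - coef y y d))"
          by (intro mult_mono) auto
        finally show "cmod (coef x x (c \<odot>\<^bsub>\<O>\<^esub> d) - coef y y (c \<odot>\<^bsub>\<O>\<^esub> d)) \<le>
           (1 + cmod c) * (cmod (coef x x d - coef y y d) + cmod (coef x x d - coef y y d))" .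
      qed (simp add: add_pos_nonneg)
      then show "c \<odot>\<^bsub>\<O>\<^esub> d \<in> {d \<in> \<D>. C d}" using D(4) dd by simp
    next
      fix d assume "d \<in> {d \<in> \<D>. C d}"
      then have dd: "d \<in> \<D>" "C d" by auto
      have "C (star \<O> d)"
      proof (rule C2[OF dd(2,2) zero_less_one])
        fix x y assume xy: "x \<in> X" "y \<in> X"
        have "coef x x (star \<O> d) - coef y y (star \<O> d) = cnj (coef x x d - coef y y d)"
          using xy dd diagonal_carrier by (simp add: coef_star)
        then have "cmod (coef x x (star \<O> d) - coef y y (star \<O> d)) = cmod (coef x x d - coef y y d)"
          by (simp only: complex_mod_cnj)
        then show "cmod (coef x x (star \<O> d) - coef y y (star \<O> d)) \<le>
           1 * (cmod (coef x x d - coef y y d) + cmod (coef x x d - coef y y d))" by simp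
      qed
      then show "star \<O> d \<in> {d \<in> \<D>. C d}" using D(6) dd by simp
    next
      fix f l assume f: "\<And>n::nat. f n \<in> {d \<in> \<D>. C d}" and l: "l \<in> carrier \<O>"
        and lim: "(\<lambda>n. alg_norm \<O> (f n \<ominus>\<^bsub>\<O>\<^esub> l)) \<longlonglongrightarrow> 0"
      have fD: "f n \<in> \<D>" "C (f n)" for n using f by auto
      have "C l"
      proof (rule CI)
        fix e :: real assume e: "e > 0"
        obtain n where n: "alg_norm \<O> (f n \<ominus>\<^bsub>\<O>\<^esub> l) < e / 3"
          using order_tendstoD(2)[OF lim, of "e / 3"] e by (auto simp: eventually_sequentially)
        have close: "cmod (coef x x (f n) - coef x x l) < e / 3" if "x \<in> X" for x
          using coef_norm[OF that, of "f n \<ominus>\<^bsub>\<O>\<^esub> l" x] diagonal_carrier[OF fD(1)] l n that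
          by (simp add: coef_minus)
        obtain m where m: "\<forall>x\<in>X. \<forall>y\<in>X. (\<forall>l<m. x l = y l) \<longrightarrow> cmod (coef x x (f n) - coef y y (f n)) < e / 3"
          using CD[OF fD(2), of "e / 3" n] e by auto
        have "cmod (coef x x l - coef y y l) < e" if xy: "x \<in> X" "y \<in> X" "\<forall>l<m. x l = y l" for x y
        proof -
          have "cmod (coef x x (f n) - coef y y (f n)) < e / 3" by (rule m[rule_format]) (use xy in simp_all)
          then show ?thesis using close[OF xy(1)] close[OF xy(2)]
            norm_triangle_ineq4[of "coef y y (f n) - coef y y l" "coef x x (f n) - coef x x l"]
            norm_triangle_ineq[of "(coef y y (f n) - coef y y l) - (coef x x (f n) - coef x x l)" "coef x x (f n) - coef y y (f n)"]
            by simp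
        qed
        then show "\<exists>m. \<forall>x\<in>X. \<forall>y\<in>X. (\<forall>l<m. x l = y l) \<longrightarrow> cmod (coef x x l - coef y y l) < e" by blast
      qed
      then show "l \<in> {d \<in> \<D>. C d}" using D(7)[OF fD(1) l lim] by simp
    qed
    fix \<mu> :: "'i list"
    have "C (pproj \<mu>)"
    proof (rule CI)
      fix e :: real assume e: "e > 0"
      have "cmod (coef x x (pproj \<mu>) - coef y y (pproj \<mu>)) < e"
        if xy: "x \<in> X" "y \<in> X" "\<forall>l<length \<mu>. x l = y l" for x y
      proof -
        have "point_prefix x (length \<mu>) = point_prefix y (length \<mu>)" using xy(3) by (simp only: point_prefix_eq_iff)
        then show ?thesis using e by (simp add: coef_pproj xy(1,2))
      qed
      then show "\<exists>m. \<forall>x\<in>X. \<forall>y\<in>X. (\<forall>l<m. x l = y l) \<longrightarrow> cmod (coef x x (pproj \<mu>) - coef y y (pproj \<mu>)) < e" by blast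
    qed
    then show "pproj \<mu> \<in> {d \<in> \<D>. C d}" using pproj_diagonal by simp
  qed
  then have "C d" using d by blast
  from CD[OF this e] obtain m where "\<forall>x\<in>X. \<forall>y\<in>X. (\<forall>l<m. x l = y l) \<longrightarrow> cmod (coef x x d - coef y y d) < e" ..
  then show ?thesis by (intro that[of m]) simp
qed

end

section \<open>Elements of degree one\<close>

text \<open>The mean of \<open>f\<close> and its image under a gauge automorphism, rotated back in degree one. In degree
  \<open>d\<close> the second term is \<open>z\<close> to the power \<open>d - 1\<close> times the first, and \<open>z\<close> is chosen such that this
  power is \<open>- 1\<close>. So degree \<open>d\<close> is removed, and degree one is kept; only \<open>d\<close> different from 1 is meant.\<close>

definition remove_degree :: "int \<Rightarrow> 'i free_algebra \<Rightarrow> 'i free_algebra" where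
  "remove_degree d f = (let z = cis (pi / of_int (d - 1)) in
     free_scale (1 / 2) (f + free_scale (inverse z) (free_gauge z f)))"

lemma lookup_remove_degree:
  assumes "d \<noteq> 1"
  shows "word_degree w = 1 \<Longrightarrow> Poly_Mapping.lookup (remove_degree d f) w = Poly_Mapping.lookup f w"
    and "word_degree w = d \<Longrightarrow> Poly_Mapping.lookup (remove_degree d f) w = 0"
    and "Poly_Mapping.lookup f w = 0 \<Longrightarrow> Poly_Mapping.lookup (remove_degree d f) w = 0"
proof -
  define z where "z = cis (pi / of_int (d - 1))"
  have z0: "z \<noteq> 0" by (simp add: z_def)
  have 1: "Poly_Mapping.lookup (remove_degree d f) w =
      (1 + inverse z * z powi word_degree w) / 2 * Poly_Mapping.lookup f w" for w
    unfolding remove_degree_def Let_def z_def[symmetric]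
    by (simp add: lookup_free_scale lookup_add free_gauge_lookup algebra_simps add_divide_distrib)
  have "z powi (d - 1) = cis (of_int (d - 1) * (pi / of_int (d - 1)))"
    unfolding z_def by (rule cis_power_int)
  also have "of_int (d - 1) * (pi / of_int (d - 1)) = pi" using assms by simp
  finally have "z powi (d - 1) = - 1" by simp
  then have m: "inverse z * z powi d = - 1"
    using z0 by (simp add: power_int_diff divide_inverse mult.commute)
  show "word_degree w = 1 \<Longrightarrow> Poly_Mapping.lookup (remove_degree d f) w = Poly_Mapping.lookup f w"
    "Poly_Mapping.lookup f w = 0 \<Longrightarrow> Poly_Mapping.lookup (remove_degree d f) w = 0"
    using z0 by (simp_all add: 1)
  assume "word_degree w = d"
  then show "Poly_Mapping.lookup (remove_degree d f) w = 0" using m by (simp add: 1)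
qed

context markov_shift
begin

lemma remove_degree_norm:
  assumes n: "n \<in> carrier \<O>" and g: "\<And>z. cmod z = 1 \<Longrightarrow> gauge_action A z n = z \<odot>\<^bsub>\<O>\<^esub> n"
  shows "alg_norm \<O> (n \<ominus>\<^bsub>\<O>\<^esub> const_cls (remove_degree d f)) \<le> alg_norm \<O> (n \<ominus>\<^bsub>\<O>\<^esub> const_cls f)"
proof -
  obtain Z where Z: "Z \<in> cauchy_seqs N" "n = cls Z" using n by (rule alg_cases)
  define z where "z = cis (pi / of_int (d - 1))"
  have z: "cmod z = 1" "z \<noteq> 0" by (simp_all add: z_def)
  have gZ: "(\<lambda>m. free_gauge z (Z m)) \<in> cauchy_seqs N" "(\<lambda>m. free_scale z (Z m)) \<in> cauchy_seqs N"
    using gauge_cls(2)[OF z(1) Z(1)] cauchy_scale[OF Z(1)] by auto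
  have "cls (\<lambda>m. free_gauge z (Z m)) = cls (\<lambda>m. free_scale z (Z m))"
    using g[OF z(1)] unfolding Z(2) gauge_cls(1)[OF z(1) Z(1)] alg_cls(4)[OF Z(1)] .
  then have null: "(\<lambda>m. N (free_gauge z (Z m) - free_scale z (Z m))) \<longlonglongrightarrow> 0"
    using cls_eq_iff[OF gZ] by simp
  have lim: "(\<lambda>m. N (Z m - f')) \<longlonglongrightarrow> alg_norm \<O> (n \<ominus>\<^bsub>\<O>\<^esub> const_cls f')" for f'
    unfolding Z(2) alg_cls(8)[OF Z(1) cauchy_const] by (rule alg_norm_cls[OF cauchy_minus[OF Z(1) cauchy_const]])
  have "N (Z m - remove_degree d f) \<le> N (Z m - f) + 1 / 2 * N (free_gauge z (Z m) - free_scale z (Z m))" for m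
  proof -
    let ?u = "Z m - f" and ?v = "free_gauge z (Z m) - free_scale z (Z m)"
    have half: "free_scale (1 / 2) x + free_scale (1 / 2) x = x" for x :: "'i free_algebra"
      using free_scale_simps(3)[of "1 / 2" "1 / 2" x] by (simp add: free_scale_simps(5))
    have "free_scale (inverse z) (free_gauge z ?u - ?v) = Z m - free_scale (inverse z) (free_gauge z f)"
      using z(2) by (simp add: free_gauge_minus free_scale_simps)
    moreover have "Z m - remove_degree d f =
        free_scale (1 / 2) ?u + free_scale (1 / 2) (Z m - free_scale (inverse z) (free_gauge z f))"
    proof -
      have "Z m - remove_degree d f = (free_scale (1 / 2) (Z m) + free_scale (1 / 2) (Z m)) - remove_degree d f"
        by (simp only: half)
      then show ?thesis
        unfolding remove_degree_def Let_def z_def[symmetric] by (simp add: free_scale_simps(1,2) algebra_simps)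
    qed
    ultimately have "N (Z m - remove_degree d f) \<le> N (free_scale (1 / 2) ?u) + N (free_scale (1 / 2) (free_scale (inverse z) (free_gauge z ?u - ?v)))"
      using N_rules(1)[of "free_scale (1 / 2) ?u" "free_scale (1 / 2) (free_scale (inverse z) (free_gauge z ?u - ?v))"] by simp
    also have "\<dots> = 1 / 2 * N ?u + 1 / 2 * N (free_gauge z ?u - ?v)"
      using z(1) by (simp add: N_rules(2) norm_inverse norm_divide)
    finally have "N (Z m - remove_degree d f) \<le> 1 / 2 * N ?u + 1 / 2 * N (free_gauge z ?u - ?v)" .
    moreover have "N (free_gauge z ?u - ?v) \<le> N ?u + N ?v"
      using N_rules(7)[of "free_gauge z ?u" ?v] ck_norm_gauge[OF z(1), of A ?u] by linarith
    ultimately show ?thesis by linarith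
  qed
  moreover have "(\<lambda>m. N (Z m - f) + 1 / 2 * N (free_gauge z (Z m) - free_scale z (Z m))) \<longlonglongrightarrow>
      alg_norm \<O> (n \<ominus>\<^bsub>\<O>\<^esub> const_cls f) + 1 / 2 * 0"
    by (intro tendsto_add tendsto_mult_left lim null)
  ultimately show ?thesis by (intro LIMSEQ_le[OF lim]) auto
qed

lemma degree_one_approximation:
  assumes n: "n \<in> carrier \<O>" and g: "\<And>z. cmod z = 1 \<Longrightarrow> gauge_action A z n = z \<odot>\<^bsub>\<O>\<^esub> n" and e: "e > 0"
  obtains f where "homogeneous 1 f" "alg_norm \<O> (n \<ominus>\<^bsub>\<O>\<^esub> const_cls f) < e"
proof -
  obtain Z where Z: "Z \<in> cauchy_seqs N" "n = cls Z" using n by (rule alg_cases)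
  obtain M where M: "\<forall>m\<ge>M. \<forall>k\<ge>M. N (Z m - Z k) < e / 2" using cauchyD[OF Z(1), of "e / 2"] e by auto
  let ?f = "Z M"
  have "alg_norm \<O> (n \<ominus>\<^bsub>\<O>\<^esub> const_cls ?f) \<le> e / 2"
    unfolding Z(2) alg_cls(8)[OF Z(1) cauchy_const]
    by (rule LIMSEQ_le_const2[OF alg_norm_cls[OF cauchy_minus[OF Z(1) cauchy_const]]])
       (use M in \<open>auto intro!: exI[of _ M] less_imp_le\<close>)
  then have f: "alg_norm \<O> (n \<ominus>\<^bsub>\<O>\<^esub> const_cls ?f) < e" using e by linarith
  have "\<exists>f'. Poly_Mapping.keys f' \<subseteq> Poly_Mapping.keys ?f \<and> (\<forall>w\<in>Poly_Mapping.keys f'. word_degree w \<notin> T) \<and>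
      alg_norm \<O> (n \<ominus>\<^bsub>\<O>\<^esub> const_cls f') < e" if "finite T" "1 \<notin> T" for T
    using that
  proof (induction T)
    case empty
    then show ?case using f by blast
  next
    case (insert d T)
    then obtain f' where f': "Poly_Mapping.keys f' \<subseteq> Poly_Mapping.keys ?f"
      "\<forall>w\<in>Poly_Mapping.keys f'. word_degree w \<notin> T" "alg_norm \<O> (n \<ominus>\<^bsub>\<O>\<^esub> const_cls f') < e" by auto
    have d: "d \<noteq> 1" using insert.prems by auto
    have "Poly_Mapping.keys (remove_degree d f') \<subseteq> Poly_Mapping.keys f'"
      using lookup_remove_degree(3)[OF d, of f'] by (auto simp: in_keys_iff)
    moreover have "word_degree w \<noteq> d" if "w \<in> Poly_Mapping.keys (remove_degree d f')" for w
      using that lookup_remove_degree(2)[OF d, of w f'] by (auto simp: in_keys_iff)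
    moreover have "alg_norm \<O> (n \<ominus>\<^bsub>\<O>\<^esub> const_cls (remove_degree d f')) < e"
      using remove_degree_norm[OF n g, of d f'] f'(3) by linarith
    ultimately show ?case using f'(1,2) by (intro exI[of _ "remove_degree d f'"]) blast
  qed
  from this[of "word_degree ` Poly_Mapping.keys ?f - {1}"] obtain f' where
    f': "Poly_Mapping.keys f' \<subseteq> Poly_Mapping.keys ?f"
    "\<forall>w\<in>Poly_Mapping.keys f'. word_degree w \<notin> word_degree ` Poly_Mapping.keys ?f - {1}"
    "alg_norm \<O> (n \<ominus>\<^bsub>\<O>\<^esub> const_cls f') < e" by auto
  have "homogeneous 1 f'" unfolding homogeneous_def using f'(1,2) by blast
  then show ?thesis using that f'(3) by blast
qed

lemma word_pull_orbit:
  assumes "word_pull ls x = Some y"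
  obtains p q where "p \<le> length ls" "q \<le> length ls" "(shift ^^ p) x = (shift ^^ q) y"
    "int p = int q + sum_list (map letter_degree ls)"
proof -
  have "\<exists>p q. p \<le> length ls \<and> q \<le> length ls \<and> (shift ^^ p) x = (shift ^^ q) y \<and>
    int p = int q + sum_list (map letter_degree ls)"
    using assms
  proof (induction ls arbitrary: x)
    case (Cons l ls)
    then obtain z where z: "pull l x = Some z" "word_pull ls z = Some y" by (auto split: Option.bind_splits)
    from Cons.IH[OF z(2)] obtain p q where pq: "p \<le> length ls" "q \<le> length ls" "(shift ^^ p) z = (shift ^^ q) y"
      "int p = int q + sum_list (map letter_degree ls)" by blast
    show ?case
    proof (cases l)
      case (Gen i)
      then have "z = shift x" using z(1) by (auto split: if_splits)
      then have "(shift ^^ Suc p) x = (shift ^^ q) y" using pq(3) by (simp add: funpow_swap1)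
      then show ?thesis using pq Gen by (intro exI[of _ "Suc p"] exI[of _ q]) simp
    next
      case (Adj i)
      then have "x = shift z" using z(1) by (auto simp: shift_def split: if_splits)
      show ?thesis
      proof (cases p)
        case 0
        then have "(shift ^^ 0) x = (shift ^^ Suc q) y" using pq(3) \<open>x = shift z\<close> by simp
        then show ?thesis using pq Adj 0 by (intro exI[of _ 0] exI[of _ "Suc q"]) simp
      next
        case (Suc p')
        then have "(shift ^^ p') x = (shift ^^ q) y" using pq(3) \<open>x = shift z\<close> by (simp add: funpow_swap1)
        then show ?thesis using pq Adj Suc by (intro exI[of _ p'] exI[of _ q]) simp
      qed
    qed
  qed simp
  then show ?thesis using that by blast
qed

section \<open>The generators normalize the diagonal\<close>

abbreviation S :: "'i \<Rightarrow> 'i ck_element" where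
  "S i \<equiv> const_cls (gen i)"

lemma S_star: "star \<O> (S i) = const_cls (adj i)"
  by (simp add: alg_cls)

lemma coef_S_conj:
  assumes x: "x \<in> X" "x 0 = i" and a: "a \<in> carrier \<O>"
  shows "coef (shift x) (shift x) (star \<O> (S i) \<otimes>\<^bsub>\<O>\<^esub> a \<otimes>\<^bsub>\<O>\<^esub> S i) = coef x x a"
proof -
  have c: "case_nat i (shift x) = x" using x(2) by (auto simp: fun_eq_iff shift_def split: nat.split)
  have A1: "A $ i $ shift x 0 = 1" using X_step[OF x(1), of 0] x(2) by (simp add: shift_nth)
  have sx: "shift x \<in> X" using x by simp
  have "coef (shift x) (shift x) (star \<O> (S i) \<otimes>\<^bsub>\<O>\<^esub> a \<otimes>\<^bsub>\<O>\<^esub> S i) = coef (shift x) x (star \<O> (S i) \<otimes>\<^bsub>\<O>\<^esub> a)"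
    using coef_right[OF sx sx, of "star \<O> (S i) \<otimes>\<^bsub>\<O>\<^esub> a" "gen i"] a c A1
    by (simp add: gen_def word_star_def)
  also have "\<dots> = coef x x a"
    unfolding S_star using coef_left[OF sx x(1) a, of "adj i"] c A1 by (simp add: adj_def)
  finally show ?thesis .
qed

lemma S_partial_isometry: "S i \<otimes>\<^bsub>\<O>\<^esub> star \<O> (S i) \<otimes>\<^bsub>\<O>\<^esub> S i = S i"
  unfolding S_star using const_cls_eqI[OF gen_partial_isometry[of i]] by (simp add: alg_cls)

text \<open>The two statements are proved together: the compression \<open>d \<mapsto> S\<^sub>i\<^sup>* d S\<^sub>i\<close> is multiplicative on
  elements that commute with the range projection of \<open>S\<^sub>i\<close>.\<close>

lemma diagonal_commute_conj:
  assumes "d \<in> \<D>"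
  shows "d \<otimes>\<^bsub>\<O>\<^esub> (S i \<otimes>\<^bsub>\<O>\<^esub> star \<O> (S i)) = S i \<otimes>\<^bsub>\<O>\<^esub> star \<O> (S i) \<otimes>\<^bsub>\<O>\<^esub> d"
    and "star \<O> (S i) \<otimes>\<^bsub>\<O>\<^esub> d \<otimes>\<^bsub>\<O>\<^esub> S i \<in> \<D>"
proof -
  note D = cstar_subalgebraD[OF diagonal_subalgebra]
  define p where "p = S i \<otimes>\<^bsub>\<O>\<^esub> star \<O> (S i)"
  define c where "c d = star \<O> (S i) \<otimes>\<^bsub>\<O>\<^esub> d \<otimes>\<^bsub>\<O>\<^esub> S i" for d
  have pC [simp]: "p \<in> carrier \<O>" by (simp add: p_def)
  have p_star: "star \<O> p = p" by (simp add: p_def alg.star_mult)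
  have pS: "p \<otimes>\<^bsub>\<O>\<^esub> S i = S i" unfolding p_def by (rule S_partial_isometry)
  have cC [simp]: "d \<in> carrier \<O> \<Longrightarrow> c d \<in> carrier \<O>" for d by (simp add: c_def)
  let ?H = "{d \<in> \<D>. d \<otimes>\<^bsub>\<O>\<^esub> p = p \<otimes>\<^bsub>\<O>\<^esub> d \<and> c d \<in> \<D>}"
  have "\<D> \<subseteq> ?H"
  proof (rule diagonal_minimal)
    show "cstar_subalgebra ?H \<O>"
    proof (rule cstar_subalgebraI)
      show "?H \<subseteq> carrier \<O>" using diagonal_carrier by blast
      show "\<zero>\<^bsub>\<O>\<^esub> \<in> ?H" using D(2) by (simp add: c_def)
    next
      fix d e assume "d \<in> ?H" "e \<in> ?H"
      then have d: "d \<in> \<D>" "d \<otimes>\<^bsub>\<O>\<^esub> p = p \<otimes>\<^bsub>\<O>\<^esub> d" "c d \<in> \<D>"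
        and e: "e \<in> \<D>" "e \<otimes>\<^bsub>\<O>\<^esub> p = p \<otimes>\<^bsub>\<O>\<^esub> e" "c e \<in> \<D>" by auto
      note C = diagonal_carrier[OF d(1)] diagonal_carrier[OF e(1)]
      have "c (d \<oplus>\<^bsub>\<O>\<^esub> e) = c d \<oplus>\<^bsub>\<O>\<^esub> c e" using C by (simp add: c_def alg.l_distr alg.r_distr)
      then have "c (d \<oplus>\<^bsub>\<O>\<^esub> e) \<in> \<D>" using D(3)[OF d(3) e(3)] by simp
      moreover have "(d \<oplus>\<^bsub>\<O>\<^esub> e) \<otimes>\<^bsub>\<O>\<^esub> p = p \<otimes>\<^bsub>\<O>\<^esub> (d \<oplus>\<^bsub>\<O>\<^esub> e)" using C d(2) e(2) by (simp add: alg.l_distr alg.r_distr)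
      ultimately show "d \<oplus>\<^bsub>\<O>\<^esub> e \<in> ?H" using D(3)[OF d(1) e(1)] by blast
      have "p \<otimes>\<^bsub>\<O>\<^esub> (e \<otimes>\<^bsub>\<O>\<^esub> S i) = e \<otimes>\<^bsub>\<O>\<^esub> S i"
      proof -
        have "p \<otimes>\<^bsub>\<O>\<^esub> (e \<otimes>\<^bsub>\<O>\<^esub> S i) = (e \<otimes>\<^bsub>\<O>\<^esub> p) \<otimes>\<^bsub>\<O>\<^esub> S i" using C e(2) by (simp add: alg.m_assoc)
        also have "\<dots> = e \<otimes>\<^bsub>\<O>\<^esub> (p \<otimes>\<^bsub>\<O>\<^esub> S i)" using C by (simp add: alg.m_assoc)
        finally show ?thesis by (simp only: pS)
      qed
      then have eS: "S i \<otimes>\<^bsub>\<O>\<^esub> (star \<O> (S i) \<otimes>\<^bsub>\<O>\<^esub> (e \<otimes>\<^bsub>\<O>\<^esub> S i)) = e \<otimes>\<^bsub>\<O>\<^esub> S i"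
        using C by (simp add: p_def alg.m_assoc)
      have "c (d \<otimes>\<^bsub>\<O>\<^esub> e) = star \<O> (S i) \<otimes>\<^bsub>\<O>\<^esub> (d \<otimes>\<^bsub>\<O>\<^esub> (e \<otimes>\<^bsub>\<O>\<^esub> S i))"
        using C by (simp add: c_def alg.m_assoc)
      also have "\<dots> = c d \<otimes>\<^bsub>\<O>\<^esub> c e"
        by (subst eS[symmetric]) (use C in \<open>simp add: c_def alg.m_assoc\<close>)
      finally have "c (d \<otimes>\<^bsub>\<O>\<^esub> e) \<in> \<D>" using D(5)[OF d(3) e(3)] by simp
      moreover have "d \<otimes>\<^bsub>\<O>\<^esub> e \<otimes>\<^bsub>\<O>\<^esub> p = p \<otimes>\<^bsub>\<O>\<^esub> (d \<otimes>\<^bsub>\<O>\<^esub> e)"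
      proof -
        have "d \<otimes>\<^bsub>\<O>\<^esub> e \<otimes>\<^bsub>\<O>\<^esub> p = (d \<otimes>\<^bsub>\<O>\<^esub> p) \<otimes>\<^bsub>\<O>\<^esub> e" using C e(2) by (simp add: alg.m_assoc)
        then show ?thesis using C by (simp add: d(2) alg.m_assoc)
      qed
      ultimately show "d \<otimes>\<^bsub>\<O>\<^esub> e \<in> ?H" using D(5)[OF d(1) e(1)] by blast
    next
      fix r d assume "d \<in> ?H"
      then have d: "d \<in> \<D>" "d \<otimes>\<^bsub>\<O>\<^esub> p = p \<otimes>\<^bsub>\<O>\<^esub> d" "c d \<in> \<D>" by auto
      note C = diagonal_carrier[OF d(1)]
      have "c (r \<odot>\<^bsub>\<O>\<^esub> d) = r \<odot>\<^bsub>\<O>\<^esub> c d" using C by (simp add: c_def alg.smult_mult_l alg.smult_mult_r)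
      then have "c (r \<odot>\<^bsub>\<O>\<^esub> d) \<in> \<D>" using D(4)[OF d(3)] by simp
      moreover have "(r \<odot>\<^bsub>\<O>\<^esub> d) \<otimes>\<^bsub>\<O>\<^esub> p = p \<otimes>\<^bsub>\<O>\<^esub> (r \<odot>\<^bsub>\<O>\<^esub> d)" using C d(2) by (simp add: alg.smult_mult_l alg.smult_mult_r)
      ultimately show "r \<odot>\<^bsub>\<O>\<^esub> d \<in> ?H" using D(4)[OF d(1)] by blast
    next
      fix d assume "d \<in> ?H"
      then have d: "d \<in> \<D>" "d \<otimes>\<^bsub>\<O>\<^esub> p = p \<otimes>\<^bsub>\<O>\<^esub> d" "c d \<in> \<D>" by auto
      note C = diagonal_carrier[OF d(1)]
      have "c (star \<O> d) = star \<O> (c d)" using C by (simp add: c_def alg.star_mult alg.m_assoc)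
      then have "c (star \<O> d) \<in> \<D>" using D(6)[OF d(3)] by simp
      moreover have "star \<O> d \<otimes>\<^bsub>\<O>\<^esub> p = p \<otimes>\<^bsub>\<O>\<^esub> star \<O> d"
        using arg_cong[OF d(2), of "star \<O>"] C by (simp add: alg.star_mult p_star)
      ultimately show "star \<O> d \<in> ?H" using D(6)[OF d(1)] by blast
    next
      fix f l assume f: "\<And>n::nat. f n \<in> ?H" and l: "l \<in> carrier \<O>"
        and lim: "(\<lambda>n. alg_norm \<O> (f n \<ominus>\<^bsub>\<O>\<^esub> l)) \<longlonglongrightarrow> 0"
      have fD: "f n \<in> \<D>" "f n \<otimes>\<^bsub>\<O>\<^esub> p = p \<otimes>\<^bsub>\<O>\<^esub> f n" "c (f n) \<in> \<D>" for n using f by auto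
      have conv: "alg.converges f l" using diagonal_carrier[OF fD(1)] l lim by (simp add: alg.converges_def)
      have 1: "alg.converges (\<lambda>n. f n \<otimes>\<^bsub>\<O>\<^esub> p) (l \<otimes>\<^bsub>\<O>\<^esub> p)"
        by (intro alg.converges_mult conv alg.converges_const pC)
      have "alg.converges (\<lambda>n. f n \<otimes>\<^bsub>\<O>\<^esub> p) (p \<otimes>\<^bsub>\<O>\<^esub> l)"
        unfolding fD(2) by (intro alg.converges_mult conv alg.converges_const pC)
      from alg.converges_unique[OF 1 this] have "l \<otimes>\<^bsub>\<O>\<^esub> p = p \<otimes>\<^bsub>\<O>\<^esub> l" .
      moreover have "alg.converges (\<lambda>n. c (f n)) (c l)"
        unfolding c_def by (intro alg.converges_mult conv alg.converges_const alg.star_closed const_cls_closed)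
      then have "c l \<in> \<D>"
        by (intro D(7)[of "\<lambda>n. c (f n)", OF fD(3)]) (simp_all add: alg.converges_def)
      ultimately show "l \<in> ?H" using D(7)[OF fD(1) l lim] by blast
    qed
    fix \<mu> :: "'i list" assume "\<mu> \<noteq> []"
    then obtain j \<nu> where \<mu>: "\<mu> = j # \<nu>" by (cases \<mu>) auto
    have hp: "homogeneous 0 (gen i * adj i)"
      using homogeneous_mult[OF homogeneous_gen[of i] homogeneous_adj[of i]] by simp
    have "path_projection \<mu> * (gen i * adj i) \<simeq> (gen i * adj i) * path_projection \<mu>"
    proof (rule homogeneous_eqvI)
      show "homogeneous 0 (path_projection \<mu> * (gen i * adj i))" "homogeneous 0 ((gen i * adj i) * path_projection \<mu>)"
        using homogeneous_mult[OF homogeneous_path_projection[of \<mu>] hp] homogeneous_mult[OF hp homogeneous_path_projection[of \<mu>]] by simp_all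
      fix v x assume x: "x \<in> X"
      show "rep (path_projection \<mu> * (gen i * adj i)) v x = rep ((gen i * adj i) * path_projection \<mu>) v x"
        unfolding rep_mult[of "path_projection \<mu>"] rep_mult[of "gen i * adj i"]
        by (simp add: rep_path_projection[OF x] rep_range_projection[OF x])
    qed
    then have 1: "pproj \<mu> \<otimes>\<^bsub>\<O>\<^esub> p = p \<otimes>\<^bsub>\<O>\<^esub> pproj \<mu>"
      using const_cls_eqI unfolding p_def S_star by (simp add: alg_cls)
    define J where "J = {l. A $ i $ l = 1 \<and> j = i}"
    define q where "q = (\<Sum>l\<in>J. path_projection [l] * path_projection \<nu>)"
    have "adj i * path_projection \<mu> * gen i \<simeq> q"
    proof (rule homogeneous_eqvI)
      show "homogeneous 0 (adj i * path_projection \<mu> * gen i)"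
        using homogeneous_mult[OF homogeneous_mult[OF homogeneous_adj[of i] homogeneous_path_projection[of \<mu>]] homogeneous_gen[of i]] by simp
      show "homogeneous 0 q" unfolding q_def
      proof (rule homogeneous_sum)
        show "homogeneous 0 (path_projection [l] * path_projection \<nu>)" for l :: 'i
          using homogeneous_mult[OF homogeneous_path_projection[of "[l]"] homogeneous_path_projection[of \<nu>]] by simp
      qed
      fix v x assume x: "x \<in> X"
      have s: "shift (case_nat i x) = x" by (simp add: shift_def)
      have "rep (adj i * path_projection \<mu> * gen i) v x =
          (if A $ i $ x 0 = 1 \<and> j = i \<and> point_prefix x (length \<nu>) = \<nu> then v x else 0)"
      proof (cases "A $ i $ x 0 = 1")
        case True
        then have ix: "case_nat i x \<in> X" using x by (simp add: cons_in_X)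
        show ?thesis using True
          by (auto simp: mult.assoc rep_mult[of "adj i"] rep_mult[of "path_projection _"] rep_adj[OF x]
            rep_path_projection[OF ix] rep_gen[OF ix] s \<mu> point_prefix_Suc)
      qed (simp add: mult.assoc rep_mult[of "adj i"] rep_adj[OF x])
      moreover have "rep q v x = (\<Sum>l\<in>J. if x 0 = l then (if point_prefix x (length \<nu>) = \<nu> then v x else 0) else 0)"
        unfolding q_def rep_sum rep_mult[of "path_projection _"]
        by (intro sum.cong refl) (simp add: rep_path_projection[OF x] point_prefix_Suc point_prefix_def[of _ 0])
      then have "rep q v x = (if x 0 \<in> J \<and> point_prefix x (length \<nu>) = \<nu> then v x else 0)"
        by (simp add: sum.delta')
      ultimately show "rep (adj i * path_projection \<mu> * gen i) v x = rep q v x" by (auto simp: J_def)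
    qed
    then have "c (pproj \<mu>) = const_cls q"
      using const_cls_eqI unfolding c_def S_star by (simp add: alg_cls)
    also have "\<dots> \<in> \<D>" unfolding q_def
    proof (rule diagonal_sum)
      show "const_cls (path_projection [l] * path_projection \<nu>) \<in> \<D>" for l
        using D(5)[OF pproj_diagonal[of "[l]"] pproj_diagonal[of \<nu>]] by (simp add: alg_cls)
    qed simp
    finally show "pproj \<mu> \<in> ?H" using 1 pproj_diagonal by blast
  qed
  then show "d \<otimes>\<^bsub>\<O>\<^esub> (S i \<otimes>\<^bsub>\<O>\<^esub> star \<O> (S i)) = S i \<otimes>\<^bsub>\<O>\<^esub> star \<O> (S i) \<otimes>\<^bsub>\<O>\<^esub> d"
    "star \<O> (S i) \<otimes>\<^bsub>\<O>\<^esub> d \<otimes>\<^bsub>\<O>\<^esub> S i \<in> \<D>"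
    using assms unfolding p_def c_def by blast+
qed

lemma diagonal_times_S:
  assumes "d \<in> \<D>" shows "d \<otimes>\<^bsub>\<O>\<^esub> S i = S i \<otimes>\<^bsub>\<O>\<^esub> (star \<O> (S i) \<otimes>\<^bsub>\<O>\<^esub> d \<otimes>\<^bsub>\<O>\<^esub> S i)"
proof -
  have C: "d \<in> carrier \<O>" by (rule diagonal_carrier[OF assms])
  have "d \<otimes>\<^bsub>\<O>\<^esub> S i = d \<otimes>\<^bsub>\<O>\<^esub> (S i \<otimes>\<^bsub>\<O>\<^esub> star \<O> (S i)) \<otimes>\<^bsub>\<O>\<^esub> S i"
    using C S_partial_isometry[of i] by (simp add: alg.m_assoc)
  also have "\<dots> = S i \<otimes>\<^bsub>\<O>\<^esub> star \<O> (S i) \<otimes>\<^bsub>\<O>\<^esub> d \<otimes>\<^bsub>\<O>\<^esub> S i"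
    by (simp only: diagonal_commute_conj(1)[OF assms])
  finally show ?thesis using C by (simp add: alg.m_assoc)
qed

end

section \<open>From an isomorphism to eventual conjugacy\<close>

text \<open>A diagonal-preserving, gauge-equivariant isomorphism together with its inverse.\<close>

locale diagonal_isomorphism = A: markov_shift A + B: markov_shift B
  for A :: "nat^'i^'i::finite" and B :: "nat^'j^'j::finite" +
  fixes \<Psi> :: "'i ck_element \<Rightarrow> 'j ck_element" and \<Psi>' :: "'j ck_element \<Rightarrow> 'i ck_element"
  assumes hom: "\<Psi> \<in> star_hom A.\<O> B.\<O>" and hom': "\<Psi>' \<in> star_hom B.\<O> A.\<O>"
    and inv: "a \<in> carrier A.\<O> \<Longrightarrow> \<Psi>' (\<Psi> a) = a" and inv': "b \<in> carrier B.\<O> \<Longrightarrow> \<Psi> (\<Psi>' b) = b"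
    and diag: "d \<in> A.\<D> \<Longrightarrow> \<Psi> d \<in> B.\<D>" and diag': "e \<in> B.\<D> \<Longrightarrow> \<Psi>' e \<in> A.\<D>"
    and equivariant: "cmod z = 1 \<Longrightarrow> a \<in> carrier A.\<O> \<Longrightarrow> gauge_action B z (\<Psi> a) = \<Psi> (gauge_action A z a)"
    and equivariant': "cmod z = 1 \<Longrightarrow> b \<in> carrier B.\<O> \<Longrightarrow> gauge_action A z (\<Psi>' b) = \<Psi>' (gauge_action B z b)"
begin

lemma swapped: "diagonal_isomorphism B A \<Psi>' \<Psi>"
  by unfold_locales (fact hom hom' inv inv' diag diag' equivariant equivariant')+

lemma hom_rules:
  "a \<in> carrier A.\<O> \<Longrightarrow> \<Psi> a \<in> carrier B.\<O>"
  "a \<in> carrier A.\<O> \<Longrightarrow> b \<in> carrier A.\<O> \<Longrightarrow> \<Psi> (a \<oplus>\<^bsub>A.\<O>\<^esub> b) = \<Psi> a \<oplus>\<^bsub>B.\<O>\<^esub> \<Psi> b"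
  "a \<in> carrier A.\<O> \<Longrightarrow> b \<in> carrier A.\<O> \<Longrightarrow> \<Psi> (a \<otimes>\<^bsub>A.\<O>\<^esub> b) = \<Psi> a \<otimes>\<^bsub>B.\<O>\<^esub> \<Psi> b"
  "\<Psi> \<one>\<^bsub>A.\<O>\<^esub> = \<one>\<^bsub>B.\<O>\<^esub>"
  "a \<in> carrier A.\<O> \<Longrightarrow> \<Psi> (c \<odot>\<^bsub>A.\<O>\<^esub> a) = c \<odot>\<^bsub>B.\<O>\<^esub> \<Psi> a"
  "a \<in> carrier A.\<O> \<Longrightarrow> \<Psi> (star A.\<O> a) = star B.\<O> (\<Psi> a)"
  using hom unfolding star_hom_def
  by (auto simp: ring_hom_closed ring_hom_add ring_hom_mult ring_hom_one)

interpretation sw: diagonal_isomorphism B A \<Psi>' \<Psi>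
  by (rule swapped)

text \<open>Evaluation at a point \<open>x\<close>, transported by the isomorphism, is a character of the diagonal over
  \<open>B\<close>. Its values on path projections single out one path of each length, hence a point, and by
  contractivity it is evaluation at that point.\<close>

lemma image_point_exists:
  assumes x: "x \<in> A.X"
  shows "\<exists>y\<in>B.X. \<forall>d\<in>B.\<D>. B.coef y y d = A.coef x x (\<Psi>' d)"
proof -
  define \<phi> where "\<phi> d = A.coef x x (\<Psi>' d)" for d
  note D = cstar_subalgebraD[OF B.diagonal_subalgebra]
  note DC = B.diagonal_carrier
  have add: "\<phi> (d \<oplus>\<^bsub>B.\<O>\<^esub> e) = \<phi> d + \<phi> e" if "d \<in> B.\<D>" "e \<in> B.\<D>" for d e
    using DC that x by (simp add: \<phi>_def sw.hom_rules A.coef_add)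
  have scale: "\<phi> (c \<odot>\<^bsub>B.\<O>\<^esub> d) = c * \<phi> d" if "d \<in> B.\<D>" for c d
    using DC that x by (simp add: \<phi>_def sw.hom_rules A.coef_smult)
  have mult: "\<phi> (d \<otimes>\<^bsub>B.\<O>\<^esub> e) = \<phi> d * \<phi> e" if "d \<in> B.\<D>" "e \<in> B.\<D>" for d e
    using DC that x by (simp add: \<phi>_def sw.hom_rules A.diagonal_mult_coef diag')
  have one: "\<phi> \<one>\<^bsub>B.\<O>\<^esub> = 1" using x by (simp add: \<phi>_def sw.hom_rules A.coef_one)
  have star: "\<phi> (star B.\<O> d) = cnj (\<phi> d)" if "d \<in> B.\<D>" for d
    using DC that x by (simp add: \<phi>_def sw.hom_rules A.coef_star)
  have zero: "\<phi> \<zero>\<^bsub>B.\<O>\<^esub> = 0"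
    using scale[OF D(2), of 0] B.alg.smult_0[of "\<zero>\<^bsub>B.\<O>\<^esub>"] by simp
  have bound: "cmod (\<phi> d) \<le> alg_norm B.\<O> d" if "d \<in> B.\<D>" for d
    by (rule character_contractive[OF ck_algebra_cstar B.diagonal_subalgebra B.one_diagonal add scale mult one that])
  define p where "p \<nu> = \<phi> (B.pproj \<nu>)" for \<nu>
  \<comment> \<open>exactly one path of each length has the value one\<close>
  have p_nil: "p [] = 1" using one by (simp add: p_def path_projection_def B.alg_cls)
  have p_mult: "p \<mu> * p \<nu> = 0" if "length \<mu> = length \<nu>" "\<mu> \<noteq> \<nu>" for \<mu> \<nu>
  proof -
    have "B.eqv (path_projection \<mu> * path_projection \<nu>) 0"
    proof (rule B.homogeneous_eqvI[of 0])
      show "homogeneous 0 (path_projection \<mu> * path_projection \<nu> :: 'j free_algebra)"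
        using homogeneous_mult[OF homogeneous_path_projection[of \<mu>] homogeneous_path_projection[of \<nu>]] by simp
      fix v y assume y: "y \<in> B.X"
      show "B.rep (path_projection \<mu> * path_projection \<nu>) v y = B.rep 0 v y"
        unfolding B.rep_mult B.rep_path_projection[OF y] using that by auto
    qed simp
    then have "B.pproj \<mu> \<otimes>\<^bsub>B.\<O>\<^esub> B.pproj \<nu> = \<zero>\<^bsub>B.\<O>\<^esub>"
      using B.const_cls_eqI[of "path_projection \<mu> * path_projection \<nu>" 0] by (simp add: B.alg_cls)
    then show ?thesis using mult[OF B.pproj_diagonal[of \<mu>] B.pproj_diagonal[of \<nu>]] zero by (simp add: p_def)
  qed
  have p_idem: "p \<nu> = 0 \<or> p \<nu> = 1" for \<nu>
  proof -
    have "B.eqv (path_projection \<nu> * path_projection \<nu>) (path_projection \<nu>)"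
    proof (rule B.homogeneous_eqvI[of 0])
      show "homogeneous 0 (path_projection \<nu> * path_projection \<nu> :: 'j free_algebra)"
        using homogeneous_mult[OF homogeneous_path_projection[of \<nu>] homogeneous_path_projection[of \<nu>]] by simp
      fix v y assume y: "y \<in> B.X"
      show "B.rep (path_projection \<nu> * path_projection \<nu>) v y = B.rep (path_projection \<nu>) v y"
        unfolding B.rep_mult B.rep_path_projection[OF y] by auto
    qed (rule homogeneous_path_projection)
    then have "B.pproj \<nu> \<otimes>\<^bsub>B.\<O>\<^esub> B.pproj \<nu> = B.pproj \<nu>"
      using B.const_cls_eqI[of "path_projection \<nu> * path_projection \<nu>"] by (simp add: B.alg_cls)
    then have "p \<nu> * p \<nu> = p \<nu>" using mult[OF B.pproj_diagonal[of \<nu>] B.pproj_diagonal[of \<nu>]] by (simp add: p_def)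
    then show ?thesis by simp
  qed
  have \<phi>_sum: "const \<in> B.\<D> \<and> \<phi> const = (\<Sum>i\<in>J. p (\<nu> @ [i]))"
    if "const = B.const_cls (\<Sum>i\<in>J. path_projection (\<nu> @ [i]))" "finite J" for const J \<nu>
    using that(2) unfolding that(1)
  proof (induction J)
    case empty
    then show ?case using zero D(2) by (simp add: B.alg_cls)
  next
    case (insert i J)
    have "B.const_cls (\<Sum>i\<in>insert i J. path_projection (\<nu> @ [i])) =
        B.pproj (\<nu> @ [i]) \<oplus>\<^bsub>B.\<O>\<^esub> B.const_cls (\<Sum>i\<in>J. path_projection (\<nu> @ [i]))"
      using insert.hyps by (simp add: B.alg_cls)
    then show ?case
      using insert.hyps conjunct1[OF insert.IH] conjunct2[OF insert.IH] D(3)[OF B.pproj_diagonal] add[OF B.pproj_diagonal]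
      by (simp add: p_def)
  qed
  have p_sum: "(\<Sum>i\<in>UNIV. p (\<nu> @ [i])) = p \<nu>" for \<nu>
    using \<phi>_sum[OF refl, of UNIV \<nu>] B.const_cls_eqI[OF B.path_projection_sum[of \<nu>]] by (simp add: p_def)
  have "\<exists>i. p (\<nu> @ [i]) = 1" if "p \<nu> = 1" for \<nu>
  proof (rule ccontr)
    assume "\<nexists>i. p (\<nu> @ [i]) = 1"
    then have "p (\<nu> @ [i]) = 0" for i using p_idem[of "\<nu> @ [i]"] by blast
    then show False using p_sum[of \<nu>] that by simp
  qed
  then obtain s where s: "\<And>\<nu>. p \<nu> = 1 \<Longrightarrow> p (\<nu> @ [s \<nu>]) = 1" by metis
  define path where "path = rec_nat [] (\<lambda>_ \<nu>. \<nu> @ [s \<nu>])"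
  have path_simps: "path 0 = []" "path (Suc n) = path n @ [s (path n)]" for n by (simp_all add: path_def)
  define y where "y n = s (path n)" for n
  have path: "point_prefix y n = path n" for n
    by (induction n) (simp_all add: path_simps point_prefix_def y_def)
  have p_one: "p (point_prefix y n) = 1" for n
    unfolding path by (induction n) (simp_all add: path_simps p_nil s)
  have y: "y \<in> B.X"
    unfolding shift_space_def
  proof (intro CollectI allI)
    fix n
    let ?\<nu> = "point_prefix y (Suc (Suc n))"
    have "\<not> B.eqv (path_monomial ?\<nu>) 0"
    proof
      assume "B.eqv (path_monomial ?\<nu>) 0"
      from B.eqv_mult[OF this B.eqv_refl] have "B.eqv (path_projection ?\<nu>) 0" by (simp add: path_projection_def)
      then have "B.pproj ?\<nu> = \<zero>\<^bsub>B.\<O>\<^esub>" using B.const_cls_eqI by (simp add: B.alg_cls)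
      then show False using p_one[of "Suc (Suc n)"] zero by (simp add: p_def)
    qed
    moreover have "?\<nu> \<noteq> []" by (simp add: point_prefix_def)
    ultimately obtain z where z: "z \<in> B.X" "point_prefix z (Suc (Suc n)) = ?\<nu>"
      using B.path_monomial_cases[of ?\<nu>] by auto
    then have "z n = y n" "z (Suc n) = y (Suc n)" by (auto simp: point_prefix_eq_iff)
    then show "B $ y n $ y (Suc n) = 1" using B.X_step[OF z(1), of n] by simp
  qed
  have p_y: "B.coef y y (B.pproj \<nu>) = p \<nu>" for \<nu>
  proof (cases "point_prefix y (length \<nu>) = \<nu>")
    case True
    then show ?thesis using p_one[of "length \<nu>"] y by (simp add: B.coef_pproj)
  next
    case False
    then have "p (point_prefix y (length \<nu>)) * p \<nu> = 0" by (intro p_mult) auto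
    then show ?thesis using p_one[of "length \<nu>"] y False by (simp add: B.coef_pproj)
  qed
  have "B.\<D> \<subseteq> {d \<in> B.\<D>. B.coef y y d = \<phi> d}"
  proof (rule B.diagonal_minimal)
    show "cstar_subalgebra {d \<in> B.\<D>. B.coef y y d = \<phi> d} B.\<O>"
    proof (rule cstar_subalgebraI)
      show "{d \<in> B.\<D>. B.coef y y d = \<phi> d} \<subseteq> carrier B.\<O>" using DC by blast
      fix f l assume f: "\<And>n::nat. f n \<in> {d \<in> B.\<D>. B.coef y y d = \<phi> d}" and l: "l \<in> carrier B.\<O>"
        and lim: "(\<lambda>n. alg_norm B.\<O> (f n \<ominus>\<^bsub>B.\<O>\<^esub> l)) \<longlonglongrightarrow> 0"
      have fD: "f n \<in> B.\<D>" "B.coef y y (f n) = \<phi> (f n)" for n using f by auto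
      have lD: "l \<in> B.\<D>" by (rule D(7)[OF fD(1) l lim])
      have minus: "f n \<ominus>\<^bsub>B.\<O>\<^esub> l = f n \<oplus>\<^bsub>B.\<O>\<^esub> (- 1) \<odot>\<^bsub>B.\<O>\<^esub> l" for n
        using l by (simp add: a_minus_def B.alg.smult_minus1)
      have mD: "f n \<ominus>\<^bsub>B.\<O>\<^esub> l \<in> B.\<D>" for n unfolding minus by (intro D(3) D(4) fD(1) lD)
      have \<phi>_minus: "\<phi> (f n \<ominus>\<^bsub>B.\<O>\<^esub> l) = \<phi> (f n) - \<phi> l" for n
        unfolding minus by (simp add: add[OF fD(1) D(4)[OF lD]] scale[OF lD])
      have "(\<lambda>n. \<phi> (f n) - \<phi> l) \<longlonglongrightarrow> 0"
        by (rule Lim_null_comparison[OF always_eventually lim]) (use bound[OF mD] \<phi>_minus in simp)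
      then have "(\<lambda>n. \<phi> (f n)) \<longlonglongrightarrow> \<phi> l" by (simp add: LIM_zero_iff)
      moreover have "(\<lambda>n. \<phi> (f n)) \<longlonglongrightarrow> B.coef y y l"
        using B.coef_converges[OF y, of f l y] DC[OF fD(1)] l lim by (simp add: B.alg.converges_def fD(2))
      ultimately have "\<phi> l = B.coef y y l" by (rule LIMSEQ_unique)
      then show "l \<in> {d \<in> B.\<D>. B.coef y y d = \<phi> d}" using lD by simp
    qed (use D(2-6) DC y in \<open>simp_all add: add scale mult star zero B.coef_add B.coef_smult B.coef_star
        B.coef_zero B.diagonal_mult_coef\<close>)
  qed (use B.pproj_diagonal p_y in \<open>simp add: p_def\<close>)
  then show ?thesis using y unfolding \<phi>_def by blast
qed

text \<open>The map on points induced by the isomorphism; the point is unique by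
  \<open>diagonal_separates\<close>.\<close>

definition point_map :: "(nat \<Rightarrow> 'i) \<Rightarrow> nat \<Rightarrow> 'j" where
  "point_map x = (SOME y. y \<in> B.X \<and> (\<forall>d\<in>B.\<D>. B.coef y y d = A.coef x x (\<Psi>' d)))"

lemma point_map:
  assumes "x \<in> A.X"
  shows "point_map x \<in> B.X" "d \<in> B.\<D> \<Longrightarrow> B.coef (point_map x) (point_map x) d = A.coef x x (\<Psi>' d)"
proof -
  have "point_map x \<in> B.X \<and> (\<forall>d\<in>B.\<D>. B.coef (point_map x) (point_map x) d = A.coef x x (\<Psi>' d))"
    unfolding point_map_def by (rule image_point_exists[OF assms, unfolded Bex_def, THEN someI_ex])
  then show "point_map x \<in> B.X" "d \<in> B.\<D> \<Longrightarrow> B.coef (point_map x) (point_map x) d = A.coef x x (\<Psi>' d)" by auto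
qed

lemma point_map_image:
  assumes "x \<in> A.X" "d \<in> A.\<D>" shows "B.coef (point_map x) (point_map x) (\<Psi> d) = A.coef x x d"
  using point_map(2)[OF assms(1) diag[OF assms(2)]] inv[OF A.diagonal_carrier[OF assms(2)]] by simp

lemma point_map_determined: "uniformly_determined A point_map"
  unfolding uniformly_determined_def
proof
  fix n
  have "\<forall>\<nu>. \<exists>m. \<forall>x\<in>A.X. \<forall>y\<in>A.X. (\<forall>l<m. x l = y l) \<longrightarrow>
      cmod (A.coef x x (\<Psi>' (B.pproj \<nu>)) - A.coef y y (\<Psi>' (B.pproj \<nu>))) < 1"
  proof
    fix \<nu>
    obtain m where "\<And>x y. x \<in> A.X \<Longrightarrow> y \<in> A.X \<Longrightarrow> \<forall>l<m. x l = y l \<Longrightarrow>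
        cmod (A.coef x x (\<Psi>' (B.pproj \<nu>)) - A.coef y y (\<Psi>' (B.pproj \<nu>))) < 1"
      by (rule A.diagonal_coef_continuous[OF diag'[OF B.pproj_diagonal[of \<nu>]] zero_less_one]) (rule that)
    then show "\<exists>m. \<forall>x\<in>A.X. \<forall>y\<in>A.X. (\<forall>l<m. x l = y l) \<longrightarrow>
      cmod (A.coef x x (\<Psi>' (B.pproj \<nu>)) - A.coef y y (\<Psi>' (B.pproj \<nu>))) < 1" by blast
  qed
  from choice[OF this] obtain m where m: "\<And>\<nu> x y. x \<in> A.X \<Longrightarrow> y \<in> A.X \<Longrightarrow> \<forall>l<m \<nu>. x l = y l \<Longrightarrow>
      cmod (A.coef x x (\<Psi>' (B.pproj \<nu>)) - A.coef y y (\<Psi>' (B.pproj \<nu>))) < 1" by blast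
  let ?M = "Max (m ` {\<nu>. length \<nu> = n})"
  have "\<forall>l<n. point_map x l = point_map y l" if xy: "x \<in> A.X" "y \<in> A.X" "\<forall>l<?M. x l = y l" for x y
  proof -
    let ?\<nu> = "point_prefix (point_map x) n"
    have "m ?\<nu> \<le> ?M" by (intro Max_ge finite_imageI finite_words_of_length imageI) simp
    then have "\<forall>l<m ?\<nu>. x l = y l" using xy(3) by (meson order.strict_trans2)
    from m[OF xy(1,2) this]
    have "cmod (B.coef (point_map x) (point_map x) (B.pproj ?\<nu>) - B.coef (point_map y) (point_map y) (B.pproj ?\<nu>)) < 1"
      by (simp add: point_map(2)[OF xy(1) B.pproj_diagonal] point_map(2)[OF xy(2) B.pproj_diagonal])
    then have "point_prefix (point_map y) n = ?\<nu>"
      by (simp add: B.coef_pproj[OF point_map(1)[OF xy(1)]] B.coef_pproj[OF point_map(1)[OF xy(2)]] split: if_splits)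
    then show ?thesis by (simp add: point_prefix_eq_iff)
  qed
  then show "\<exists>m. \<forall>x\<in>A.X. \<forall>y\<in>A.X. (\<forall>l<m. x l = y l) \<longrightarrow> (\<forall>l<n. point_map x l = point_map y l)" by blast
qed

text \<open>The image \<open>n\<close> of a generator is a normalizer of the diagonal that carries the point
  \<open>y = point_map (shift x)\<close> to \<open>point_map x\<close>: all other matrix coefficients in the column of \<open>y\<close> vanish.
  Since \<open>n\<^sup>* n\<close> has coefficient one at \<open>y\<close>, some word of degree one in an approximation of \<open>n\<close> moves
  \<open>y\<close> to \<open>point_map x\<close>.\<close>

lemma letter_lag:
  "\<exists>K. \<forall>x\<in>A.X. x 0 = i \<longrightarrow> (\<exists>q\<le>K. (shift ^^ q) (point_map (shift x)) = (shift ^^ Suc q) (point_map x))"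
proof -
  define n where "n = \<Psi> (A.S i)"
  have nC: "n \<in> carrier B.\<O>" unfolding n_def by (rule hom_rules(1)) simp
  have n_star: "star B.\<O> n = \<Psi> (star A.\<O> (A.S i))" unfolding n_def by (simp add: hom_rules(6))
  have gauge: "gauge_action B z n = z \<odot>\<^bsub>B.\<O>\<^esub> n" if z: "cmod z = 1" for z
  proof -
    have "gauge_action A z (A.S i) = z \<odot>\<^bsub>A.\<O>\<^esub> A.S i"
      using gauge_action_gen[OF z, of A i] by (simp only: A.ck_gen_cls)
    then show ?thesis unfolding n_def equivariant[OF z A.const_cls_closed] by (simp add: hom_rules(5))
  qed
  define r where "r = 1 / (1 + alg_norm B.\<O> n)"
  have n0: "0 \<le> alg_norm B.\<O> n" by (rule B.alg.norm_nonneg[OF nC])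
  then have r: "r > 0" by (simp add: r_def add_pos_nonneg)
  obtain f where f: "homogeneous 1 f" "alg_norm B.\<O> (n \<ominus>\<^bsub>B.\<O>\<^esub> B.const_cls f) < r"
    by (rule B.degree_one_approximation[OF nC gauge r]) (assumption | rule that)+
  define K where "K = Max (insert 0 ((\<lambda>w. length (letters w)) ` Poly_Mapping.keys f))"
  have "\<exists>q\<le>K. (shift ^^ q) (point_map (shift x)) = (shift ^^ Suc q) (point_map x)" if x: "x \<in> A.X" "x 0 = i" for x
  proof -
    have sx: "shift x \<in> A.X" using x(1) by simp
    define y where "y = point_map (shift x)"
    define x' where "x' = point_map x"
    have y: "y \<in> B.X" and x': "x' \<in> B.X" unfolding y_def x'_def by (rule point_map(1)[OF sx], rule point_map(1)[OF x(1)])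
    \<comment> \<open>the column of \<open>y\<close> is supported at \<open>x'\<close>\<close>
    have column: "B.coef z y n = 0" if z: "z \<in> B.X" "z \<noteq> x'" for z
    proof -
      obtain l where l: "z l \<noteq> x' l" using z(2) by blast
      define d where "d = B.pproj (point_prefix z (Suc l))"
      have dD: "d \<in> B.\<D>" unfolding d_def by (rule B.pproj_diagonal)
      have dz: "B.coef z z d = 1" by (simp add: d_def B.coef_pproj[OF z(1)])
      have dx: "B.coef x' x' d = 0" using l by (auto simp: d_def B.coef_pproj[OF x'] point_prefix_eq_iff)
      define e where "e = \<Psi>' d"
      have eD: "e \<in> A.\<D>" unfolding e_def by (rule diag'[OF dD])
      have eC: "e \<in> carrier A.\<O>" by (rule A.diagonal_carrier[OF eD])
      define g where "g = star A.\<O> (A.S i) \<otimes>\<^bsub>A.\<O>\<^esub> e \<otimes>\<^bsub>A.\<O>\<^esub> A.S i"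
      have gD: "g \<in> A.\<D>" unfolding g_def by (rule A.diagonal_commute_conj(2)[OF eD])
      have gC: "g \<in> carrier A.\<O>" by (rule A.diagonal_carrier[OF gD])
      have d\<Psi>: "\<Psi> e = d" unfolding e_def by (rule inv'[OF B.diagonal_carrier[OF dD]])
      have "d \<otimes>\<^bsub>B.\<O>\<^esub> n = \<Psi> (e \<otimes>\<^bsub>A.\<O>\<^esub> A.S i)"
        by (simp add: d\<Psi>[symmetric] n_def hom_rules(3)[OF eC A.const_cls_closed])
      also have "\<dots> = n \<otimes>\<^bsub>B.\<O>\<^esub> \<Psi> g"
        unfolding A.diagonal_times_S[OF eD] g_def[symmetric] n_def by (rule hom_rules(3)[OF A.const_cls_closed gC])
      finally have "B.coef z y (d \<otimes>\<^bsub>B.\<O>\<^esub> n) = B.coef z y (n \<otimes>\<^bsub>B.\<O>\<^esub> \<Psi> g)" by simp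
      then have "B.coef z y n = B.coef z y n * B.coef y y (\<Psi> g)"
        using B.diagonal_left[OF dD nC z(1) y] B.diagonal_right[OF diag[OF gD] nC z(1) y] dz by simp
      also have "B.coef y y (\<Psi> g) = A.coef (shift x) (shift x) g" unfolding y_def by (rule point_map_image[OF sx gD])
      also have "\<dots> = A.coef x x e" unfolding g_def by (rule A.coef_S_conj[OF x eC])
      also have "\<dots> = B.coef x' x' d" unfolding e_def x'_def by (rule point_map(2)[OF x(1) dD, symmetric])
      finally show ?thesis by (simp add: dx)
    qed
    have nn: "B.coef y y (star B.\<O> n \<otimes>\<^bsub>B.\<O>\<^esub> n) = 1"
    proof -
      let ?g = "star A.\<O> (A.S i) \<otimes>\<^bsub>A.\<O>\<^esub> \<one>\<^bsub>A.\<O>\<^esub> \<otimes>\<^bsub>A.\<O>\<^esub> A.S i"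
      have "star B.\<O> n \<otimes>\<^bsub>B.\<O>\<^esub> n = \<Psi> ?g"
        unfolding n_star unfolding n_def by (simp add: hom_rules(3))
      then have "B.coef y y (star B.\<O> n \<otimes>\<^bsub>B.\<O>\<^esub> n) = A.coef (shift x) (shift x) ?g"
        unfolding y_def using point_map_image[OF sx A.diagonal_commute_conj(2)[OF A.one_diagonal]] by simp
      also have "\<dots> = A.coef x x \<one>\<^bsub>A.\<O>\<^esub>" by (rule A.coef_S_conj[OF x]) simp
      finally show ?thesis using x(1) by (simp add: A.coef_one)
    qed
    let ?m = "n \<ominus>\<^bsub>B.\<O>\<^esub> B.const_cls f"
    have mC: "?m \<in> carrier B.\<O>" using nC by simp
    have nsC: "star B.\<O> n \<in> carrier B.\<O>" using nC by simp
    have "B.coef y y (star B.\<O> n \<otimes>\<^bsub>B.\<O>\<^esub> B.const_cls f) \<noteq> 0"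
    proof
      assume 0: "B.coef y y (star B.\<O> n \<otimes>\<^bsub>B.\<O>\<^esub> B.const_cls f) = 0"
      have "star B.\<O> n \<otimes>\<^bsub>B.\<O>\<^esub> ?m = star B.\<O> n \<otimes>\<^bsub>B.\<O>\<^esub> n \<ominus>\<^bsub>B.\<O>\<^esub> star B.\<O> n \<otimes>\<^bsub>B.\<O>\<^esub> B.const_cls f"
        using nC nsC by (simp add: a_minus_def B.alg.r_distr B.alg.r_minus)
      then have "B.coef y y (star B.\<O> n \<otimes>\<^bsub>B.\<O>\<^esub> ?m) = 1"
        using 0 nn nC nsC by (simp add: B.coef_minus[OF y])
      then have "1 \<le> alg_norm B.\<O> (star B.\<O> n \<otimes>\<^bsub>B.\<O>\<^esub> ?m)"
        using B.coef_norm[OF y, of "star B.\<O> n \<otimes>\<^bsub>B.\<O>\<^esub> ?m" y] nsC mC by simp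
      also have "\<dots> \<le> alg_norm B.\<O> n * alg_norm B.\<O> ?m"
        using B.alg.norm_mult[OF nsC mC] B.alg.norm_star[OF nC] by simp
      also have "\<dots> \<le> alg_norm B.\<O> n * r" using f(2) n0 by (intro mult_left_mono) auto
      also have "\<dots> < 1" using n0 by (simp add: r_def)
      finally show False by simp
    qed
    then obtain w where w: "w \<in> Poly_Mapping.keys f"
      "(case B.word_pull (letters (word_star w)) y of None \<Rightarrow> 0 | Some y' \<Rightarrow> B.coef y y' (star B.\<O> n)) \<noteq> 0"
      unfolding B.coef_right[OF y y nsC] by (auto elim!: sum.not_neutral_contains_not_neutral)
    then obtain y' where y': "B.word_pull (letters (word_star w)) y = Some y'" "B.coef y y' (star B.\<O> n) \<noteq> 0"
      by (auto split: option.splits)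
    have y'X: "y' \<in> B.X" by (rule B.word_pull_star(1)[OF y y'(1)])
    have "B.coef y' y n \<noteq> 0" using y'(2) by (simp add: B.coef_star[OF y y'X nC])
    then have "y' = x'" using column[OF y'X] by blast
    obtain p q where pq: "p \<le> length (letters (word_star w))" "q \<le> length (letters (word_star w))"
      "(shift ^^ p) y = (shift ^^ q) y'" "int p = int q + sum_list (map letter_degree (letters (word_star w)))"
      by (rule B.word_pull_orbit[OF y'(1)]) (rule that)
    have "sum_list (map letter_degree (letters (word_star w))) = - 1"
      using homogeneousD[OF f(1) w(1)] word_degree_star[of w] by (simp add: word_degree_def)
    then have "q = Suc p" using pq(4) by simp
    moreover have "length (letters (word_star w)) = length (letters w)" by (simp add: word_star_def)
    moreover have "length (letters w) \<le> K" unfolding K_def using w(1) by (intro Max_ge) auto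
    ultimately show ?thesis using pq \<open>y' = x'\<close> unfolding y_def x'_def by (intro exI[of _ p]) simp
  qed
  then show ?thesis by blast
qed

lemma uniform_lag:
  "\<exists>K. \<forall>x\<in>A.X. (shift ^^ K) (point_map (shift x)) = (shift ^^ (K + 1)) (point_map x)"
proof -
  have "\<forall>i. \<exists>K. \<forall>x\<in>A.X. x 0 = i \<longrightarrow> (\<exists>q\<le>K. (shift ^^ q) (point_map (shift x)) = (shift ^^ Suc q) (point_map x))"
    by (intro allI letter_lag)
  from choice[OF this] obtain K where K: "\<forall>i. \<forall>x\<in>A.X. x 0 = i \<longrightarrow>
      (\<exists>q\<le>K i. (shift ^^ q) (point_map (shift x)) = (shift ^^ Suc q) (point_map x))" ..
  have "(shift ^^ Max (range K)) (point_map (shift x)) = (shift ^^ (Max (range K) + 1)) (point_map x)" if x: "x \<in> A.X" for x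
  proof -
    obtain q where q: "q \<le> K (x 0)" "(shift ^^ q) (point_map (shift x)) = (shift ^^ Suc q) (point_map x)"
      using K[rule_format, OF x refl] by blast
    have "q \<le> Max (range K)" using q(1) by (rule order.trans) (intro Max_ge finite_imageI finite rangeI)
    with q(2) show ?thesis using larger_lag[of q "point_map (shift x)" "point_map x" "Max (range K)"] by simp
  qed
  then show ?thesis by blast
qed

end

context diagonal_isomorphism
begin

interpretation sw: diagonal_isomorphism B A \<Psi>' \<Psi>
  by (rule swapped)

lemma point_map_inverse:
  assumes x: "x \<in> A.X" shows "sw.point_map (point_map x) = x"
proof (rule A.diagonal_separates)
  note y = point_map(1)[OF x]
  show "sw.point_map (point_map x) \<in> A.X" by (rule sw.point_map(1)[OF y])
  fix d assume d: "d \<in> A.\<D>"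
  show "A.coef (sw.point_map (point_map x)) (sw.point_map (point_map x)) d = A.coef x x d"
    using sw.point_map(2)[OF y d] point_map_image[OF x d] by simp
qed (rule x)

end

context diagonal_isomorphism
begin

interpretation sw: diagonal_isomorphism B A \<Psi>' \<Psi>
  by (rule swapped)

theorem conjugate: "eventually_conjugate A B"
proof -
  obtain K where K: "\<forall>x\<in>A.X. (shift ^^ K) (point_map (shift x)) = (shift ^^ (K + 1)) (point_map x)"
    using uniform_lag by blast
  obtain K' where K': "\<forall>y\<in>B.X. (shift ^^ K') (sw.point_map (shift y)) = (shift ^^ (K' + 1)) (sw.point_map y)"
    using sw.uniform_lag by blast
  have "continuous_map (shift_topology A) (shift_topology B) point_map"
    by (rule uniformly_determined_imp_continuous[OF point_map(1) point_map_determined])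
  moreover have "continuous_map (shift_topology B) (shift_topology A) sw.point_map"
    by (rule uniformly_determined_imp_continuous[OF sw.point_map(1) sw.point_map_determined])
  ultimately have "homeomorphic_maps (shift_topology A) (shift_topology B) point_map sw.point_map"
    unfolding homeomorphic_maps_def topspace_shift_topology
    using point_map_inverse sw.point_map_inverse by (intro conjI ballI)
  then show ?thesis unfolding eventually_conjugate_def using K K'
    by (intro exI[of _ point_map] exI[of _ sw.point_map] exI[of _ "\<lambda>_. K"] exI[of _ "\<lambda>_. K'"] conjI) simp_all
qed

end

lemma inverse_star_iso:
  assumes A: "cstar_algebra R" and iso: "\<Psi> \<in> star_iso R S"
  shows "inv_into (carrier R) \<Psi> \<in> star_hom S R"
proof -
  interpret cstar_algebra R by fact
  let ?i = "inv_into (carrier R) \<Psi>"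
  have hom: "\<Psi> \<in> ring_hom R S" "\<And>c x. x \<in> carrier R \<Longrightarrow> \<Psi> (c \<odot>\<^bsub>R\<^esub> x) = c \<odot>\<^bsub>S\<^esub> \<Psi> x"
    "\<And>x. x \<in> carrier R \<Longrightarrow> \<Psi> (star R x) = star S (\<Psi> x)" and bij: "bij_betw \<Psi> (carrier R) (carrier S)"
    using iso by (auto simp: star_iso_def star_hom_def)
  have i: "?i (\<Psi> x) = x" if "x \<in> carrier R" for x using bij that by (rule bij_betw_inv_into_left)
  have cases: "\<exists>x\<in>carrier R. y = \<Psi> x" if "y \<in> carrier S" for y
    using bij that by (auto simp: bij_betw_def)
  have "?i \<in> ring_hom S R"
  proof (rule ring_hom_memI)
    fix y z assume "y \<in> carrier S" "z \<in> carrier S"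
    obtain u where u: "u \<in> carrier R" "y = \<Psi> u" using cases[OF \<open>y \<in> carrier S\<close>] by blast
    obtain v where v: "v \<in> carrier R" "z = \<Psi> v" using cases[OF \<open>z \<in> carrier S\<close>] by blast
    show "?i y \<in> carrier R" unfolding u(2) i[OF u(1)] by (rule u(1))
    show "?i (y \<otimes>\<^bsub>S\<^esub> z) = ?i y \<otimes>\<^bsub>R\<^esub> ?i z"
      unfolding u(2) v(2) ring_hom_mult[OF hom(1) u(1) v(1), symmetric] i[OF u(1)] i[OF v(1)]
      by (rule i[OF m_closed[OF u(1) v(1)]])
    show "?i (y \<oplus>\<^bsub>S\<^esub> z) = ?i y \<oplus>\<^bsub>R\<^esub> ?i z"
      unfolding u(2) v(2) ring_hom_add[OF hom(1) u(1) v(1), symmetric] i[OF u(1)] i[OF v(1)]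
      by (rule i[OF add.m_closed[OF u(1) v(1)]])
  next
    show "?i \<one>\<^bsub>S\<^esub> = \<one>\<^bsub>R\<^esub>" using i[OF one_closed] unfolding ring_hom_one[OF hom(1)] .
  qed
  moreover have "?i (c \<odot>\<^bsub>S\<^esub> y) = c \<odot>\<^bsub>R\<^esub> ?i y" "?i (star S y) = star R (?i y)" if y: "y \<in> carrier S" for c y
  proof -
    obtain u where u: "u \<in> carrier R" "y = \<Psi> u" using cases[OF y] by blast
    show "?i (c \<odot>\<^bsub>S\<^esub> y) = c \<odot>\<^bsub>R\<^esub> ?i y"
      unfolding u(2) hom(2)[OF u(1), symmetric] i[OF u(1)] by (rule i[OF smult_closed[OF u(1)]])
    show "?i (star S y) = star R (?i y)"
      unfolding u(2) hom(3)[OF u(1), symmetric] i[OF u(1)] by (rule i[OF star_closed[OF u(1)]])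
  qed
  ultimately show ?thesis by (simp add: star_hom_def)
qed

theorem isomorphic_imp_eventually_conjugate:
  assumes A: "markov_shift A" and B: "markov_shift B"
    and iso: "\<Psi> \<in> star_iso (ck_algebra A) (ck_algebra B)" and diag: "\<Psi> ` ck_diagonal A = ck_diagonal B"
    and gauge: "\<forall>z. cmod z = 1 \<longrightarrow> (\<forall>a\<in>carrier (ck_algebra A). gauge_action B z (\<Psi> a) = \<Psi> (gauge_action A z a))"
  shows "eventually_conjugate A B"
proof -
  interpret A: markov_shift A by fact
  interpret B: markov_shift B by fact
  define \<Psi>' where "\<Psi>' = inv_into (carrier A.\<O>) \<Psi>"
  have hom: "\<Psi> \<in> star_hom A.\<O> B.\<O>" and bij: "bij_betw \<Psi> (carrier A.\<O>) (carrier B.\<O>)"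
    using iso by (auto simp: star_iso_def)
  have hom': "\<Psi>' \<in> star_hom B.\<O> A.\<O>" unfolding \<Psi>'_def by (rule inverse_star_iso[OF ck_algebra_cstar iso])
  have inv: "\<Psi>' (\<Psi> a) = a" if "a \<in> carrier A.\<O>" for a
    unfolding \<Psi>'_def using bij that by (rule bij_betw_inv_into_left)
  have inv': "\<Psi> (\<Psi>' b) = b" if "b \<in> carrier B.\<O>" for b
    unfolding \<Psi>'_def using bij that by (rule bij_betw_inv_into_right)
  have closed': "\<Psi>' b \<in> carrier A.\<O>" if "b \<in> carrier B.\<O>" for b
    using hom' that unfolding star_hom_def by (auto simp: ring_hom_closed)
  have gauge_closed: "gauge_action A z a \<in> carrier A.\<O>" if "cmod z = 1" "a \<in> carrier A.\<O>" for z a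
    using gauge_action_iso[OF that(1), of A] that(2) by (auto simp: star_iso_def star_hom_def ring_hom_closed)
  interpret diagonal_isomorphism A B \<Psi> \<Psi>'
  proof (unfold_locales)
    show "\<Psi> d \<in> B.\<D>" if "d \<in> A.\<D>" for d using diag that by blast
    show "\<Psi>' e \<in> A.\<D>" if e: "e \<in> B.\<D>" for e
    proof -
      obtain d where "d \<in> A.\<D>" "e = \<Psi> d" using diag e by blast
      then show ?thesis using inv[OF A.diagonal_carrier] by simp
    qed
    show "gauge_action B z (\<Psi> a) = \<Psi> (gauge_action A z a)" if "cmod z = 1" "a \<in> carrier A.\<O>" for z a
      using gauge that by blast
    show "gauge_action A z (\<Psi>' b) = \<Psi>' (gauge_action B z b)" if z: "cmod z = 1" and b: "b \<in> carrier B.\<O>" for z b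
    proof -
      have "gauge_action B z (\<Psi> (\<Psi>' b)) = \<Psi> (gauge_action A z (\<Psi>' b))"
        using gauge z closed'[OF b] by blast
      then have "gauge_action B z b = \<Psi> (gauge_action A z (\<Psi>' b))" unfolding inv'[OF b] .
      then show ?thesis using inv[OF gauge_closed[OF z closed'[OF b]]] by simp
    qed
  qed (fact hom hom' inv inv')+
  show ?thesis by (rule conjugate)
qed

theorem corollary4p2:
  fixes A :: "nat^'i^'i" and B :: "nat^'j^'j"
  assumes "\<forall>i j. A $ i $ j \<in> {0, 1}"
    and "\<forall>i. row i A \<noteq> 0" and "\<forall>j. column j A \<noteq> 0"
    and "\<forall>i j. B $ i $ j \<in> {0, 1}"
    and "\<forall>i. row i B \<noteq> 0" and "\<forall>j. column j B \<noteq> 0"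
  shows "(\<exists>\<Psi>\<in>star_iso (ck_algebra A) (ck_algebra B).
            \<Psi> ` ck_diagonal A = ck_diagonal B \<and>
            (\<forall>z. cmod z = 1 \<longrightarrow>
               (\<forall>a\<in>carrier (ck_algebra A). gauge_action B z (\<Psi> a) = \<Psi> (gauge_action A z a))))
         \<longleftrightarrow> eventually_conjugate A B"
proof -
  have A: "markov_shift A" and B: "markov_shift B" using assms(1,2,4,5) by (simp_all add: markov_shift_def)
  show ?thesis
  proof
    assume "\<exists>\<Psi>\<in>star_iso (ck_algebra A) (ck_algebra B). \<Psi> ` ck_diagonal A = ck_diagonal B \<and>
      (\<forall>z. cmod z = 1 \<longrightarrow> (\<forall>a\<in>carrier (ck_algebra A). gauge_action B z (\<Psi> a) = \<Psi> (gauge_action A z a)))"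
    then show "eventually_conjugate A B"
      by (elim bexE conjE) (rule isomorphic_imp_eventually_conjugate[OF A B])
  qed (rule eventually_conjugate_imp_isomorphic[OF A B])
qed

end
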